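(* Let $b\in\omega$ with $b\geq 2$. Then for all positive reals $\varepsilon,M$ there exists a positive integer $t=t(\varepsilon,M)$ such that for every bounded metric space $(K,d)$ and every $M$-Lipschitz map $c:C^{\uparrow}_{\mathrm{sur}}(b^\omega)\to K$ (with respect to the metric $\rho_\infty$) there exist $h\in C^{\uparrow}_{\mathrm{sur}}(b^\omega)$ and $B\subseteq K$ of $\varepsilon$-covering number at most $t$ such that for every $f\in C^{\uparrow}_{\mathrm{sur}}(b^\omega)$ we have $c(f\circ h)\in B$. In particular, $t(\varepsilon,M)=t\left(\frac{\varepsilon}{2M}\right)$, where for a positive real $\delta$ one writes $t(\delta)=t_{b^k-1}$ with $k=\lfloor\log_2(1/\delta)\rfloor+1$, and $(t_j)_{j\ge 1}$ is the sequence of odd tangent numbers.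
   Context: $\omega=\{0,1,2,\dots\}$. $b^\omega$ is the set of infinite sequences with values in $\{0,\dots,b-1\}$. For distinct $x,y\in b^\omega$, $\rho_b(x,y)=2^{-n_0}$ with $n_0=\min\{n:x(n)\neq y(n)\}$ (and $\rho_b(x,x)=0$). The lexicographic linear order is: $x\leq_{\mathrm{lex}}y$ iff $x=y$ or $x(n_0)<y(n_0)$ with $n_0=\min\{n:x(n)\neq y(n)\}$. $C^{\uparrow}_{\mathrm{sur}}(b^\omega)$ is the set of all maps $f:b^\omega\to b^\omega$ that are continuous, onto and nondecreasing ($x\leq_{\mathrm{lex}}y$ implies $f(x)\leq_{\mathrm{lex}}f(y)$), with metric $\rho_\infty(f,g)=\sup\{\rho_b(f(x),g(x)):x\in b^\omega\}$. For a metric space $(X,d)$, a positive integer $t$ and a positive real $\delta$, a subset $Y\subseteq X$ is of $\delta$-covering number at most $t$ if there is a finite set $A\subseteq X$ of cardinality at most $t$ with $Y\subseteq\bigcup_{x\in A}B_d(x,\delta)$, where $B_d(x,\delta)=\{y\in X:d(x,y)<\delta\}$. The odd tangent numbers are $t_j=\tan^{(2j-1)}(0)$, the value at $0$ of the $(2j-1)$-th derivative of $\tan$, for each positive integer $j$.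
   Formalization: "Bounded metric space" is read as totally bounded, since the claim fails for merely bounded K (e.g. an infinite 0-1 metric space); where ε/(2M) > 1, so that the index b^k-1 is not positive and the formula is undefined, t is taken to be 1. *)

theory Defs
  imports "HOL-Analysis.Analysis"
begin

definition seqs :: "nat \<Rightarrow> (nat \<Rightarrow> nat) set" where
  "seqs b = {x. \<forall>n. x n < b}"

definition first_diff :: "(nat \<Rightarrow> nat) \<Rightarrow> (nat \<Rightarrow> nat) \<Rightarrow> nat" where
  "first_diff x y = (LEAST n. x n \<noteq> y n)"

definition rho :: "(nat \<Rightarrow> nat) \<Rightarrow> (nat \<Rightarrow> nat) \<Rightarrow> real" where
  "rho x y = (if x = y then 0 else (1/2) ^ first_diff x y)"

definition lex_le :: "(nat \<Rightarrow> nat) \<Rightarrow> (nat \<Rightarrow> nat) \<Rightarrow> bool" where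
  "lex_le x y \<longleftrightarrow> x = y \<or> x (first_diff x y) < y (first_diff x y)"

abbreviation seq_top :: "nat \<Rightarrow> (nat \<Rightarrow> nat) topology" where
  "seq_top b \<equiv> Metric_space.mtopology (seqs b) rho"

(* Maps are kept in PiE (undefined outside seqs b), so that HOL equality is
   equality of maps on seqs b; composition is therefore FuncSet.compose. *)
definition Csur :: "nat \<Rightarrow> ((nat \<Rightarrow> nat) \<Rightarrow> (nat \<Rightarrow> nat)) set" where
  "Csur b = {f \<in> seqs b \<rightarrow>\<^sub>E seqs b.
      continuous_map (seq_top b) (seq_top b) f \<and>
      f ` seqs b = seqs b \<and>
      (\<forall>x\<in>seqs b. \<forall>y\<in>seqs b. lex_le x y \<longrightarrow> lex_le (f x) (f y))}"

definition rho_inf :: "nat \<Rightarrow> ((nat \<Rightarrow> nat) \<Rightarrow> (nat \<Rightarrow> nat)) \<Rightarrow> ((nat \<Rightarrow> nat) \<Rightarrow> (nat \<Rightarrow> nat)) \<Rightarrow> real" where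
  "rho_inf b f g = (SUP x\<in>seqs b. rho (f x) (g x))"

(* lipschitz_on is tied to class metric_space and Lipschitz_continuous_map
   leaves the constant existential, hence a carrier-based version. *)
definition Lipschitz_between ::
  "real \<Rightarrow> 'a set \<Rightarrow> ('a \<Rightarrow> 'a \<Rightarrow> real) \<Rightarrow> 'b set \<Rightarrow> ('b \<Rightarrow> 'b \<Rightarrow> real) \<Rightarrow> ('a \<Rightarrow> 'b) \<Rightarrow> bool" where
  "Lipschitz_between L X dX Y dY c \<longleftrightarrow>
     c \<in> X \<rightarrow> Y \<and> (\<forall>x\<in>X. \<forall>y\<in>X. dY (c x) (c y) \<le> L * dX x y)"

(* The target spaces considered are totally bounded. For X merely metrically bounded,
   uniform covering bounds fail: with the 0-1 metric on sets, f |-> {x. f x 0 = 0} is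
   1-Lipschitz on Csur 2, but attains infinitely many values on {f o h | f}, for each h. *)
definition covering_number_le :: "'a set \<Rightarrow> ('a \<Rightarrow> 'a \<Rightarrow> real) \<Rightarrow> real \<Rightarrow> nat \<Rightarrow> 'a set \<Rightarrow> bool" where
  "covering_number_le X d \<delta> t Y \<longleftrightarrow>
     Y \<subseteq> X \<and> (\<exists>A\<subseteq>X. finite A \<and> card A \<le> t \<and> Y \<subseteq> (\<Union>x\<in>A. Metric_space.mball X d x \<delta>))"

definition odd_tangent_number :: "nat \<Rightarrow> real" where
  "odd_tangent_number j = (deriv ^^ (2 * j - 1)) tan 0"

definition level :: "real \<Rightarrow> int" where
  "level \<delta> = \<lfloor>log 2 (1 / \<delta>)\<rfloor> + 1"

(* For \<delta> > 1 the level is \<le> 0 and b^k - 1 is not a valid (positive) index of the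
   sequence of tangent numbers; the value is then taken to be 1. *)
definition tangent_bound :: "nat \<Rightarrow> real \<Rightarrow> real" where
  "tangent_bound b \<delta> =
     (if level \<delta> \<ge> 1 then odd_tangent_number (b ^ nat (level \<delta>) - 1) else 1)"

lemma CsurD:
  assumes "f \<in> Csur b"
  shows "f \<in> seqs b \<rightarrow>\<^sub>E seqs b" "f ` seqs b = seqs b" "\<And>x. x \<in> seqs b \<Longrightarrow> f x \<in> seqs b"
proof -
  show 1: "f \<in> seqs b \<rightarrow>\<^sub>E seqs b" and "f ` seqs b = seqs b"
    using assms by (simp_all add: Csur_def)
  show "f x \<in> seqs b" if "x \<in> seqs b" for x
    using 1 that by (rule PiE_mem)
qed

lemma first_diff_neq: "x \<noteq> y \<Longrightarrow> x (first_diff x y) \<noteq> y (first_diff x y)"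
  unfolding first_diff_def by (rule LeastI_ex) auto

lemma first_diff_eq_below: "n < first_diff x y \<Longrightarrow> x n = y n"
  unfolding first_diff_def using not_less_Least by blast

lemma first_diff_commute: "first_diff x y = first_diff y x"
  unfolding first_diff_def by (rule arg_cong[where f = Least]) auto

lemma rho_nonneg: "0 \<le> rho x y" and rho_le_1: "rho x y \<le> 1"
  by (auto simp: rho_def power_le_one)

lemma rho_commute: "rho x y = rho y x"
  by (auto simp: rho_def first_diff_commute)

lemma rho_eq_0: "rho x y = 0 \<longleftrightarrow> x = y"
  by (simp add: rho_def)

lemma rho_ultra: "rho x z \<le> max (rho x y) (rho y z)"
proof (cases "x = y \<or> y = z \<or> x = z")
  case True
  then show ?thesis using rho_nonneg by (auto simp: rho_def max_def)
next
  case False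
  let ?m = "min (first_diff x y) (first_diff y z)"
  have "?m \<le> first_diff x z"
  proof (rule ccontr)
    assume "\<not> ?m \<le> first_diff x z"
    then have "first_diff x z < first_diff x y" "first_diff x z < first_diff y z" by auto
    then have "x (first_diff x z) = z (first_diff x z)"
      using first_diff_eq_below by metis
    then show False using first_diff_neq False by blast
  qed
  then have "(1/2::real) ^ first_diff x z \<le> (1/2) ^ ?m"
    by (intro power_decreasing) auto
  also have "\<dots> \<le> max ((1/2) ^ first_diff x y) ((1/2) ^ first_diff y z)"
    by (auto simp: min_def)
  finally show ?thesis using False by (simp add: rho_def)
qed

lemma rho_triangle: "rho x z \<le> rho x y + rho y z"
  using rho_ultra[of x z y] rho_nonneg[of x y] rho_nonneg[of y z] by linarith

lemma Metric_space_rho: "Metric_space (seqs b) rho"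
  by unfold_locales (auto simp: rho_nonneg rho_commute rho_eq_0 rho_triangle)

lemma seqs_nonempty: "1 \<le> b \<Longrightarrow> seqs b \<noteq> {}"
  by (auto simp: seqs_def intro!: exI[of _ "\<lambda>_. 0"])

lemma bdd_above_rho: "bdd_above ((\<lambda>x. rho (f x) (g x)) ` A)"
  by (rule bdd_aboveI[of _ 1]) (auto simp: rho_le_1)

lemma rho_le_rho_inf: "x \<in> seqs b \<Longrightarrow> rho (f x) (g x) \<le> rho_inf b f g"
  unfolding rho_inf_def by (intro cSUP_upper bdd_above_rho)

lemma Metric_space_rho_inf:
  assumes "1 \<le> b"
  shows "Metric_space (Csur b) (rho_inf b)"
proof unfold_locales
  note ne = seqs_nonempty[OF assms]
  fix f g h
  show "0 \<le> rho_inf b f g"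
  proof -
    obtain x where "x \<in> seqs b" using ne by auto
    then show ?thesis
      using rho_le_rho_inf[of x b f g] rho_nonneg[of "f x" "g x"] by linarith
  qed
  show "rho_inf b f g = rho_inf b g f"
    by (simp add: rho_inf_def rho_commute)
  show "rho_inf b f g = 0 \<longleftrightarrow> f = g" if "f \<in> Csur b" "g \<in> Csur b"
  proof
    assume "rho_inf b f g = 0"
    then have "f x = g x" if "x \<in> seqs b" for x
      using rho_le_rho_inf[OF that, of f g] rho_nonneg[of "f x" "g x"] rho_eq_0[of "f x" "g x"]
      by linarith
    then show "f = g"
      by (rule PiE_ext[OF CsurD(1)[OF that(1)] CsurD(1)[OF that(2)]])
  next
    assume "f = g"
    then show "rho_inf b f g = 0" using ne by (simp add: rho_inf_def rho_def)
  qed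
  show "rho_inf b f h \<le> rho_inf b f g + rho_inf b g h"
    unfolding rho_inf_def[of b f h]
  proof (rule cSUP_least[OF ne])
    fix x assume "x \<in> seqs b"
    then show "rho (f x) (h x) \<le> rho_inf b f g + rho_inf b g h"
      using rho_triangle[of "f x" "h x" "g x"] rho_le_rho_inf[of x b f g] rho_le_rho_inf[of x b g h]
      by linarith
  qed
qed

lemma Csur_compose:
  assumes f: "f \<in> Csur b" and h: "h \<in> Csur b"
  shows "compose (seqs b) f h \<in> Csur b"
proof -
  interpret S: Metric_space "seqs b" rho by (rule Metric_space_rho)
  have "continuous_map (seq_top b) (seq_top b) (f \<circ> h)"
    using f h by (intro continuous_map_compose[of _ "seq_top b"]) (simp_all add: Csur_def)
  then have "continuous_map (seq_top b) (seq_top b) (compose (seqs b) f h)"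
    by (rule continuous_map_eq) (simp add: compose_eq)
  moreover have hx: "h x \<in> seqs b" if "x \<in> seqs b" for x
    using h that by (rule CsurD(3))
  moreover have fx: "f x \<in> seqs b" if "x \<in> seqs b" for x
    using f that by (rule CsurD(3))
  moreover have "compose (seqs b) f h ` seqs b = seqs b"
  proof -
    have "compose (seqs b) f h ` seqs b = f ` h ` seqs b"
      by (simp add: compose_eq image_image cong: image_cong_simp)
    also have "\<dots> = seqs b" using f h by (simp add: Csur_def)
    finally show ?thesis .
  qed
  moreover have "lex_le (f (h x)) (f (h y))" if "x \<in> seqs b" "y \<in> seqs b" "lex_le x y" for x y
    using f h hx that unfolding Csur_def by simp
  moreover have "compose (seqs b) f h \<in> seqs b \<rightarrow>\<^sub>E seqs b"
    using hx fx by (intro PiE_I) (simp_all add: compose_def)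
  ultimately show ?thesis
    unfolding Csur_def by (simp add: compose_eq)
qed

end

theory Submission
  imports Defs "HOL-Library.Ramsey"
begin

text \<open>A map \<open>f\<close> in \<open>Csur b\<close> has an adjoint on the clopen initial segments of the Cantor order, a
  countable dense linear order whose elements are coded by the nonzero eventually vanishing
  sequences: \<open>z \<le> f x\<close> iff \<open>adj f z \<le> x\<close>. Up to distance \<open>2\<^sup>-\<^sup>k\<close>, \<open>f\<close> is determined by the image
  under \<open>adj f\<close> of the \<open>b\<^sup>k - 1\<close> cuts of length \<open>k\<close>, and every strictly increasing self-map of
  the cuts is the adjoint of some \<open>h\<close>. So, after rounding \<open>c\<close> to a finite net, the claim is
  Devlin's theorem on finite colourings of \<open>n\<close>-subsets of the rationals, \<open>n = b\<^sup>k - 1\<close>.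

  The homogeneous copy of the rationals consists of the leaves of a binary tree in which one event
  (the splitting of a branch or the end of a branch) takes place at a time. Seen from an
  \<open>n\<close>-subset, the tree is a sequence of \<open>2n - 1\<close> events, each of which concerns one of the \<open>m\<close>
  branches currently alive and changes \<open>m\<close> by one. As the derivative of \<open>tan\<^sup>m\<close> is
  \<open>m (tan\<^sup>m\<^sup>-\<^sup>1 + tan\<^sup>m\<^sup>+\<^sup>1)\<close>, the number of such sequences is the odd tangent number of index \<open>n\<close>.

  The words by which the branches grow between events are taken from ultrafilters \<open>p\<close> (all branches
  grow) and \<open>q\<close> (one branch splits) on words over an alphabet of columns, with
  \<open>p p = p\<close>, \<open>p q = q\<close>, with every substitution for the variable sending \<open>q\<close> to \<open>p\<close>, and invariant
  under passing to an increasing subsequence of rows. The colour of a sequence of events is the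
  iterated limit of the colours along \<open>p\<close> and \<open>q\<close>; events that do not concern a given subset leave its
  limit colour unchanged.\<close>

section \<open>Idempotent ultrafilters on words\<close>

definition ultra :: "'a filter \<Rightarrow> bool" where
  "ultra F \<longleftrightarrow> F \<noteq> bot \<and> (\<forall>P. eventually P F \<or> eventually (\<lambda>x. \<not> P x) F)"

lemma ultra_not:
  assumes "ultra F"
  shows "eventually (\<lambda>x. \<not> P x) F \<longleftrightarrow> \<not> eventually P F"
proof -
  have "\<not> (eventually P F \<and> eventually (\<lambda>x. \<not> P x) F)"
    using assms eventually_conj[of P F "\<lambda>x. \<not> P x"]
    by (auto simp: ultra_def trivial_limit_def)
  then show ?thesis
    using assms by (auto simp: ultra_def)
qed

lemma ultra_eq_iff:
  assumes "ultra F"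
  shows "eventually (\<lambda>x. P x = Q x) F \<longleftrightarrow> (eventually P F \<longleftrightarrow> eventually Q F)"
proof
  assume *: "eventually (\<lambda>x. P x = Q x) F"
  show "eventually P F \<longleftrightarrow> eventually Q F"
    using * by (rule eventually_cong) 
next
  assume *: "eventually P F \<longleftrightarrow> eventually Q F"
  show "eventually (\<lambda>x. P x = Q x) F"
  proof (cases "eventually P F")
    case True
    with * have "eventually (\<lambda>x. P x \<and> Q x) F" by (simp add: eventually_conj)
    then show ?thesis by (rule eventually_mono) auto
  next
    case False
    with * have "eventually (\<lambda>x. \<not> P x) F" "eventually (\<lambda>x. \<not> Q x) F"
      by (simp_all add: ultra_not[OF assms])
    then have "eventually (\<lambda>x. \<not> P x \<and> \<not> Q x) F" by (rule eventually_conj)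
    then show ?thesis by (rule eventually_mono) auto
  qed
qed

lemma ultra_leD:
  assumes "F \<le> G" "ultra F" "ultra G"
  shows "F = G"
  unfolding filter_eq_iff
proof (intro allI iffI)
  fix P
  show "eventually P F" if "eventually P G"
    using that assms(1) by (simp add: le_filter_def)
  show "eventually P G" if "eventually P F"
  proof (rule ccontr)
    assume "\<not> eventually P G"
    then have "eventually (\<lambda>x. \<not> P x) F"
      using assms(1) ultra_not[OF assms(3)] by (auto simp: le_filter_def)
    with that show False using ultra_not[OF assms(2)] by blast
  qed
qed

lemma ultra_finite:
  assumes "ultra F" "finite C" "eventually (\<lambda>x. \<exists>c\<in>C. P x c) F"
  shows "\<exists>c\<in>C. eventually (\<lambda>x. P x c) F"
proof (rule ccontr)
  assume "\<not> ?thesis"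
  then have "\<forall>c\<in>C. eventually (\<lambda>x. \<not> P x c) F"
    by (simp add: ultra_not[OF assms(1)])
  then have "eventually (\<lambda>x. \<forall>c\<in>C. \<not> P x c) F"
    by (intro eventually_ball_finite assms) auto
  then have "eventually (\<lambda>x. \<not> (\<exists>c\<in>C. P x c)) F" by simp
  with assms(3) show False using ultra_not[OF assms(1)] by blast
qed

text \<open>Zorn's lemma for nonempty closed sets of ultrafilters: a smaller filter is a smaller
  closed set, and \<open>bot\<close> is the empty one. Compactness enters as the fact that the
  infimum of a chain of proper filters is proper.\<close>

lemma minimal_filter:
  fixes \<Phi> :: "'a filter \<Rightarrow> bool"
  assumes "F0 \<noteq> bot" "\<Phi> F0"
    and Inf: "\<And>C. C \<noteq> {} \<Longrightarrow> (\<And>F. F \<in> C \<Longrightarrow> \<Phi> F) \<Longrightarrow> \<Phi> (Inf C)"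
  obtains F where "F \<le> F0" "F \<noteq> bot" "\<Phi> F" "\<And>G. G \<le> F \<Longrightarrow> G \<noteq> bot \<Longrightarrow> \<Phi> G \<Longrightarrow> G = F"
proof -
  define A where "A = {F. F \<le> F0 \<and> F \<noteq> bot \<and> \<Phi> F}"
  have "\<exists>m\<in>A. \<forall>a\<in>A. a \<le> m \<longrightarrow> a = m"
  proof (rule predicate_Zorn)
    show "partial_order_on A (relation_of (\<lambda>x y. y \<le> x) A)"
      by (rule partial_order_on_relation_ofI) auto
  next
    fix C assume C: "C \<in> Chains (relation_of (\<lambda>x y. y \<le> x) A)"
    then have CA: "C \<subseteq> A" and tot: "\<And>F G. F \<in> C \<Longrightarrow> G \<in> C \<Longrightarrow> F \<le> G \<or> G \<le> F"
      by (auto simp: Chains_def relation_of_def)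
    show "\<exists>u\<in>A. \<forall>a\<in>C. u \<le> a"
    proof (cases "C = {}")
      case True
      then show ?thesis using assms by (auto simp: A_def)
    next
      case False
      have "\<not> eventually (\<lambda>_. False) (Inf C)"
      proof (subst eventually_Inf_base[OF False])
        fix F G assume "F \<in> C" "G \<in> C"
        then show "\<exists>x\<in>C. x \<le> inf F G"
          using tot[of F G] by (metis inf.orderE inf.commute order_refl)
      next
        show "\<not> (\<exists>b\<in>C. eventually (\<lambda>_. False) b)"
          using CA by (auto simp: A_def trivial_limit_def)
      qed
      then have "Inf C \<noteq> bot" by (simp add: trivial_limit_def)
      moreover have "Inf C \<le> F0"
        using False CA by (auto simp: A_def intro: Inf_lower2)
      moreover have "\<Phi> (Inf C)"
        using False CA by (intro Inf) (auto simp: A_def)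
      ultimately have "Inf C \<in> A" by (simp add: A_def)
      then show ?thesis by (auto intro: Inf_lower)
    qed
  qed
  then show ?thesis
    using that by (auto simp: A_def)
qed

lemma ultra_exists:
  assumes "F \<noteq> bot"
  obtains U where "U \<le> F" "ultra U"
proof -
  obtain U where U: "U \<le> F" "U \<noteq> bot" and min: "\<And>G. G \<le> U \<Longrightarrow> G \<noteq> bot \<Longrightarrow> G = U"
    using minimal_filter[of F "\<lambda>_. True"] assms by auto
  have "eventually P U \<or> eventually (\<lambda>x. \<not> P x) U" for P
  proof (cases "inf U (principal {x. P x}) = bot")
    case True
    then have "eventually (\<lambda>_. False) (inf U (principal {x. P x}))" by simp
    then show ?thesis by (simp add: eventually_inf_principal)
  next
    case False
    then have "inf U (principal {x. P x}) = U" by (intro min) auto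
    moreover have "eventually P (inf U (principal {x. P x}))"
      by (simp add: eventually_inf_principal)
    ultimately show ?thesis by simp
  qed
  with U that show ?thesis by (auto simp: ultra_def)
qed

text \<open>If \<open>P\<close> holds eventually in \<open>G\<close> but not in \<open>F\<close>,
  then some ultrafilter below \<open>F\<close> contains the negation of \<open>P\<close>. A filter
  is thus determined by the closed set of ultrafilters below it.\<close>

lemma filter_le_if_ultra_le:
  assumes "\<And>U. ultra U \<Longrightarrow> U \<le> F \<Longrightarrow> U \<le> G"
  shows "F \<le> G"
  unfolding le_filter_def
proof (intro allI impI, rule ccontr)
  fix P assume P: "eventually P G" "\<not> eventually P F"
  then have "inf F (principal {x. \<not> P x}) \<noteq> bot"
    by (auto simp: trivial_limit_def eventually_inf_principal)
  then obtain U where U: "U \<le> inf F (principal {x. \<not> P x})" "ultra U"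
    by (rule ultra_exists)
  then have "eventually (\<lambda>x. \<not> P x) U" by (simp add: le_principal)
  moreover have "U \<le> G" using assms[OF U(2)] U(1) by simp
  then have "eventually P U" using P by (simp add: le_filter_def)
  ultimately show False using ultra_not[OF U(2)] by blast
qed

lemma ultra_filtermap: "ultra F \<Longrightarrow> ultra (filtermap f F)"
  by (auto simp: ultra_def eventually_filtermap filtermap_bot_iff)

text \<open>On ultrafilters this is the extension of concatenation to the Stone-Cech
  compactification of the discrete set of words, with \<open>F\<close> as the outer limit.\<close>

definition fprod :: "'a list filter \<Rightarrow> 'a list filter \<Rightarrow> 'a list filter" (infixl "\<odot>" 70) where
  "F \<odot> G = Abs_filter (\<lambda>P. eventually (\<lambda>x. eventually (\<lambda>y. P (x @ y)) G) F)"

lemma eventually_fprod: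
  "eventually P (F \<odot> G) \<longleftrightarrow> eventually (\<lambda>x. eventually (\<lambda>y. P (x @ y)) G) F"
  unfolding fprod_def
proof (rule eventually_Abs_filter, unfold_locales)
  fix P Q :: "'a list \<Rightarrow> bool"
  assume "eventually (\<lambda>x. eventually (\<lambda>y. P (x @ y)) G) F"
    and "eventually (\<lambda>x. eventually (\<lambda>y. Q (x @ y)) G) F"
  then show "eventually (\<lambda>x. eventually (\<lambda>y. P (x @ y) \<and> Q (x @ y)) G) F"
    by eventually_elim (rule eventually_conj)
next
  fix P Q :: "'a list \<Rightarrow> bool"
  assume *: "\<forall>x. P x \<longrightarrow> Q x"
  assume "eventually (\<lambda>x. eventually (\<lambda>y. P (x @ y)) G) F"
  then show "eventually (\<lambda>x. eventually (\<lambda>y. Q (x @ y)) G) F"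
    by eventually_elim (use * in \<open>auto elim: eventually_mono\<close>)
qed simp

lemma fprod_assoc: "F \<odot> G \<odot> H = F \<odot> (G \<odot> H)"
  by (simp add: filter_eq_iff eventually_fprod)

lemma fprod_mono1: "F \<le> F' \<Longrightarrow> F \<odot> G \<le> F' \<odot> G"
  by (simp add: le_filter_def eventually_fprod)

lemma fprod_neq_bot: "F \<noteq> bot \<Longrightarrow> G \<noteq> bot \<Longrightarrow> F \<odot> G \<noteq> bot"
  by (simp add: trivial_limit_def eventually_fprod)

lemma ultra_fprod:
  assumes "ultra F" "ultra G"
  shows "ultra (F \<odot> G)"
proof -
  have "F \<odot> G \<noteq> bot"
    using assms by (intro fprod_neq_bot) (simp_all add: ultra_def)
  moreover have "eventually P (F \<odot> G) \<or> eventually (\<lambda>x. \<not> P x) (F \<odot> G)" for P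
    using ultra_not[OF assms(1)] ultra_not[OF assms(2)] by (simp add: eventually_fprod)
  ultimately show ?thesis by (simp add: ultra_def)
qed

lemma filtermap_fprod:
  assumes "\<And>x y. f (x @ y) = f x @ f y"
  shows "filtermap f (F \<odot> G) = filtermap f F \<odot> filtermap f G"
  by (simp add: filter_eq_iff eventually_fprod eventually_filtermap assms)

text \<open>Filters stand for closed sets of ultrafilters, so that the compactness arguments need no
  topology; here the closed set is \<open>{v \<le> F. v \<odot> u \<le> w}\<close>.\<close>

definition fquot :: "'a list filter \<Rightarrow> 'a list filter \<Rightarrow> 'a list filter \<Rightarrow> 'a list filter" where
  "fquot F u w = Abs_filter (\<lambda>Q. \<exists>P. eventually P w \<and>
     eventually (\<lambda>x. eventually (\<lambda>y. P (x @ y)) u \<longrightarrow> Q x) F)"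

lemma eventually_fquot:
  "eventually Q (fquot F u w) \<longleftrightarrow> (\<exists>P. eventually P w \<and>
     eventually (\<lambda>x. eventually (\<lambda>y. P (x @ y)) u \<longrightarrow> Q x) F)"
  unfolding fquot_def
proof (rule eventually_Abs_filter, unfold_locales)
  fix Q R :: "'a list \<Rightarrow> bool"
  assume "\<exists>P. eventually P w \<and> eventually (\<lambda>x. eventually (\<lambda>y. P (x @ y)) u \<longrightarrow> Q x) F"
    and "\<exists>P. eventually P w \<and> eventually (\<lambda>x. eventually (\<lambda>y. P (x @ y)) u \<longrightarrow> R x) F"
  then obtain P P' where
    "eventually P w" "eventually (\<lambda>x. eventually (\<lambda>y. P (x @ y)) u \<longrightarrow> Q x) F"
    "eventually P' w" "eventually (\<lambda>x. eventually (\<lambda>y. P' (x @ y)) u \<longrightarrow> R x) F"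
    by blast
  then show "\<exists>P. eventually P w \<and>
    eventually (\<lambda>x. eventually (\<lambda>y. P (x @ y)) u \<longrightarrow> Q x \<and> R x) F"
    by (intro exI[of _ "\<lambda>x. P x \<and> P' x"]) (auto simp: eventually_conj_iff elim: eventually_elim2)
next
  fix Q R :: "'a list \<Rightarrow> bool"
  assume *: "\<forall>x. Q x \<longrightarrow> R x"
  assume "\<exists>P. eventually P w \<and> eventually (\<lambda>x. eventually (\<lambda>y. P (x @ y)) u \<longrightarrow> Q x) F"
  then obtain P where "eventually P w" "eventually (\<lambda>x. eventually (\<lambda>y. P (x @ y)) u \<longrightarrow> Q x) F"
    by blast
  then show "\<exists>P. eventually P w \<and> eventually (\<lambda>x. eventually (\<lambda>y. P (x @ y)) u \<longrightarrow> R x) F"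
    using * by (intro exI[of _ P]) (auto elim: eventually_mono)
qed (auto intro!: exI[of _ "\<lambda>_. True"])

lemma le_fquot_iff: "v \<le> fquot F u w \<longleftrightarrow> v \<le> F \<and> v \<odot> u \<le> w"
proof (intro iffI conjI)
  assume v: "v \<le> fquot F u w"
  show "v \<le> F"
    unfolding le_filter_def
  proof (intro allI impI)
    fix P assume "eventually P F"
    then have "eventually P (fquot F u w)"
      by (auto simp: eventually_fquot intro!: exI[of _ "\<lambda>_. True"] elim: eventually_mono)
    then show "eventually P v" using v by (simp add: le_filter_def)
  qed
  show "v \<odot> u \<le> w"
    unfolding le_filter_def
  proof (intro allI impI)
    fix P assume "eventually P w"
    then have "eventually (\<lambda>x. eventually (\<lambda>y. P (x @ y)) u) (fquot F u w)"
      by (auto simp: eventually_fquot)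
    then show "eventually P (v \<odot> u)" using v by (simp add: le_filter_def eventually_fprod)
  qed
next
  assume v: "v \<le> F \<and> v \<odot> u \<le> w"
  show "v \<le> fquot F u w"
    unfolding le_filter_def eventually_fquot
  proof (intro allI impI, elim exE conjE)
    fix P Q
    assume P: "eventually P w" and Q: "eventually (\<lambda>x. eventually (\<lambda>y. P (x @ y)) u \<longrightarrow> Q x) F"
    have "eventually (\<lambda>x. eventually (\<lambda>y. P (x @ y)) u) v"
      using v P by (auto simp: le_filter_def eventually_fprod)
    moreover have "eventually (\<lambda>x. eventually (\<lambda>y. P (x @ y)) u \<longrightarrow> Q x) v"
      using v Q by (simp add: le_filter_def)
    ultimately show "eventually Q v" by eventually_elim simp
  qed
qed

text \<open>Right multiplication by \<open>u\<close> maps the closed set of \<open>F\<close> onto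
  that of \<open>F \<odot> u\<close>. An empty fibre over \<open>w\<close> would give some
  \<open>P\<close> in \<open>w\<close> whose negation is in \<open>F \<odot> u\<close>, since
  \<open>u\<close> decides the inner predicate.\<close>

lemma le_fprod_factor:
  assumes "ultra u" "ultra w" "w \<le> F \<odot> u"
  obtains v where "ultra v" "v \<le> F" "v \<odot> u = w"
proof -
  have "\<not> eventually (\<lambda>_. False) (fquot F u w)"
  proof
    assume "eventually (\<lambda>_. False) (fquot F u w)"
    then obtain P where P: "eventually P w" "eventually (\<lambda>x. \<not> eventually (\<lambda>y. P (x @ y)) u) F"
      by (auto simp: eventually_fquot)
    then have "eventually (\<lambda>x. \<not> P x) (F \<odot> u)"
      by (simp add: eventually_fprod ultra_not[OF assms(1)])
    with assms(3) have "eventually (\<lambda>x. \<not> P x) w" by (simp add: le_filter_def)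
    with P(1) show False using ultra_not[OF assms(2)] by blast
  qed
  then obtain v where v: "v \<le> fquot F u w" "ultra v"
    using ultra_exists by (auto simp: trivial_limit_def)
  then have "v \<le> F" "v \<odot> u \<le> w" by (simp_all add: le_fquot_iff)
  with v assms that show ?thesis by (meson ultra_fprod ultra_leD)
qed

definition subsemi :: "'a list filter \<Rightarrow> bool" where
  "subsemi F \<longleftrightarrow> (\<forall>u v. ultra u \<longrightarrow> ultra v \<longrightarrow> u \<le> F \<longrightarrow> v \<le> F \<longrightarrow> u \<odot> v \<le> F)"

text \<open>The Ellis-Numakura argument. In a minimal closed subsemigroup \<open>M\<close>,
  minimality gives \<open>M \<odot> u = M\<close>, so the set of \<open>v\<close> in
  \<open>M\<close> with \<open>v \<odot> u = u\<close> is nonempty. It is again a closed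
  subsemigroup, hence all of \<open>M\<close>, and contains \<open>u\<close>.\<close>

lemma ellis:
  assumes "F \<noteq> bot" "subsemi F"
  obtains u where "ultra u" "u \<le> F" "u \<odot> u = u"
proof -
  obtain M where M: "M \<le> F" "M \<noteq> bot" "subsemi M"
    and min: "\<And>G. G \<le> M \<Longrightarrow> G \<noteq> bot \<Longrightarrow> subsemi G \<Longrightarrow> G = M"
  proof (rule minimal_filter[of F subsemi])
    fix C :: "'a list filter set" assume "\<And>F. F \<in> C \<Longrightarrow> subsemi F"
    then show "subsemi (Inf C)" by (auto simp: subsemi_def le_Inf_iff)
  qed (use assms in auto)
  have sub: "u \<odot> v \<le> M" if "ultra u" "ultra v" "u \<le> M" "v \<le> M" for u v
    using M(3) that by (auto simp: subsemi_def)
  obtain u where u: "u \<le> M" "ultra u" using M(2) by (rule ultra_exists)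
  have "M \<odot> u = M"
  proof (rule min)
    show "M \<odot> u \<le> M"
    proof (rule filter_le_if_ultra_le)
      fix w assume "ultra w" "w \<le> M \<odot> u"
      then obtain v where "ultra v" "v \<le> M" "v \<odot> u = w" using u le_fprod_factor by blast
      then show "w \<le> M" using sub u by blast
    qed
    show "M \<odot> u \<noteq> bot" using M(2) u by (intro fprod_neq_bot) (auto simp: ultra_def)
    show "subsemi (M \<odot> u)"
      unfolding subsemi_def
    proof (intro allI impI)
      fix w w' assume w: "ultra w" "ultra w'" "w \<le> M \<odot> u" "w' \<le> M \<odot> u"
      obtain v where v: "ultra v" "v \<le> M" "v \<odot> u = w" using u w le_fprod_factor by blast
      obtain v' where v': "ultra v'" "v' \<le> M" "v' \<odot> u = w'" using u w le_fprod_factor by blast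
      have "w \<odot> w' = v \<odot> u \<odot> v' \<odot> u" using v v' by (simp add: fprod_assoc)
      also have "\<dots> \<le> M \<odot> u"
        using u v v' by (intro fprod_mono1 sub ultra_fprod)
      finally show "w \<odot> w' \<le> M \<odot> u" .
    qed
  qed
  with u obtain v where v: "ultra v" "v \<le> M" "v \<odot> u = u"
    using le_fprod_factor by metis
  have "fquot M u u = M"
  proof (rule min)
    show "fquot M u u \<le> M" using le_fquot_iff[of "fquot M u u" M u u] by simp
    have "v \<le> fquot M u u" using v by (simp add: le_fquot_iff)
    then show "fquot M u u \<noteq> bot" using v by (auto simp: ultra_def le_bot)
    show "subsemi (fquot M u u)"
      unfolding subsemi_def
    proof (intro allI impI)
      fix w w' assume w: "ultra w" "ultra w'" "w \<le> fquot M u u" "w' \<le> fquot M u u"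
      then have "w \<odot> u = u" "w' \<odot> u = u" "w \<le> M" "w' \<le> M"
        using u by (auto simp: le_fquot_iff intro!: ultra_leD ultra_fprod)
      with w show "w \<odot> w' \<le> fquot M u u"
        by (simp add: le_fquot_iff sub fprod_assoc)
    qed
  qed
  then have "u \<odot> u \<le> u" using u le_fquot_iff by metis
  with u have "u \<odot> u = u" by (auto intro: ultra_leD ultra_fprod)
  with u M(1) that show ?thesis by (meson order_trans)
qed

text \<open>The result keeps the option type, so that words with and without the variable lie in one
  semigroup.\<close>

definition subst :: "'l \<Rightarrow> 'l option list \<Rightarrow> 'l option list" where
  "subst a x = map (\<lambda>l. Some (case l of None \<Rightarrow> a | Some f \<Rightarrow> f)) x"

lemma subst_append: "subst a (x @ y) = subst a x @ subst a y"
  by (simp add: subst_def)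

lemma None_notin_subst: "None \<notin> set (subst a x)"
  by (auto simp: subst_def)

lemma subst_id: "None \<notin> set x \<Longrightarrow> subst a x = x"
  unfolding subst_def by (rule map_idI) (metis not_None_eq option.simps(5))

lemma filtermap_subst_id:
  assumes "eventually (\<lambda>x. None \<notin> set x) p"
  shows "filtermap (subst a) p = p"
  unfolding filter_eq_iff eventually_filtermap
proof
  fix P
  show "eventually (\<lambda>x. P (subst a x)) p = eventually P p"
    using assms by (intro eventually_cong[OF eventually_mono[OF assms]]) (auto simp: subst_id)
qed

text \<open>Carlson's argument: below an idempotent \<open>p\<close> in a minimal left ideal of ultrafilters on
  constant words there is an idempotent \<open>q\<close> on variable words, and substitution sends \<open>q\<close> to
  an idempotent below \<open>p\<close>, which is \<open>p\<close> by minimality.\<close>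

lemma variable_ultrafilter_exists:
  obtains q :: "'l option list filter"
  where "ultra q" "eventually (\<lambda>x. None \<in> set x) q"
    "\<And>a b. filtermap (subst a) q = filtermap (subst b) q"
proof -
  define W :: "'l option list filter" where "W = principal {x. None \<notin> set x}"
  define V :: "'l option list filter" where "V = principal {x. None \<in> set x}"
  have leW: "u \<le> W \<longleftrightarrow> eventually (\<lambda>x. None \<notin> set x) u" for u by (simp add: W_def le_principal)
  have leV: "u \<le> V \<longleftrightarrow> eventually (\<lambda>x. None \<in> set x) u" for u by (simp add: V_def le_principal)
  have WW: "u \<odot> v \<le> W" if "u \<le> W" "v \<le> W" for u v
    using that by (auto simp: leW eventually_fprod elim: eventually_mono)
  have VX: "u \<odot> v \<le> V" if "u \<le> V" for u v
    using that unfolding leV eventually_fprod by (rule eventually_mono) simp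
  have XV: "u \<odot> v \<le> V" if "v \<le> V" for u v
    using that by (simp add: leV eventually_fprod eventually_mono)
  \<comment> \<open>Closed left ideals of the semigroup of constant words; \<open>p\<close> is taken
    from a minimal one.\<close>
  define ideal where "ideal F \<longleftrightarrow> (\<forall>u v. ultra u \<longrightarrow> ultra v \<longrightarrow> u \<le> W \<longrightarrow> v \<le> F \<longrightarrow> u \<odot> v \<le> F)"
    for F :: "'l option list filter"
  obtain L where L: "L \<le> W" "L \<noteq> bot" "ideal L"
    and min: "\<And>G. G \<le> L \<Longrightarrow> G \<noteq> bot \<Longrightarrow> ideal G \<Longrightarrow> G = L"
  proof (rule minimal_filter[of W ideal])
    have "[] \<in> {x :: 'l option list. None \<notin> set x}" by simp
    then show "W \<noteq> bot" unfolding W_def principal_eq_bot_iff by blast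
    show "ideal W" by (simp add: ideal_def WW)
    fix C assume "\<And>F. F \<in> C \<Longrightarrow> ideal F"
    then show "ideal (Inf C)" by (auto simp: ideal_def le_Inf_iff)
  qed (use that in auto)
  have idealD: "u \<odot> v \<le> L" if "ultra u" "ultra v" "u \<le> W" "v \<le> L" for u v
    using L(3) that by (auto simp: ideal_def)
  have "subsemi L" using idealD L(1) by (auto simp: subsemi_def)
  then obtain p where p: "ultra p" "p \<le> L" "p \<odot> p = p" using L(2) ellis by blast
  have pW: "p \<le> W" using p L by simp
  \<comment> \<open>Lying below \<open>V \<odot> p\<close> forces \<open>q1 \<odot> p = q1\<close>.
    Multiplying by \<open>p\<close> on the left then yields \<open>q\<close> below \<open>p\<close>
    in the order of idempotents, that is, \<open>p \<odot> q = q \<odot> p = q\<close>.\<close>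
  obtain q1 where q1: "ultra q1" "q1 \<le> V \<odot> p" "q1 \<odot> q1 = q1"
  proof (rule ellis)
    have "[None] \<in> {x :: 'l option list. None \<in> set x}" by simp
    then have "V \<noteq> bot" unfolding V_def principal_eq_bot_iff by blast
    then show "V \<odot> p \<noteq> bot" using p by (intro fprod_neq_bot) (auto simp: ultra_def)
    show "subsemi (V \<odot> p)"
      unfolding subsemi_def
    proof (intro allI impI)
      fix w w' assume w: "ultra w" "ultra w'" "w \<le> V \<odot> p" "w' \<le> V \<odot> p"
      obtain v where v: "ultra v" "v \<le> V" "v \<odot> p = w" using p w le_fprod_factor by blast
      obtain v' where v': "ultra v'" "v' \<le> V" "v' \<odot> p = w'" using p w le_fprod_factor by blast
      have "w \<odot> w' = v \<odot> p \<odot> v' \<odot> p" using v v' by (simp add: fprod_assoc)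
      also have "\<dots> \<le> V \<odot> p" using v' by (intro fprod_mono1 XV)
      finally show "w \<odot> w' \<le> V \<odot> p" .
    qed
  qed
  obtain v where v: "ultra v" "v \<le> V" "v \<odot> p = q1" using p q1 le_fprod_factor by blast
  have q1p: "q1 \<odot> p = q1" using v p by (metis fprod_assoc)
  define q where "q = p \<odot> q1"
  have "q1 \<le> V" using v VX by blast
  then have qV: "q \<le> V" unfolding q_def by (rule XV)
  have q: "ultra q" using p q1 by (simp add: q_def ultra_fprod)
  have pq: "p \<odot> q = q" using p by (simp add: q_def flip: fprod_assoc)
  have qp: "q \<odot> p = q" by (simp add: q_def fprod_assoc q1p)
  have qq: "q \<odot> q = q" by (metis fprod_assoc q1(3) q1p q_def)
  have "filtermap (subst a) q = p" for a
  proof -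
    define s where "s = filtermap (subst a) q"
    have s: "ultra s" using q by (simp add: s_def ultra_filtermap)
    have sW: "s \<le> W" by (simp add: leW s_def eventually_filtermap None_notin_subst)
    have p': "filtermap (subst a) p = p" using pW by (simp add: filtermap_subst_id leW)
    have ss: "s \<odot> s = s" "p \<odot> s = s" "s \<odot> p = s"
      using qq pq qp p' by (simp_all add: s_def flip: filtermap_fprod[OF subst_append])
         (metis filtermap_fprod subst_append)+
    have sL: "s \<le> L" using idealD[of s p] s sW p ss by simp
    \<comment> \<open>A closed left ideal inside the minimal one is all of it. Hence
      \<open>p\<close> is a left multiple of \<open>s\<close>, which gives
      \<open>p \<odot> s = p\<close>, while \<open>p \<odot> s = s\<close> holds because
      substitution is a homomorphism fixing \<open>p\<close>.\<close>
    have "W \<odot> s = L"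
    proof (rule min)
      show "W \<odot> s \<le> L"
      proof (rule filter_le_if_ultra_le)
        fix w assume "ultra w" "w \<le> W \<odot> s"
        then obtain v where "ultra v" "v \<le> W" "v \<odot> s = w" using s le_fprod_factor by blast
        then show "w \<le> L" using idealD s sL by blast
      qed
      show "W \<odot> s \<noteq> bot" using L s by (intro fprod_neq_bot) (auto simp: ultra_def le_bot)
      show "ideal (W \<odot> s)"
        unfolding ideal_def
      proof (intro allI impI)
        fix u w assume uw: "ultra u" "ultra w" "u \<le> W" "w \<le> W \<odot> s"
        then obtain v where v: "ultra v" "v \<le> W" "v \<odot> s = w" using s le_fprod_factor by blast
        have "u \<odot> w = u \<odot> v \<odot> s" using v by (simp add: fprod_assoc)
        also have "\<dots> \<le> W \<odot> s" using v uw by (intro fprod_mono1 WW)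
        finally show "u \<odot> w \<le> W \<odot> s" .
      qed
    qed
    then obtain t where "ultra t" "t \<odot> s = p" using p s le_fprod_factor by metis
    then have "p \<odot> s = p" using ss by (metis fprod_assoc)
    with ss show ?thesis by (simp add: s_def)
  qed
  with q qV that show ?thesis by (auto simp: leV)
qed

section \<open>Ultrafilters invariant under the choice of rows\<close>

text \<open>A letter is a column of bits, one for each row; \<open>None\<close> is the variable.\<close>

type_synonym word = "(nat \<Rightarrow> bool) option list"

definition reindex :: "(nat \<Rightarrow> nat) \<Rightarrow> word \<Rightarrow> word" where
  "reindex \<alpha> x = map (map_option (\<lambda>f. f \<circ> \<alpha>)) x"

definition rows_below :: "nat \<Rightarrow> word \<Rightarrow> word" where
  "rows_below k x = map (map_option (\<lambda>f i. i < k \<and> f i)) x"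

text \<open>Invariance can only be asked for predicates depending on finitely many rows, since it comes
  from Ramsey's theorem for sets of rows of bounded size.\<close>

definition cyl :: "nat \<Rightarrow> (word \<Rightarrow> 'c) \<Rightarrow> bool" where
  "cyl k R \<longleftrightarrow> (\<forall>x. R (rows_below k x) = R x)"

lemma reindex_append: "reindex \<alpha> (x @ y) = reindex \<alpha> x @ reindex \<alpha> y"
  by (simp add: reindex_def)

lemma reindex_reindex: "reindex \<alpha> (reindex \<beta> x) = reindex (\<beta> \<circ> \<alpha>) x"
  by (simp add: reindex_def option.map_comp comp_def)

lemma rows_below_append: "rows_below k (x @ y) = rows_below k x @ rows_below k y"
  by (simp add: rows_below_def)

lemma rows_below_idem: "rows_below k (rows_below k x) = rows_below k x"
  by (simp add: rows_below_def option.map_comp comp_def cong: conj_cong)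

lemma rows_below_reindex_cong:
  assumes "\<And>i. i < k \<Longrightarrow> \<alpha> i = \<beta> i"
  shows "rows_below k (reindex \<alpha> x) = rows_below k (reindex \<beta> x)"
proof -
  have "(\<lambda>i. i < k \<and> f (\<alpha> i)) = (\<lambda>i. i < k \<and> f (\<beta> i))" for f :: "nat \<Rightarrow> bool"
    using assms by auto
  then show ?thesis by (simp add: rows_below_def reindex_def option.map_comp comp_def)
qed

lemma rows_below_subst_rows_below: "rows_below k (subst a (rows_below k x)) = rows_below k (subst a x)"
  by (auto simp: rows_below_def subst_def split: option.splits)

lemma reindex_subst: "reindex \<alpha> (subst a x) = subst (a \<circ> \<alpha>) (reindex \<alpha> x)"
  by (auto simp: reindex_def subst_def split: option.splits)

lemma None_in_reindex: "None \<in> set (reindex \<alpha> x) \<longleftrightarrow> None \<in> set x"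
  by (force simp: reindex_def image_iff)

lemma cyl_reindex_cong:
  assumes "cyl k R" "\<And>i. i < k \<Longrightarrow> \<alpha> i = \<beta> i"
  shows "R (reindex \<alpha> x) = R (reindex \<beta> x)"
  using assms rows_below_reindex_cong[of k \<alpha> \<beta> x] unfolding cyl_def by metis

lemma cyl_append: "cyl k R \<Longrightarrow> cyl k (\<lambda>y. R (x @ y))"
  unfolding cyl_def by (metis rows_below_append rows_below_idem)

lemma cyl_eventually_append:
  assumes "cyl k R"
  shows "cyl k (\<lambda>x. eventually (\<lambda>y. R (x @ y)) F)"
proof -
  have "R (rows_below k x @ y) = R (x @ y)" for x y
    using assms unfolding cyl_def by (metis rows_below_append rows_below_idem)
  then show ?thesis by (simp add: cyl_def)
qed

lemma cyl_subst: "cyl k R \<Longrightarrow> cyl k (\<lambda>x. R (subst a x))"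
  unfolding cyl_def by (metis rows_below_subst_rows_below)

section \<open>Passing to increasing sequences of rows\<close>

definition invar :: "word filter \<Rightarrow> (word \<Rightarrow> bool) \<Rightarrow> bool" where
  "invar F R \<longleftrightarrow> (\<forall>\<alpha>. strict_mono \<alpha> \<longrightarrow>
     eventually (\<lambda>x. R (reindex \<alpha> x)) F = eventually R F)"

lemma invar_filtermap_reindex:
  assumes "invar F R" "strict_mono \<gamma>"
  shows "invar (filtermap (reindex \<gamma>) F) R"
  using assms unfolding invar_def
  by (simp add: eventually_filtermap reindex_reindex strict_mono_o)

lemma sorted_list_of_image_strict_mono:
  assumes "strict_mono (\<alpha> :: nat \<Rightarrow> nat)"
  shows "sorted_list_of_set (\<alpha> ` {..<k}) = map \<alpha> [0..<k]"
proof -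
  have "sorted_wrt (<) (map \<alpha> [0..<k])"
    using assms by (simp add: sorted_wrt_map strict_mono_less)
  moreover have "set (map \<alpha> [0..<k]) = \<alpha> ` {..<k}"
    by (simp add: lessThan_atLeast0)
  ultimately show ?thesis
    by (metis strict_sorted_equal finite_imageI finite_lessThan set_sorted_list_of_set strict_sorted_list_of_set)
qed

text \<open>Ramsey's theorem for \<open>k\<close>-subsets of the rows, coloured by whether
  \<open>R\<close> holds eventually when the word is read in these rows; \<open>\<gamma>\<close>
  enumerates the homogeneous set.\<close>

lemma invar_single:
  assumes "cyl k R"
  obtains \<gamma> where "strict_mono \<gamma>" "invar (filtermap (reindex \<gamma>) F) R"
proof -
  define en where "en S i = sorted_list_of_set S ! i" for S :: "nat set" and i
  define f :: "nat set \<Rightarrow> nat"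
    where "f S = of_bool (eventually (\<lambda>x. R (reindex (en S) x)) F)" for S
  have less_2: "f S < 2" for S by (simp add: f_def)
  obtain Y t where Y: "infinite Y" and t: "\<And>X. X \<subseteq> Y \<Longrightarrow> finite X \<Longrightarrow> card X = k \<Longrightarrow> f X = t"
    using Ramsey[of "UNIV :: nat set" k f 2] less_2 by auto
  define \<gamma> where "\<gamma> = enumerate Y"
  have \<gamma>: "strict_mono \<gamma>" unfolding \<gamma>_def using Y by (rule strict_mono_enumerate)
  have col: "of_bool (eventually (\<lambda>x. R (reindex (\<gamma> \<circ> \<alpha>) x)) F) = t"
    if "strict_mono \<alpha>" for \<alpha>
  proof -
    have mono: "strict_mono (\<gamma> \<circ> \<alpha>)" using \<gamma> that by (rule strict_mono_o)
    let ?S = "(\<gamma> \<circ> \<alpha>) ` {..<k}"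
    have "f ?S = t"
    proof (rule t)
      show "?S \<subseteq> Y" using Y by (auto simp: \<gamma>_def enumerate_in_set)
      show "card ?S = k"
        using card_image[OF inj_on_subset[OF strict_mono_imp_inj_on[OF mono] subset_UNIV]] by simp
    qed simp
    \<comment> \<open>From index \<open>k\<close> on, \<open>en ?S\<close> is out of the range of a
      list of length \<open>k\<close>; the cylinder condition makes these rows irrelevant.\<close>
    moreover have "R (reindex (en ?S) x) = R (reindex (\<gamma> \<circ> \<alpha>) x)" for x
      using assms by (rule cyl_reindex_cong)
        (simp only: en_def sorted_list_of_image_strict_mono[OF mono], simp)
    ultimately show ?thesis by (simp add: f_def)
  qed
  have "invar (filtermap (reindex \<gamma>) F) R"
    unfolding invar_def eventually_filtermap reindex_reindex
  proof (intro allI impI)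
    fix \<alpha> :: "nat \<Rightarrow> nat" assume "strict_mono \<alpha>"
    then have "of_bool (eventually (\<lambda>x. R (reindex (\<gamma> \<circ> \<alpha>) x)) F) = t" by (rule col)
    moreover have "strict_mono (id :: nat \<Rightarrow> nat)" by (simp add: strict_mono_def)
    then have "of_bool (eventually (\<lambda>x. R (reindex \<gamma> x)) F) = t" using col by force
    ultimately show "eventually (\<lambda>x. R (reindex (\<gamma> \<circ> \<alpha>) x)) F = eventually (\<lambda>x. R (reindex \<gamma> x)) F"
      by (metis of_bool_eq_iff)
  qed
  with \<gamma> that show ?thesis by blast
qed

text \<open>The predicates are treated one after another; invariance already obtained survives a
  further reindexing by an increasing map.\<close>

lemma invar_finite:
  assumes "finite \<R>" "\<And>R. R \<in> \<R> \<Longrightarrow> \<exists>k. cyl k R"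
  shows "\<exists>\<beta>. strict_mono \<beta> \<and> (\<forall>R\<in>\<R>. invar (filtermap (reindex \<beta>) F) R)"
  using assms
proof (induction \<R>)
  case empty
  have "strict_mono (id :: nat \<Rightarrow> nat)" by (simp add: strict_mono_def)
  then show ?case by blast
next
  case (insert R \<R>)
  then obtain \<beta> where \<beta>: "strict_mono \<beta>" "\<forall>R\<in>\<R>. invar (filtermap (reindex \<beta>) F) R" by auto
  obtain k where "cyl k R" using insert.prems by auto
  then obtain \<gamma> where \<gamma>: "strict_mono \<gamma>"
    "invar (filtermap (reindex \<gamma>) (filtermap (reindex \<beta>) F)) R"
    using invar_single by blast
  have eq: "filtermap (reindex \<gamma>) (filtermap (reindex \<beta>) F) = filtermap (reindex (\<beta> \<circ> \<gamma>)) F"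
    by (simp add: filtermap_filtermap reindex_reindex)
  have "\<forall>R\<in>insert R \<R>. invar (filtermap (reindex (\<beta> \<circ> \<gamma>)) F) R"
    using \<beta> \<gamma> invar_filtermap_reindex unfolding eq[symmetric] by auto
  moreover have "strict_mono (\<beta> \<circ> \<gamma>)" using \<beta> \<gamma> by (intro strict_mono_o)
  ultimately show ?case by blast
qed

text \<open>Invariance of \<open>v\<close> is used for each fixed left factor, that of
  \<open>u\<close> for the predicate left by the inner limit; both are cylinders for the same
  \<open>k\<close>.\<close>

lemma invar_fprod:
  assumes "\<And>k R. cyl k R \<Longrightarrow> invar u R" "\<And>k R. cyl k R \<Longrightarrow> invar v R" "cyl k R"
  shows "invar (u \<odot> v) R"
  unfolding invar_def
proof (intro allI impI)
  fix \<alpha> :: "nat \<Rightarrow> nat" assume \<alpha>: "strict_mono \<alpha>"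
  have "eventually (\<lambda>y. R (x @ reindex \<alpha> y)) v = eventually (\<lambda>y. R (x @ y)) v" for x
    using assms(2)[OF cyl_append[OF assms(3), of x]] \<alpha> by (auto simp: invar_def)
  then have "eventually (\<lambda>x. R (reindex \<alpha> x)) (u \<odot> v) =
      eventually (\<lambda>x. eventually (\<lambda>y. R (reindex \<alpha> x @ y)) v) u"
    by (simp add: eventually_fprod reindex_append)
  also have "\<dots> = eventually (\<lambda>x. eventually (\<lambda>y. R (x @ y)) v) u"
    using assms(1)[OF cyl_eventually_append[OF assms(3)]] \<alpha> by (auto simp: invar_def)
  finally show "eventually (\<lambda>x. R (reindex \<alpha> x)) (u \<odot> v) = eventually R (u \<odot> v)"
    by (simp add: eventually_fprod)
qed

locale splitting_pair =
  fixes p q :: "word filter"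
  assumes ultra_p: "ultra p" and ultra_q: "ultra q"
    and pp: "p \<odot> p = p" and pq: "p \<odot> q = q"
    and var: "eventually (\<lambda>x. None \<in> set x) q"
    and subst_q: "\<And>a. filtermap (subst a) q = p"
    and invar_p: "\<And>k R. cyl k R \<Longrightarrow> invar p R"
    and invar_q: "\<And>k R. cyl k R \<Longrightarrow> invar q R"

text \<open>These conditions are preserved by products and cut out a closed set of ultrafilters, so
  that an idempotent \<open>q\<close> can be found among them; its common image under all
  substitutions then serves as \<open>p\<close>.\<close>

definition coherent :: "word filter \<Rightarrow> bool" where
  "coherent q \<longleftrightarrow> eventually (\<lambda>x. None \<in> set x) q \<and>
     (\<forall>a b. filtermap (subst a) q = filtermap (subst b) q) \<and> (\<forall>k R. cyl k R \<longrightarrow> invar q R)"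

lemma coherent_fprod:
  assumes "ultra u" "ultra v" "coherent u" "coherent v"
  shows "coherent (u \<odot> v)"
  unfolding coherent_def
proof (intro conjI allI impI)
  show "eventually (\<lambda>x. None \<in> set x) (u \<odot> v)"
    using assms(3) unfolding eventually_fprod coherent_def by (auto elim: eventually_mono)
  show "filtermap (subst a) (u \<odot> v) = filtermap (subst b) (u \<odot> v)" for a b
    using assms(3,4) unfolding filtermap_fprod[OF subst_append] coherent_def by metis
  fix k and R :: "word \<Rightarrow> bool" assume R: "cyl k R"
  then show "invar (u \<odot> v) R"
    using assms(3,4) by (intro invar_fprod) (auto simp: coherent_def)
qed

text \<open>For an ultrafilter, agreement of two limits is an eventual equality, so coherence says
  that every member of \<open>\<P>\<close> holds eventually. By compactness only finitely many
  members have to be satisfied at once, which a variable ultrafilter does after a suitable choice of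
  rows.\<close>

lemma filter_of_coherent:
  obtains F where "F \<noteq> bot" "\<And>q. ultra q \<Longrightarrow> q \<le> F \<longleftrightarrow> coherent q"
proof -
  define \<P> :: "(word \<Rightarrow> bool) set" where "\<P> = {\<lambda>x. None \<in> set x}
     \<union> (\<Union>a b. range (\<lambda>(R :: word \<Rightarrow> bool) x. R (subst a x) = R (subst b x)))
     \<union> (\<Union>k. \<Union>R :: word \<Rightarrow> bool\<in>Collect (cyl k). (\<lambda>\<alpha> x. R (reindex \<alpha> x) = R x) ` Collect strict_mono)"
  define F where "F = (INF P\<in>\<P>. principal {x. P x})"
  have le: "q \<le> F \<longleftrightarrow> coherent q" if "ultra q" for q
  proof -
    have "q \<le> F \<longleftrightarrow> (\<forall>P\<in>\<P>. eventually P q)"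
      by (simp add: F_def le_INF_iff le_principal)
    also have "\<dots> \<longleftrightarrow> eventually (\<lambda>x. None \<in> set x) q \<and>
       (\<forall>a b (R :: word \<Rightarrow> bool). eventually (\<lambda>x. R (subst a x) = R (subst b x)) q) \<and>
       (\<forall>k (R :: word \<Rightarrow> bool). cyl k R \<longrightarrow> (\<forall>\<alpha>. strict_mono \<alpha> \<longrightarrow> eventually (\<lambda>x. R (reindex \<alpha> x) = R x) q))"
      unfolding \<P>_def by (simp only: ball_Un ball_UN ball_simps UNIV_I simp_thms mem_Collect_eq conj_assoc)
    also have "\<dots> \<longleftrightarrow> coherent q"
      unfolding coherent_def ultra_eq_iff[OF that] filter_eq_iff eventually_filtermap invar_def
      by (rule refl)
    finally show ?thesis .
  qed
  have "F \<noteq> bot"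
  proof
    assume "F = bot"
    then have "eventually (\<lambda>_. False) F" by simp
    then obtain X where X: "X \<subseteq> \<P>" "finite X" "(INF P\<in>X. principal {x. P x}) = bot"
      unfolding F_def by (subst (asm) eventually_INF) (auto simp: trivial_limit_def)
    \<comment> \<open>One member of \<open>\<P>\<close> may arise from several pairs of a predicate
      and a map of rows; \<open>r\<close> selects one predicate for each of the finitely many
      members of \<open>Y\<close>.\<close>
    define inst :: "(word \<Rightarrow> bool) \<Rightarrow> (word \<Rightarrow> bool) \<Rightarrow> bool" where "inst P R \<longleftrightarrow>
      (\<exists>\<alpha>. P = (\<lambda>x. R (reindex \<alpha> x) = R x) \<and> strict_mono \<alpha> \<and> (\<exists>k. cyl k R))" for P R
    define Y where "Y = {P\<in>X. \<exists>R. inst P R}"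
    have "\<forall>P\<in>Y. \<exists>R. inst P R" by (simp add: Y_def)
    then obtain r where r: "\<forall>P\<in>Y. inst P (r P)" by metis
    obtain q0 :: "word filter" where q0: "ultra q0" "eventually (\<lambda>x. None \<in> set x) q0"
      "\<And>a b. filtermap (subst a) q0 = filtermap (subst b) q0"
      using variable_ultrafilter_exists by blast
    have "finite (r ` Y)" using X(2) by (simp add: Y_def)
    then obtain \<beta> where \<beta>: "strict_mono \<beta>" "\<forall>R\<in>r ` Y. invar (filtermap (reindex \<beta>) q0) R"
      using invar_finite[of "r ` Y" q0] r by (auto simp: inst_def)
    define q where "q = filtermap (reindex \<beta>) q0"
    have q: "ultra q" using q0 by (simp add: q_def ultra_filtermap)
    have "eventually P q" if "P \<in> X" for P
    proof -
      from that X have "P \<in> \<P>" by blast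
      then show ?thesis
        unfolding \<P>_def
      proof (elim UnE UN_E imageE)
        assume "P \<in> {\<lambda>x. None \<in> set x}"
        then show ?thesis using q0 by (simp add: q_def eventually_filtermap None_in_reindex)
      next
        fix a b and R :: "word \<Rightarrow> bool" assume P: "P = (\<lambda>x. R (subst a x) = R (subst b x))"
        have inj: "inj \<beta>" using \<beta>(1) by (rule strict_mono_imp_inj_on)
        \<comment> \<open>As \<open>\<beta>\<close> is injective, \<open>a\<close> equals
          \<open>a \<circ> inv \<beta> \<circ> \<beta>\<close>: substituting after the choice of
          rows amounts to substituting another letter before it.\<close>
        have *: "filtermap (subst a) q = filtermap (reindex \<beta>) (filtermap (subst (a \<circ> inv \<beta>)) q0)" for a
          using inj by (simp add: q_def filtermap_filtermap reindex_subst comp_assoc)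
        have "filtermap (subst a) q = filtermap (subst b) q"
          unfolding * using q0(3) by metis
        then show ?thesis
          unfolding P ultra_eq_iff[OF q] by (metis eventually_filtermap)
      next
        fix k and R :: "word \<Rightarrow> bool" and \<alpha>
        assume P: "P = (\<lambda>x. R (reindex \<alpha> x) = R x)" and "R \<in> Collect (cyl k)" "\<alpha> \<in> Collect strict_mono"
        then have "inst P R" unfolding inst_def by blast
        with that have "P \<in> Y" by (auto simp: Y_def)
        then obtain \<alpha> where \<alpha>: "P = (\<lambda>x. r P (reindex \<alpha> x) = r P x)" "strict_mono \<alpha>"
          using r unfolding inst_def by blast
        have "invar q (r P)" using \<beta> \<open>P \<in> Y\<close> by (simp add: q_def)
        then have "eventually (\<lambda>x. r P (reindex \<alpha> x) = r P x) q"
          using \<alpha>(2) by (simp add: ultra_eq_iff[OF q] invar_def)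
        then show ?thesis using \<alpha>(1) by simp
      qed
    qed
    then have "q \<le> (INF P\<in>X. principal {x. P x})"
      by (simp add: le_INF_iff le_principal)
    then show False using q X(3) by (simp add: ultra_def le_bot)
  qed
  with le that show ?thesis by blast
qed

lemma splitting_pair_exists: "\<exists>p q. splitting_pair p q"
proof -
  obtain F where F: "F \<noteq> bot" "\<And>q. ultra q \<Longrightarrow> q \<le> F \<longleftrightarrow> coherent q"
    using filter_of_coherent by blast
  have "subsemi F"
    using F(2) by (auto simp: subsemi_def coherent_fprod ultra_fprod)
  with F(1) obtain q where q: "ultra q" "q \<le> F" "q \<odot> q = q" using ellis by blast
  then have coh: "coherent q" using F by blast
  define p where "p = filtermap (subst (\<lambda>_. False)) q"
  have p: "ultra p" using q by (simp add: p_def ultra_filtermap)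
  have sp: "filtermap (subst a) q = p" for a using coh by (simp add: coherent_def p_def)
  have pp: "p \<odot> p = p"
    using q(3) by (simp add: p_def flip: filtermap_fprod[OF subst_append])
  have invp: "invar p R" if "cyl k R" for k R
    unfolding invar_def
  proof (intro allI impI)
    fix \<alpha> :: "nat \<Rightarrow> nat" assume \<alpha>: "strict_mono \<alpha>"
    have "eventually (\<lambda>x. R (reindex \<alpha> x)) p =
        eventually (\<lambda>x. R (subst (\<lambda>_. False) (reindex \<alpha> x))) q"
      by (simp add: p_def eventually_filtermap reindex_subst comp_def)
    also have "\<dots> = eventually (\<lambda>x. R (subst (\<lambda>_. False) x)) q"
    proof -
      have "invar q (\<lambda>x. R (subst (\<lambda>_. False) x))"
        using coh cyl_subst[OF that] unfolding coherent_def by blast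
      then show ?thesis using \<alpha> unfolding invar_def by blast
    qed
    finally show "eventually (\<lambda>x. R (reindex \<alpha> x)) p = eventually R p"
      by (simp add: p_def eventually_filtermap)
  qed
  \<comment> \<open>Left multiplication by \<open>p\<close> makes \<open>p \<odot> q' = q'\<close>
    true. Substitution still yields \<open>p\<close>, since it fixes \<open>p\<close> and
    \<open>p \<odot> p = p\<close>.\<close>
  define q' where "q' = p \<odot> q"
  have spp: "filtermap (subst a) p = p" for a
    by (rule filtermap_subst_id) (simp add: p_def eventually_filtermap None_notin_subst)
  have "splitting_pair p q'"
  proof
    show "ultra p" "p \<odot> p = p" by fact+
    show "ultra q'" using p q by (simp add: q'_def ultra_fprod)
    show "p \<odot> q' = q'" by (simp add: q'_def pp flip: fprod_assoc)
    show "eventually (\<lambda>x. None \<in> set x) q'"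
      using coh by (simp add: q'_def coherent_def eventually_fprod eventually_mono)
    show "filtermap (subst a) q' = p" for a
      by (simp add: q'_def filtermap_fprod[OF subst_append] sp spp pp)
    show "invar p R" if "cyl k R" for k R using that by (rule invp)
    show "invar q' R" if R: "cyl k R" for k R
      unfolding q'_def using coh R by (intro invar_fprod[of p q, OF invp]) (auto simp: coherent_def)
  qed
  then show ?thesis by blast
qed

section \<open>Sequences of events\<close>

definition row_of :: "nat \<Rightarrow> bool \<Rightarrow> word \<Rightarrow> bool list" where
  "row_of i c x = map (\<lambda>l. case l of None \<Rightarrow> c | Some f \<Rightarrow> f i) x"

lemma row_append: "row_of i c (x @ y) = row_of i c x @ row_of i c y"
  by (simp add: row_of_def)

lemma row_reindex: "row_of i c (reindex \<alpha> x) = row_of (\<alpha> i) c x"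
  by (auto simp: row_of_def reindex_def split: option.splits)

lemma row_subst: "row_of i c (subst s x) = row_of i (s i) x"
  by (auto simp: row_of_def subst_def split: option.splits)

lemma row_rows_below: "i < k \<Longrightarrow> row_of i c (rows_below k x) = row_of i c x"
  by (auto simp: row_of_def rows_below_def split: option.splits)

lemma row_const: "None \<notin> set x \<Longrightarrow> row_of i c x = row_of i c' x"
  by (auto simp: row_of_def split: option.splits)

section \<open>Growing, splitting and removing branches\<close>

definition ext :: "word \<Rightarrow> (nat \<Rightarrow> bool list) \<Rightarrow> nat \<Rightarrow> bool list" where
  "ext x A i = A i @ row_of i False x"

text \<open>Row \<open>j\<close> is doubled; the variable becomes \<open>0\<close> in the rows up to the lower copy and \<open>1\<close> in the
  rows from the upper copy on. A set of rows avoiding one of the two copies thus sees a variable-free word.\<close>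

definition split :: "nat \<Rightarrow> word \<Rightarrow> (nat \<Rightarrow> bool list) \<Rightarrow> nat \<Rightarrow> bool list" where
  "split j x A i = (if i \<le> j then A i @ row_of i False x else A (i - 1) @ row_of (i - 1) True x)"

definition skip :: "nat \<Rightarrow> nat \<Rightarrow> nat" where
  "skip j i = (if i < j then i else Suc i)"

definition drop_row :: "nat \<Rightarrow> (nat \<Rightarrow> 'a) \<Rightarrow> nat \<Rightarrow> 'a" where
  "drop_row j A i = A (skip j i)"

datatype event = Split nat | End nat

text \<open>The number argument counts the branches alive. From one branch to none, a sequence with
  \<open>n\<close> ends has \<open>n - 1\<close> splits, hence length
  \<open>2 * n - 1\<close>.\<close>

fun wf_events :: "event list \<Rightarrow> nat \<Rightarrow> bool" where
  "wf_events [] m \<longleftrightarrow> m = 0"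
| "wf_events (Split j # \<tau>) m \<longleftrightarrow> j < m \<and> wf_events \<tau> (m + 1)"
| "wf_events (End j # \<tau>) m \<longleftrightarrow> j < m \<and> wf_events \<tau> (m - 1)"

text \<open>This is the value at 0 of the \<open>N\<close>-th derivative of \<open>tan ^ m\<close>,
  see \<open>tan_deriv_poly_0\<close>. For \<open>m = 0\<close> the factor \<open>m\<close>
  annihilates the term with the truncated \<open>m - 1\<close>.\<close>

fun path_count :: "nat \<Rightarrow> nat \<Rightarrow> nat" where
  "path_count 0 m = (if m = 0 then 1 else 0)"
| "path_count (Suc N) m = m * (path_count N (m - 1) + path_count N (m + 1))"

lemma card_wf_events:
  "finite {\<tau>. wf_events \<tau> m \<and> length \<tau> = N} \<and> card {\<tau>. wf_events \<tau> m \<and> length \<tau> = N} \<le> path_count N m"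
proof (induction N arbitrary: m)
  case 0
  have "{\<tau>. wf_events \<tau> m \<and> length \<tau> = 0} = (if m = 0 then {[]} else {})" by auto
  then show ?case by simp
next
  case (Suc N)
  let ?E = "\<lambda>N m. {\<tau>. wf_events \<tau> m \<and> length \<tau> = N}"
  let ?S = "(\<lambda>(j, \<tau>). Split j # \<tau>) ` ({..<m} \<times> ?E N (m + 1))"
  let ?T = "(\<lambda>(j, \<tau>). End j # \<tau>) ` ({..<m} \<times> ?E N (m - 1))"
  have eq: "?E (Suc N) m = ?S \<union> ?T"
  proof (intro equalityI subsetI)
    fix \<tau> assume "\<tau> \<in> ?E (Suc N) m"
    then obtain e \<tau>' where "\<tau> = e # \<tau>'" "wf_events (e # \<tau>') m" "length \<tau>' = N"
      by (auto simp: length_Suc_conv)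
    then show "\<tau> \<in> ?S \<union> ?T" by (cases e) (auto simp: image_iff)
  qed auto
  have fin: "finite ?S" "finite ?T" using Suc.IH by auto
  have "card ?S \<le> m * path_count N (m + 1)"
    using Suc.IH[of "m + 1"] card_image_le[of "{..<m} \<times> ?E N (m + 1)"]
    by (auto simp: card_cartesian_product intro: order_trans mult_le_mono)
  moreover have "card ?T \<le> m * path_count N (m - 1)"
    using Suc.IH[of "m - 1"] card_image_le[of "{..<m} \<times> ?E N (m - 1)"]
    by (auto simp: card_cartesian_product intro: order_trans mult_le_mono)
  ultimately have "card (?S \<union> ?T) \<le> path_count (Suc N) m"
    using card_Un_le[of ?S ?T] by (simp add: add_mult_distrib2)
  then show ?case using eq fin by simp
qed

text \<open>Demanding an actual branching, not only lexicographic precedence, makes the relation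
  survive arbitrary extensions of both words.\<close>

definition lex_left :: "bool list \<Rightarrow> bool list \<Rightarrow> bool" where
  "lex_left u w \<longleftrightarrow> (\<exists>r u' w'. u = r @ False # u' \<and> w = r @ True # w')"

lemma lex_left_append: "lex_left u w \<Longrightarrow> lex_left (u @ a) (w @ b)"
  unfolding lex_left_def by force

lemma lex_left_prefix: "lex_left u w \<Longrightarrow> lex_left (r @ u) (r @ w)"
  unfolding lex_left_def by (metis append_assoc)

text \<open>The two readings branch at the first variable of \<open>x\<close>; before it the word is
  constant.\<close>

lemma lex_left_row:
  assumes "None \<in> set x"
  shows "lex_left (row_of i False x) (row_of i True x)"
proof -
  obtain y z where x: "x = y @ None # z" and y: "None \<notin> set y"
    using split_list_first[OF assms] by blast
  have "row_of i False x = row_of i False y @ False # row_of i False z"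
    "row_of i True x = row_of i False y @ True # row_of i True z"
    using row_const[OF y, of i True False] by (simp_all add: x row_append) (simp_all add: row_of_def)
  then show ?thesis unfolding lex_left_def by blast
qed

definition rows_lex :: "nat \<Rightarrow> (nat \<Rightarrow> bool list) \<Rightarrow> bool" where
  "rows_lex M B \<longleftrightarrow> (\<forall>i k. i < k \<longrightarrow> k < M \<longrightarrow> lex_left (B i) (B k))"

lemma rows_lex_split:
  assumes "rows_lex M B" "None \<in> set x" "j < M"
  shows "rows_lex (Suc M) (split j x B)"
  unfolding rows_lex_def
proof (intro allI impI)
  fix i k assume *: "i < k" "k < Suc M"
  consider "k \<le> j" | "i \<le> j" "j < k" "k - 1 \<noteq> i" | "i = j" "k = Suc j" | "j < i" using * by linarith
  then show "lex_left (split j x B i) (split j x B k)"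
  proof cases
    case 3
    then show ?thesis using lex_left_row[OF assms(2)] by (simp add: split_def lex_left_prefix)
  qed (use * assms(1,3) in \<open>auto simp: split_def rows_lex_def intro!: lex_left_append\<close>)
qed

lemma rows_lex_ext: "rows_lex M B \<Longrightarrow> rows_lex M (ext x B)"
  by (auto simp: rows_lex_def ext_def intro: lex_left_append)

lemma rows_lex_drop: "rows_lex (Suc M) B \<Longrightarrow> rows_lex M (drop_row j B)"
  by (auto simp: rows_lex_def drop_row_def skip_def)

text \<open>An \<open>m\<close>-element set of the first \<open>M\<close> rows, encoded by its enumeration. Infinitely many rows are carried
  along, and the enumeration is continued by the rows from \<open>M\<close> on, which are not yet in use.\<close>

definition conf :: "nat \<Rightarrow> nat \<Rightarrow> (nat \<Rightarrow> nat) set" where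
  "conf M m = {\<alpha>. strict_mono \<alpha> \<and> (\<forall>i<m. \<alpha> i < M) \<and> (\<forall>i\<ge>m. \<alpha> i = M + (i - m))}"

lemma finite_conf: "finite (conf M m)"
proof (rule finite_subset)
  show "conf M m \<subseteq> (\<lambda>g i. if i < m then g i else M + (i - m)) ` ({..<m} \<rightarrow>\<^sub>E {..<M})"
  proof
    fix \<alpha> assume "\<alpha> \<in> conf M m"
    then show "\<alpha> \<in> (\<lambda>g i. if i < m then g i else M + (i - m)) ` ({..<m} \<rightarrow>\<^sub>E {..<M})"
      by (intro image_eqI[where x = "restrict \<alpha> {..<m}"]) (auto simp: conf_def fun_eq_iff)
  qed
  show "finite ((\<lambda>g i. if i < m then g i else M + (i - m)) ` ({..<m} \<rightarrow>\<^sub>E {..<M}))"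
    by (intro finite_imageI finite_PiE) auto
qed

lemma conf_strict_mono: "\<alpha> \<in> conf M m \<Longrightarrow> strict_mono \<alpha>"
  by (simp add: conf_def)

lemma conf_less_iff: "\<alpha> \<in> conf M m \<Longrightarrow> \<alpha> i < M \<longleftrightarrow> i < m"
  by (cases "i < m") (auto simp: conf_def)

text \<open>The case of a set containing both copies of a doubled row \<open>j\<close>: before the
  split it had one row fewer, and its member of rank \<open>pos\<close> is the one that
  splits.\<close>

lemma conf_split_merge:
  assumes \<alpha>: "\<alpha> \<in> conf (Suc M) m" and pos: "\<alpha> pos = j" "\<alpha> (Suc pos) = Suc j" and "j < M"
  shows "(\<lambda>i. if i \<le> pos then \<alpha> i else \<alpha> (Suc i) - 1) \<in> conf M (m - 1)" (is "?\<beta> \<in> _")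
    and "pos < m - 1" "0 < m"
proof -
  have mono: "strict_mono \<alpha>" using \<alpha> by (rule conf_strict_mono)
  have "\<alpha> (Suc pos) < Suc M" using assms by simp
  then have "Suc pos < m" using conf_less_iff[OF \<alpha>] by blast
  then show pm: "pos < m - 1" "0 < m" by auto
  have sm: "strict_mono ?\<beta>"
  proof (rule strict_monoI)
    fix i k :: nat assume "i < k"
    consider "k \<le> pos" | "i \<le> pos" "pos < k" | "pos < i" using \<open>i < k\<close> by linarith
    then show "?\<beta> i < ?\<beta> k"
    proof cases
      case 1 then show ?thesis using mono \<open>i < k\<close> by (simp add: strict_monoD)
    next
      case 2
      then have "\<alpha> i \<le> \<alpha> pos" "\<alpha> (Suc pos) < \<alpha> (Suc k)"
        using mono by (auto simp: strict_mono_less_eq strict_mono_less)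
      then show ?thesis using 2 pos by simp
    next
      case 3
      then have "\<alpha> (Suc pos) < \<alpha> (Suc i)" "\<alpha> (Suc i) < \<alpha> (Suc k)"
        using mono \<open>i < k\<close> by (auto simp: strict_mono_less)
      then show ?thesis using 3 \<open>i < k\<close> by simp
    qed
  qed
  have "?\<beta> i < M" if "i < m - 1" for i
  proof (cases "i \<le> pos")
    case True
    then have "\<alpha> i \<le> \<alpha> pos" using mono by (simp add: strict_mono_less_eq)
    then show ?thesis using True assms by simp
  next
    case False
    then have "\<alpha> (Suc pos) < \<alpha> (Suc i)" "\<alpha> (Suc i) < Suc M"
      using mono that conf_less_iff[OF \<alpha>, of "Suc i"] by (auto simp: strict_mono_less)
    then show ?thesis using False pos by simp
  qed
  moreover have "?\<beta> i = M + (i - (m - 1))" if "i \<ge> m - 1" for i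
    using \<alpha> pm that by (simp add: conf_def)
  ultimately show "?\<beta> \<in> conf M (m - 1)" using sm by (simp add: conf_def)
qed

definition merge :: "nat \<Rightarrow> nat \<Rightarrow> nat" where
  "merge j i = (if i \<le> j then i else i - 1)"

text \<open>If one of the two copies of row \<open>j\<close> is missed, undoing the split is
  injective on the set.\<close>

lemma conf_split_keep:
  assumes \<alpha>: "\<alpha> \<in> conf (Suc M) m" and no: "\<not> (\<exists>i. \<alpha> i = j \<and> \<alpha> (Suc i) = Suc j)" and "j < M"
  shows "(\<lambda>i. merge j (\<alpha> i)) \<in> conf M m"
proof -
  have mono: "strict_mono \<alpha>" using \<alpha> by (rule conf_strict_mono)
  have "strict_mono (\<lambda>i. merge j (\<alpha> i))"
    unfolding strict_mono_Suc_iff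
  proof
    fix i
    have "\<alpha> i < \<alpha> (Suc i)" using mono by (simp add: strict_mono_less)
    moreover have "\<not> (\<alpha> i = j \<and> \<alpha> (Suc i) = Suc j)" using no by blast
    ultimately show "merge j (\<alpha> i) < merge j (\<alpha> (Suc i))"
      by (auto simp: merge_def)
  qed
  moreover have "merge j (\<alpha> i) < M" if "i < m" for i
    using conf_less_iff[OF \<alpha>, of i] that \<open>j < M\<close> by (auto simp: merge_def)
  moreover have "merge j (\<alpha> i) = M + (i - m)" if "i \<ge> m" for i
    using \<alpha> that \<open>j < M\<close> by (auto simp: conf_def merge_def)
  ultimately show ?thesis by (simp add: conf_def)
qed

lemma conf_skip:
  assumes \<alpha>: "\<alpha> \<in> conf M m" and "j \<le> M"
  shows "(\<lambda>i. skip j (\<alpha> i)) \<in> conf (Suc M) m"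
proof -
  have "strict_mono (\<lambda>i. skip j (\<alpha> i))"
    using conf_strict_mono[OF \<alpha>] by (auto simp: strict_mono_Suc_iff skip_def) (metis less_trans)
  moreover have "skip j (\<alpha> i) < Suc M" if "i < m" for i
    using conf_less_iff[OF \<alpha>, of i] that by (auto simp: skip_def)
  moreover have "skip j (\<alpha> i) = Suc M + (i - m)" if "i \<ge> m" for i
    using \<alpha> that \<open>j \<le> M\<close> by (auto simp: conf_def skip_def)
  ultimately show ?thesis by (simp add: conf_def)
qed

text \<open>Used when row \<open>j\<close> ends as a point of the set: the row is put back into the
  set, where it has rank \<open>pos\<close>. The rank is at most \<open>m\<close> because
  \<open>\<alpha> m = M\<close>.\<close>

lemma conf_insert:
  assumes \<alpha>: "\<alpha> \<in> conf M m" and "j \<le> M"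
  obtains \<beta> pos where "\<beta> \<in> conf (Suc M) (Suc m)" "pos < Suc m" "\<beta> pos = j"
    "\<And>i. \<beta> (skip pos i) = skip j (\<alpha> i)"
proof -
  have mono: "strict_mono \<alpha>" using \<alpha> by (rule conf_strict_mono)
  define pos where "pos = (LEAST i. j \<le> \<alpha> i)"
  have "j \<le> \<alpha> m" using \<alpha> \<open>j \<le> M\<close> by (simp add: conf_def)
  then have pos: "pos \<le> m" "j \<le> \<alpha> pos" unfolding pos_def by (auto intro: Least_le LeastI)
  have iff: "\<alpha> i < j \<longleftrightarrow> i < pos" for i
  proof
    show "i < pos" if "\<alpha> i < j"
    proof (rule ccontr)
      assume "\<not> i < pos"
      then have "\<alpha> pos \<le> \<alpha> i" using mono by (simp add: strict_mono_less_eq)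
      with pos that show False by simp
    qed
    show "\<alpha> i < j" if "i < pos" using not_less_Least that unfolding pos_def by force
  qed
  define \<beta> where "\<beta> i = (if i < pos then \<alpha> i else if i = pos then j else Suc (\<alpha> (i - 1)))" for i
  have skip: "\<beta> (skip pos i) = skip j (\<alpha> i)" for i
    using iff[of i] by (auto simp: \<beta>_def skip_def)
  have "strict_mono \<beta>"
    unfolding strict_mono_Suc_iff
  proof
    fix i
    have "\<alpha> i < \<alpha> (Suc i)" "0 < i \<Longrightarrow> \<alpha> (i - 1) < \<alpha> i" using mono by (auto simp: strict_mono_less)
    moreover have "j \<le> \<alpha> i" if "i = pos" using pos that by simp
    ultimately show "\<beta> i < \<beta> (Suc i)"
      using iff[of i] iff[of "i - 1"] by (auto simp: \<beta>_def)
  qed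
  moreover have "\<beta> i < Suc M" if "i < Suc m" for i
    using that conf_less_iff[OF \<alpha>, of i] conf_less_iff[OF \<alpha>, of "i - 1"] pos(1) \<open>j \<le> M\<close>
    by (auto simp: \<beta>_def)
  moreover have "\<beta> i = Suc M + (i - Suc m)" if "i \<ge> Suc m" for i
    using that \<alpha> pos(1) by (auto simp: \<beta>_def conf_def)
  ultimately have "\<beta> \<in> conf (Suc M) (Suc m)" by (simp add: conf_def)
  moreover have "\<beta> pos = j" by (simp add: \<beta>_def)
  ultimately show ?thesis using that[of \<beta> pos] pos(1) skip by simp
qed

section \<open>Generic colours\<close>

locale generic_colouring = splitting_pair p q for p q +
  fixes \<kappa> :: "bool list set \<Rightarrow> 'c" and n :: nat
  assumes finite_colours: "finite (range \<kappa>)" and n_pos: "0 < n"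
begin

text \<open>The iterated limit is stated as a relation to the colour \<open>c\<close>; such a colour
  exists by finiteness of \<open>range \<kappa>\<close>. All rows of \<open>A\<close> grow by the
  same word, each reading its own bits.\<close>

fun gen :: "event list \<Rightarrow> (nat \<Rightarrow> bool list) \<Rightarrow> bool list set \<Rightarrow> 'c \<Rightarrow> bool" where
  "gen [] A D c \<longleftrightarrow> \<kappa> D = c"
| "gen (Split j # \<tau>) A D c \<longleftrightarrow> eventually (\<lambda>x. gen \<tau> (split j x A) D c) q"
| "gen (End j # \<tau>) A D c \<longleftrightarrow>
     eventually (\<lambda>x. gen \<tau> (drop_row j (ext x A)) (insert (ext x A j) D) c) p"

lemma gen_exists: "\<exists>c\<in>range \<kappa>. gen \<tau> A D c"
proof (induction \<tau> arbitrary: A D)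
  case (Cons e \<tau>)
  show ?case
  proof (cases e)
    case (Split j)
    then show ?thesis
      by (simp only: gen.simps, intro ultra_finite[OF ultra_q finite_colours] always_eventually allI Cons.IH)
  next
    case (End j)
    then show ?thesis
      by (simp only: gen.simps, intro ultra_finite[OF ultra_p finite_colours] always_eventually allI Cons.IH)
  qed
qed simp

definition col :: "event list \<Rightarrow> 'c" where
  "col \<tau> = (SOME c. gen \<tau> (\<lambda>_. []) {} c)"

lemma gen_col: "gen \<tau> (\<lambda>_. []) {} (col \<tau>)"
  unfolding col_def using gen_exists[of \<tau>] by (metis someI)

text \<open>Well-formed events concern only rows below \<open>m\<close>; this is what makes the
  predicates met later cylinders.\<close>

lemma gen_cong:
  assumes "wf_events \<tau> m" "\<And>i. i < m \<Longrightarrow> A i = A' i"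
  shows "gen \<tau> A D c = gen \<tau> A' D c"
  using assms
proof (induction \<tau> arbitrary: m A A' D)
  case (Cons e \<tau>)
  show ?case
  proof (cases e)
    case (Split j)
    have "gen \<tau> (split j x A) D c = gen \<tau> (split j x A') D c" for x
      using Cons.prems Split by (intro Cons.IH[of "m + 1"]) (auto simp: split_def)
    then show ?thesis by (simp add: Split)
  next
    case (End j)
    have "gen \<tau> (drop_row j (ext x A)) D' c = gen \<tau> (drop_row j (ext x A')) D' c" for x D'
      using Cons.prems End by (intro Cons.IH[of "m - 1"]) (auto simp: drop_row_def skip_def ext_def)
    moreover have "ext x A j = ext x A' j" for x
      using Cons.prems End by (simp add: ext_def)
    ultimately show ?thesis by (simp add: End)
  qed
qed simp

lemma const_p: "eventually (\<lambda>x. None \<notin> set x) p"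
  unfolding subst_q[of "\<lambda>_. False", symmetric] by (simp add: eventually_filtermap None_notin_subst)

text \<open>The first event absorbs a preceding growth of all branches:
  \<open>p \<odot> q = q\<close> for a split and \<open>p \<odot> p = p\<close> for an end. With no
  events left the colour depends on \<open>D\<close> alone.\<close>

lemma gen_absorb:
  assumes "wf_events \<tau> m" "gen \<tau> A D c"
  shows "eventually (\<lambda>x. gen \<tau> (ext x A) D c) p"
proof (cases \<tau>)
  case (Cons e \<tau>')
  show ?thesis
  proof (cases e)
    case (Split j)
    have "eventually (\<lambda>x. gen \<tau>' (split j x A) D c) (p \<odot> q)"
      using assms(2) by (simp add: Cons Split pq)
    then have "eventually (\<lambda>x. eventually (\<lambda>y. gen \<tau>' (split j (x @ y) A) D c) q) p"
      by (simp add: eventually_fprod)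
    then show ?thesis
      using const_p
    proof eventually_elim
      case (elim x)
      have "split j (x @ y) A = split j y (ext x A)" for y
        using row_const[OF elim(2)] by (auto simp: split_def ext_def row_append fun_eq_iff)
      then show ?case using elim(1) by (simp add: Cons Split)
    qed
  next
    case (End j)
    have ext: "ext (x @ y) A = ext y (ext x A)" for x y
      by (simp add: ext_def row_append fun_eq_iff)
    have "eventually (\<lambda>x. gen \<tau>' (drop_row j (ext x A)) (insert (ext x A j) D) c) (p \<odot> p)"
      using assms(2) by (simp add: Cons End pp)
    then show ?thesis by (simp add: eventually_fprod ext Cons End)
  qed
qed (use assms in simp)

lemma p_reindex: "cyl k R \<Longrightarrow> strict_mono \<alpha> \<Longrightarrow> eventually R p \<Longrightarrow> eventually (\<lambda>x. R (reindex \<alpha> x)) p"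
  and q_reindex: "cyl k R \<Longrightarrow> strict_mono \<alpha> \<Longrightarrow> eventually R q \<Longrightarrow> eventually (\<lambda>x. R (reindex \<alpha> x)) q"
  using invar_p[of k R] invar_q[of k R] by (simp_all add: invar_def)

text \<open>In \<open>gen_absorb\<close> the rows are numbered within the set. Here the set
  \<open>\<alpha>\<close> reads its own rows of a word shared by the whole tree, and invariance of
  \<open>p\<close> identifies the two limits.\<close>

lemma gen_ext_p:
  assumes "wf_events \<tau> m" "gen \<tau> (\<lambda>i. B (\<alpha> i)) D c" "strict_mono \<alpha>"
  shows "eventually (\<lambda>x. gen \<tau> (\<lambda>i. ext x B (\<alpha> i)) D c) p"
proof -
  have "cyl m (\<lambda>x. gen \<tau> (ext x (\<lambda>i. B (\<alpha> i))) D c)"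
    unfolding cyl_def using assms(1)
    by (intro allI gen_cong[of \<tau> m]) (simp_all add: ext_def row_rows_below)
  then have "eventually (\<lambda>x. gen \<tau> (ext (reindex \<alpha> x) (\<lambda>i. B (\<alpha> i))) D c) p"
    using assms(3) gen_absorb[OF assms(1,2)] by (rule p_reindex)
  then show ?thesis by (simp add: ext_def[abs_def] row_reindex)
qed

text \<open>A split that gives each row of the set a single value \<open>s\<close> at the variable
  looks to the set like a constant word, because substitution turns \<open>q\<close> into
  \<open>p\<close>.\<close>

lemma gen_ext_q:
  assumes "wf_events \<tau> m" "gen \<tau> (\<lambda>i. B (\<alpha> i)) D c" "strict_mono \<alpha>"
  shows "eventually (\<lambda>x. gen \<tau> (\<lambda>i. B (\<alpha> i) @ row_of (\<alpha> i) (s (\<alpha> i)) x) D c) q"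
proof -
  have "eventually (\<lambda>x. gen \<tau> (\<lambda>i. ext x B (\<alpha> i)) D c) (filtermap (subst s) q)"
    using gen_ext_p[OF assms] by (simp add: subst_q)
  then show ?thesis by (simp add: eventually_filtermap ext_def row_subst)
qed

lemma gen_split_q:
  assumes "wf_events (Split j # \<tau>) m" "gen (Split j # \<tau>) (\<lambda>i. B (\<alpha> i)) D c" "strict_mono \<alpha>"
  shows "eventually (\<lambda>x. gen \<tau> (split j (reindex \<alpha> x) (\<lambda>i. B (\<alpha> i))) D c) q"
proof -
  have "cyl m (\<lambda>x. gen \<tau> (split j x (\<lambda>i. B (\<alpha> i))) D c)"
    unfolding cyl_def using assms(1)
    by (intro allI gen_cong[of \<tau> "m + 1"]) (auto simp: split_def row_rows_below)
  then show ?thesis using assms(2,3) by (auto intro: q_reindex)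
qed

lemma gen_end_p:
  assumes "wf_events (End j # \<tau>) m" "gen (End j # \<tau>) (\<lambda>i. B (\<alpha> i)) D c" "strict_mono \<alpha>"
  shows "eventually (\<lambda>x. gen \<tau> (\<lambda>i. ext x B (\<alpha> (skip j i))) (insert (ext x B (\<alpha> j)) D) c) p"
proof -
  have "cyl m (\<lambda>x. gen \<tau> (drop_row j (ext x (\<lambda>i. B (\<alpha> i)))) (insert (ext x (\<lambda>i. B (\<alpha> i)) j) D) c)"
    unfolding cyl_def
  proof
    fix x
    have "ext (rows_below m x) (\<lambda>i. B (\<alpha> i)) j = ext x (\<lambda>i. B (\<alpha> i)) j"
      using assms(1) by (simp add: ext_def row_rows_below)
    moreover have "gen \<tau> (drop_row j (ext (rows_below m x) (\<lambda>i. B (\<alpha> i)))) D' c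
        = gen \<tau> (drop_row j (ext x (\<lambda>i. B (\<alpha> i)))) D' c" for D'
      using assms(1)
      by (intro gen_cong[of \<tau> "m - 1"]) (auto simp: ext_def row_rows_below drop_row_def skip_def)
    ultimately show "gen \<tau> (drop_row j (ext (rows_below m x) (\<lambda>i. B (\<alpha> i))))
          (insert (ext (rows_below m x) (\<lambda>i. B (\<alpha> i)) j) D) c
        = gen \<tau> (drop_row j (ext x (\<lambda>i. B (\<alpha> i)))) (insert (ext x (\<lambda>i. B (\<alpha> i)) j) D) c"
      by simp
  qed
  then have "eventually (\<lambda>x. gen \<tau> (drop_row j (ext (reindex \<alpha> x) (\<lambda>i. B (\<alpha> i))))
      (insert (ext (reindex \<alpha> x) (\<lambda>i. B (\<alpha> i)) j) D) c) p"
    using assms(2,3) by (auto intro: p_reindex)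
  then show ?thesis by (simp add: ext_def[abs_def] row_reindex drop_row_def[abs_def])
qed

text \<open>The events \<open>\<sigma>\<close> lie in the past, \<open>A\<close> and \<open>D\<close> are the live and the finished branches, and every
  possible future \<open>\<tau>\<close> yields the colour that was generic at the start.\<close>

definition continues :: "event list \<Rightarrow> nat \<Rightarrow> (nat \<Rightarrow> bool list) \<Rightarrow> bool list set \<Rightarrow> bool" where
  "continues \<sigma> m A D \<longleftrightarrow> (\<forall>\<tau>. wf_events \<tau> m \<longrightarrow> length \<sigma> + length \<tau> = 2 * n - 1 \<longrightarrow>
     wf_events (\<sigma> @ \<tau>) 1 \<and> gen \<tau> A D (col (\<sigma> @ \<tau>)))"

text \<open>There are only finitely many futures of the prescribed length, so their limits can be
  realised by one word.\<close>

lemma eventually_continues: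
  assumes "\<And>\<tau>. wf_events \<tau> m \<Longrightarrow> length \<sigma> + length \<tau> = 2 * n - 1 \<Longrightarrow>
     wf_events (\<sigma> @ \<tau>) 1 \<and> eventually (\<lambda>x. gen \<tau> (A x) (D x) (col (\<sigma> @ \<tau>))) F"
  shows "eventually (\<lambda>x. continues \<sigma> m (A x) (D x)) F"
proof -
  let ?T = "{\<tau>. wf_events \<tau> m \<and> length \<sigma> + length \<tau> = 2 * n - 1}"
  have "?T \<subseteq> {\<tau>. wf_events \<tau> m \<and> length \<tau> = 2 * n - 1 - length \<sigma>}" by auto
  then have "finite ?T" using card_wf_events finite_subset by blast
  then have "eventually (\<lambda>x. \<forall>\<tau>\<in>?T. gen \<tau> (A x) (D x) (col (\<sigma> @ \<tau>))) F"
    using assms by (intro eventually_ball_finite) auto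
  then show ?thesis
    by eventually_elim (use assms in \<open>auto simp: continues_def\<close>)
qed

lemma continues_ext_p:
  assumes "continues \<sigma> m (\<lambda>i. B (\<alpha> i)) D" "strict_mono \<alpha>"
  shows "eventually (\<lambda>x. continues \<sigma> m (\<lambda>i. ext x B (\<alpha> i)) D) p"
  using assms by (intro eventually_continues) (auto simp: continues_def intro: gen_ext_p)

lemma continues_ext_q:
  assumes "continues \<sigma> m (\<lambda>i. B (\<alpha> i)) D" "strict_mono \<alpha>"
  shows "eventually (\<lambda>x. continues \<sigma> m (\<lambda>i. B (\<alpha> i) @ row_of (\<alpha> i) (s (\<alpha> i)) x) D) q"
  using assms by (intro eventually_continues) (auto simp: continues_def intro: gen_ext_q)

lemma continues_split_q:
  assumes "continues \<sigma> m (\<lambda>i. B (\<alpha> i)) D" "strict_mono \<alpha>" "j < m"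
  shows "eventually (\<lambda>x. continues (\<sigma> @ [Split j]) (m + 1) (split j (reindex \<alpha> x) (\<lambda>i. B (\<alpha> i))) D) q"
proof (rule eventually_continues)
  fix \<tau> assume *: "wf_events \<tau> (m + 1)" "length (\<sigma> @ [Split j]) + length \<tau> = 2 * n - 1"
  then have w: "wf_events (Split j # \<tau>) m" using assms(3) by simp
  then have "wf_events (\<sigma> @ Split j # \<tau>) 1" "gen (Split j # \<tau>) (\<lambda>i. B (\<alpha> i)) D (col (\<sigma> @ Split j # \<tau>))"
    using assms(1) * unfolding continues_def by (metis add_Suc_right add_Suc length_append_singleton length_Cons)+
  then show "wf_events ((\<sigma> @ [Split j]) @ \<tau>) 1 \<and> eventually (\<lambda>x. gen \<tau>
      (split j (reindex \<alpha> x) (\<lambda>i. B (\<alpha> i))) D (col ((\<sigma> @ [Split j]) @ \<tau>))) q"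
    using gen_split_q[OF w _ assms(2)] by simp
qed

lemma continues_end_p:
  assumes "continues \<sigma> m (\<lambda>i. B (\<alpha> i)) D" "strict_mono \<alpha>" "j < m"
  shows "eventually (\<lambda>x. continues (\<sigma> @ [End j]) (m - 1) (\<lambda>i. ext x B (\<alpha> (skip j i)))
    (insert (ext x B (\<alpha> j)) D)) p"
proof (rule eventually_continues)
  fix \<tau> assume *: "wf_events \<tau> (m - 1)" "length (\<sigma> @ [End j]) + length \<tau> = 2 * n - 1"
  then have w: "wf_events (End j # \<tau>) m" using assms(3) by simp
  then have "wf_events (\<sigma> @ End j # \<tau>) 1" "gen (End j # \<tau>) (\<lambda>i. B (\<alpha> i)) D (col (\<sigma> @ End j # \<tau>))"
    using assms(1) * unfolding continues_def by (metis add_Suc_right add_Suc length_append_singleton length_Cons)+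
  then show "wf_events ((\<sigma> @ [End j]) @ \<tau>) 1 \<and> eventually (\<lambda>x. gen \<tau> (\<lambda>i. ext x B (\<alpha> (skip j i)))
      (insert (ext x B (\<alpha> j)) D) (col ((\<sigma> @ [End j]) @ \<tau>))) p"
    using gen_end_p[OF w _ assms(2)] by simp
qed

text \<open>A set of \<open>m\<close> live rows and the finished points \<open>D\<close> has seen
  \<open>card D\<close> ends and, starting from one branch, \<open>card D + m - 1\<close> splits;
  hence the length of \<open>\<sigma>\<close>. Only sets of size at most \<open>n\<close> are
  considered, since every live branch still has to end.\<close>

definition generic :: "nat \<Rightarrow> (nat \<Rightarrow> bool list) \<Rightarrow> nat set \<Rightarrow> (nat \<Rightarrow> bool list) \<Rightarrow> bool" where
  "generic M B F \<phi> \<longleftrightarrow> (\<forall>m \<alpha> D. \<alpha> \<in> conf M m \<longrightarrow> D \<subseteq> F \<longrightarrow> 0 < m + card D \<longrightarrow> m + card D \<le> n \<longrightarrow>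
     (\<exists>\<sigma>. Suc (length \<sigma>) = 2 * card D + m \<and> continues \<sigma> m (\<lambda>i. B (\<alpha> i)) (\<phi> ` D)))"

lemma genericD:
  assumes "generic M B F \<phi>" "\<alpha> \<in> conf M m" "D \<subseteq> F" "0 < m + card D" "m + card D \<le> n"
  obtains \<sigma> where "Suc (length \<sigma>) = 2 * card D + m" "continues \<sigma> m (\<lambda>i. B (\<alpha> i)) (\<phi> ` D)"
proof -
  have "\<exists>\<sigma>. Suc (length \<sigma>) = 2 * card D + m \<and> continues \<sigma> m (\<lambda>i. B (\<alpha> i)) (\<phi> ` D)"
    using assms(1)[unfolded generic_def, rule_format, OF assms(2-5)] .
  then show ?thesis using that by (elim exE conjE)
qed

lemma eventually_generic:
  assumes "finite F"
    and "\<And>m \<alpha> D. \<alpha> \<in> conf M m \<Longrightarrow> D \<subseteq> F \<Longrightarrow> 0 < m + card D \<Longrightarrow> m + card D \<le> n \<Longrightarrow>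
      \<exists>\<sigma>. Suc (length \<sigma>) = 2 * card D + m \<and>
        eventually (\<lambda>x. continues \<sigma> m (\<lambda>i. B x (\<alpha> i)) (\<phi> x ` D)) G"
  shows "eventually (\<lambda>x. generic M (B x) F (\<phi> x)) G"
proof -
  let ?T = "{(m, \<alpha>, D). m \<le> n \<and> \<alpha> \<in> conf M m \<and> D \<subseteq> F \<and> 0 < m + card D \<and> m + card D \<le> n}"
  have "?T \<subseteq> (SIGMA m : {..n}. conf M m \<times> Pow F)" by auto
  then have "finite ?T"
    by (rule finite_subset) (use assms(1) in \<open>auto intro!: finite_SigmaI finite_conf\<close>)
  then have "eventually (\<lambda>x. \<forall>(m, \<alpha>, D)\<in>?T. \<exists>\<sigma>. Suc (length \<sigma>) = 2 * card D + m \<and>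
      continues \<sigma> m (\<lambda>i. B x (\<alpha> i)) (\<phi> x ` D)) G"
  proof (rule eventually_ball_finite, intro ballI)
    fix t assume "t \<in> ?T"
    then obtain m \<alpha> D where t: "t = (m, \<alpha>, D)" "\<alpha> \<in> conf M m" "D \<subseteq> F" "0 < m + card D" "m + card D \<le> n"
      by auto
    obtain \<sigma> where "Suc (length \<sigma>) = 2 * card D + m"
      "eventually (\<lambda>x. continues \<sigma> m (\<lambda>i. B x (\<alpha> i)) (\<phi> x ` D)) G"
      using assms(2)[OF t(2-5)] by blast
    then show "eventually (\<lambda>x. case t of (m, \<alpha>, D) \<Rightarrow> \<exists>\<sigma>. Suc (length \<sigma>) = 2 * card D + m \<and>
      continues \<sigma> m (\<lambda>i. B x (\<alpha> i)) (\<phi> x ` D)) G"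
      unfolding t by (auto elim: eventually_mono)
  qed
  then show ?thesis
    by eventually_elim (auto simp: generic_def)
qed

text \<open>A set that misses a copy of row \<open>j\<close> keeps its past, as \<open>q\<close>
  then acts like \<open>p\<close>; a set with both copies gets its past extended by
  \<open>Split pos\<close>.\<close>

lemma generic_split:
  assumes "generic M B F \<phi>" "finite F" "j < M"
  shows "eventually (\<lambda>x. generic (Suc M) (split j x B) F \<phi>) q"
proof (rule eventually_generic[OF assms(2)])
  fix m \<alpha> D
  assume \<alpha>: "\<alpha> \<in> conf (Suc M) m" and D: "D \<subseteq> F" "0 < m + card D" "m + card D \<le> n"
  show "\<exists>\<sigma>. Suc (length \<sigma>) = 2 * card D + m \<and>
     eventually (\<lambda>x. continues \<sigma> m (\<lambda>i. split j x B (\<alpha> i)) (\<phi> ` D)) q"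
  proof (cases "\<exists>pos. \<alpha> pos = j \<and> \<alpha> (Suc pos) = Suc j")
    case False
    define \<beta> where "\<beta> i = merge j (\<alpha> i)" for i
    have \<beta>: "\<beta> \<in> conf M m"
      using conf_split_keep[OF \<alpha> False assms(3)] by (simp add: \<beta>_def[abs_def])
    obtain \<sigma> where \<sigma>: "Suc (length \<sigma>) = 2 * card D + m" "continues \<sigma> m (\<lambda>i. B (\<beta> i)) (\<phi> ` D)"
      using genericD[OF assms(1) \<beta> D] .
    \<comment> \<open>The rows are numbered as before the split: those above \<open>j\<close> read
      1, those below read 0, and row \<open>j\<close> reads the value of the copy belonging to the
      set.\<close>
    define s where "s r \<longleftrightarrow> j < r \<or> r = j \<and> (\<exists>i. \<alpha> i = Suc j)" for r
    have "split j x B (\<alpha> i) = B (\<beta> i) @ row_of (\<beta> i) (s (\<beta> i)) x" for x i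
    proof -
      have "\<not> (\<exists>k. \<alpha> k = Suc j)" if "\<alpha> i = j"
      proof
        assume "\<exists>k. \<alpha> k = Suc j"
        then obtain k where k: "\<alpha> k = Suc j" ..
        have mono: "strict_mono \<alpha>" using \<alpha> by (rule conf_strict_mono)
        have "\<alpha> i < \<alpha> (Suc i)" using mono by (simp add: strict_mono_less)
        moreover have "i < k" using k that mono by (metis lessI strict_mono_less)
        then have "\<alpha> (Suc i) \<le> \<alpha> k" using mono by (simp add: strict_mono_less_eq)
        ultimately have "\<alpha> (Suc i) = Suc j" using k that by simp
        with False that show False by blast
      qed
      then have "s (\<beta> i) \<longleftrightarrow> j < \<alpha> i"
        by (cases "\<alpha> i" j rule: linorder_cases) (auto simp: \<beta>_def merge_def s_def intro: exI[of _ i])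
      then show ?thesis by (auto simp: split_def \<beta>_def merge_def)
    qed
    then have "eventually (\<lambda>x. continues \<sigma> m (\<lambda>i. split j x B (\<alpha> i)) (\<phi> ` D)) q"
      using continues_ext_q[OF \<sigma>(2) conf_strict_mono[OF \<beta>], of s] by simp
    with \<sigma>(1) show ?thesis by blast
  next
    case True
    then obtain pos where pos: "\<alpha> pos = j" "\<alpha> (Suc pos) = Suc j" by blast
    define \<beta> where "\<beta> i = (if i \<le> pos then \<alpha> i else \<alpha> (Suc i) - 1)" for i
    note merge = conf_split_merge[OF \<alpha> pos assms(3), folded \<beta>_def[abs_def]]
    obtain \<sigma> where \<sigma>: "Suc (length \<sigma>) = 2 * card D + (m - 1)"
        "continues \<sigma> (m - 1) (\<lambda>i. B (\<beta> i)) (\<phi> ` D)"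
      using D merge(2) by (elim genericD[OF assms(1) merge(1)]) auto
    have "split pos (reindex \<beta> x) (\<lambda>i. B (\<beta> i)) = (\<lambda>i. split j x B (\<alpha> i))" for x
    proof
      fix i
      have mono: "strict_mono \<alpha>" using \<alpha> by (rule conf_strict_mono)
      consider "i \<le> pos" | "i = Suc pos" | "Suc pos < i" by linarith
      then show "split pos (reindex \<beta> x) (\<lambda>i. B (\<beta> i)) i = split j x B (\<alpha> i)"
      proof cases
        case 1
        then have "\<alpha> i \<le> \<alpha> pos" using mono by (simp add: strict_mono_less_eq)
        with 1 show ?thesis by (simp add: split_def \<beta>_def row_reindex pos(1))
      next
        case 2
        then show ?thesis using pos by (simp add: split_def \<beta>_def row_reindex)
      next
        case 3
        then have "\<alpha> (Suc pos) < \<alpha> i" using mono by (simp add: strict_mono_less)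
        with 3 pos show ?thesis by (auto simp: split_def \<beta>_def row_reindex)
      qed
    qed
    then have "eventually (\<lambda>x. continues (\<sigma> @ [Split pos]) m (\<lambda>i. split j x B (\<alpha> i)) (\<phi> ` D)) q"
      using continues_split_q[OF \<sigma>(2) conf_strict_mono[OF merge(1)] merge(2)] merge(3) by simp
    moreover have "Suc (length (\<sigma> @ [Split pos])) = 2 * card D + m" using \<sigma>(1) merge(3) by simp
    ultimately show ?thesis by blast
  qed
qed

text \<open>For a set without the new point \<open>y\<close> the word is a mere growth. A set
  containing \<open>y\<close> had row \<open>j\<close> among its live rows before, and its past is
  extended by \<open>End pos\<close>.\<close>

lemma generic_end:
  assumes "generic (Suc M) B F \<phi>" "finite F" "j \<le> M" "y \<notin> F"
  shows "eventually (\<lambda>x. generic M (drop_row j (ext x B)) (insert y F) (\<phi>(y := ext x B j))) p"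
proof (rule eventually_generic)
  show "finite (insert y F)" using assms(2) by simp
  fix m \<alpha> D
  assume \<alpha>: "\<alpha> \<in> conf M m" and D: "D \<subseteq> insert y F" "0 < m + card D" "m + card D \<le> n"
  show "\<exists>\<sigma>. Suc (length \<sigma>) = 2 * card D + m \<and> eventually (\<lambda>x. continues \<sigma> m
     (\<lambda>i. drop_row j (ext x B) (\<alpha> i)) ((\<phi>(y := ext x B j)) ` D)) p"
  proof (cases "y \<in> D")
    case False
    have \<beta>: "(\<lambda>i. skip j (\<alpha> i)) \<in> conf (Suc M) m" using \<alpha> assms(3) by (rule conf_skip)
    have "D \<subseteq> F" using D(1) False by blast
    then obtain \<sigma> where \<sigma>: "Suc (length \<sigma>) = 2 * card D + m"
        "continues \<sigma> m (\<lambda>i. B (skip j (\<alpha> i))) (\<phi> ` D)"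
      using genericD[OF assms(1) \<beta> _ D(2,3)] by blast
    have "(\<phi>(y := w)) ` D = \<phi> ` D" for w using False by (intro image_cong) auto
    then have "eventually (\<lambda>x. continues \<sigma> m
       (\<lambda>i. drop_row j (ext x B) (\<alpha> i)) ((\<phi>(y := ext x B j)) ` D)) p"
      using continues_ext_p[OF \<sigma>(2) conf_strict_mono[OF \<beta>]] by (simp add: drop_row_def)
    with \<sigma>(1) show ?thesis by blast
  next
    case True
    define D' where "D' = D - {y}"
    have D': "D' \<subseteq> F" "card D = Suc (card D')" "D = insert y D'" "y \<notin> D'"
      using True D(1) card.remove[OF finite_subset[OF D(1)] True] assms(2) by (auto simp: D'_def)
    obtain \<beta> pos where \<beta>: "\<beta> \<in> conf (Suc M) (Suc m)" "pos < Suc m" "\<beta> pos = j"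
      "\<And>i. \<beta> (skip pos i) = skip j (\<alpha> i)"
      using conf_insert[OF \<alpha> assms(3)] by blast
    have "0 < Suc m + card D'" "Suc m + card D' \<le> n" using D(3) D'(2) by auto
    then obtain \<sigma> where \<sigma>: "Suc (length \<sigma>) = 2 * card D' + Suc m"
        "continues \<sigma> (Suc m) (\<lambda>i. B (\<beta> i)) (\<phi> ` D')"
      using genericD[OF assms(1) \<beta>(1) D'(1)] by blast
    have "(\<phi>(y := w)) ` D = insert w (\<phi> ` D')" for w
      using D' by (auto simp: image_iff)
    then have "eventually (\<lambda>x. continues (\<sigma> @ [End pos]) m
       (\<lambda>i. drop_row j (ext x B) (\<alpha> i)) ((\<phi>(y := ext x B j)) ` D)) p"
      using continues_end_p[OF \<sigma>(2) conf_strict_mono[OF \<beta>(1)] \<beta>(2)] by (simp add: drop_row_def \<beta>(3,4))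
    moreover have "Suc (length (\<sigma> @ [End pos])) = 2 * card D + m" using \<sigma>(1) D' by simp
    ultimately show ?thesis by blast
  qed
qed

lemma generic_init: "generic 1 (\<lambda>_. []) {} \<phi>"
  unfolding generic_def
proof (intro allI impI)
  fix m \<alpha> and D :: "nat set"
  assume *: "\<alpha> \<in> conf 1 m" "D \<subseteq> {}" "0 < m + card D"
  have "m = 1"
  proof (rule ccontr)
    assume "m \<noteq> 1"
    with * have "1 < m" by auto
    then have "\<alpha> 1 < 1" using conf_less_iff[OF *(1)] by blast
    moreover have "\<alpha> 0 < \<alpha> 1" using conf_strict_mono[OF *(1)] by (simp add: strict_mono_less)
    ultimately show False by simp
  qed
  then have "continues [] m (\<lambda>i. []) (\<phi> ` D)"
    using *(2) gen_col by (simp add: continues_def)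
  with \<open>m = 1\<close> *(2) show "\<exists>\<sigma>. Suc (length \<sigma>) = 2 * card D + m \<and> continues \<sigma> m (\<lambda>i. []) (\<phi> ` D)"
    by (intro exI[of _ "[]"]) simp
qed

lemma generic_colour:
  assumes "generic M B F \<phi>" "D \<subseteq> F" "card D = n"
  shows "\<kappa> (\<phi> ` D) \<in> col ` {\<tau>. wf_events \<tau> 1 \<and> length \<tau> = 2 * n - 1}"
proof -
  have "(\<lambda>i. M + i) \<in> conf M 0" by (simp add: conf_def strict_mono_def)
  then obtain \<sigma> where \<sigma>: "Suc (length \<sigma>) = 2 * card D + 0" "continues \<sigma> 0 (\<lambda>i. B (M + i)) (\<phi> ` D)"
    using genericD[OF assms(1) _ assms(2), of _ 0] assms(3) n_pos by auto
  then have "length \<sigma> + length [] = 2 * n - 1" using assms(3) by simp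
  then have "wf_events (\<sigma> @ []) 1 \<and> gen [] (\<lambda>i. B (M + i)) (\<phi> ` D) (col (\<sigma> @ []))"
    using \<sigma>(2) unfolding continues_def by (metis wf_events.simps(1))
  then show ?thesis using \<open>length \<sigma> + length [] = 2 * n - 1\<close> by auto
qed

end

section \<open>The homogeneous tree\<close>

context generic_colouring
begin

context
  fixes lt :: "nat \<Rightarrow> nat \<Rightarrow> bool"
  assumes irrefl: "\<And>x. \<not> lt x x"
    and trans: "\<And>x y z. lt x y \<Longrightarrow> lt y z \<Longrightarrow> lt x z"
    and total: "\<And>x y. x \<noteq> y \<Longrightarrow> lt x y \<or> lt y x"
begin

text \<open>The row of the tree that point \<open>z\<close> follows before stage \<open>i\<close>, when the points below \<open>i\<close> are finished.\<close>

definition gap :: "nat \<Rightarrow> nat \<Rightarrow> nat" where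
  "gap i z = card {y. y < i \<and> lt y z}"

lemma gap_le: "gap i z \<le> i"
  unfolding gap_def using card_mono[of "{..<i}" "{y. y < i \<and> lt y z}"] by auto

lemma gap_mono: "lt z z' \<Longrightarrow> gap i z \<le> gap i z'"
  unfolding gap_def by (intro card_mono) (auto intro: trans)

lemma gap_Suc: "gap (Suc i) z = (if lt i z then Suc (gap i z) else gap i z)"
proof -
  have "{y. y < Suc i \<and> lt y z} = (if lt i z then insert i {y. y < i \<and> lt y z} else {y. y < i \<and> lt y z})"
    by (auto simp: less_Suc_eq)
  then show ?thesis by (simp add: gap_def)
qed

text \<open>The \<open>i\<close> finished points leave \<open>i + 1\<close> gaps, and one live row
  is kept for each of them.\<close>

definition stage :: "nat \<Rightarrow> (nat \<Rightarrow> bool list) \<Rightarrow> (nat \<Rightarrow> bool list) \<Rightarrow> bool" where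
  "stage i B \<phi> \<longleftrightarrow> generic (Suc i) B {..<i} \<phi> \<and> rows_lex (Suc i) B \<and>
     (\<forall>y z. y < i \<longrightarrow> i \<le> z \<longrightarrow> (lt y z \<longrightarrow> lex_left (\<phi> y) (B (gap i z))) \<and>
        (lt z y \<longrightarrow> lex_left (B (gap i z)) (\<phi> y))) \<and>
     (\<forall>y y'. y < i \<longrightarrow> y' < i \<longrightarrow> lt y y' \<longrightarrow> lex_left (\<phi> y) (\<phi> y'))"

lemma stage_0: "stage 0 (\<lambda>_. []) \<phi>"
  using generic_init by (simp add: stage_def rows_lex_def)

text \<open>Two splits turn row \<open>j\<close>, the row of point \<open>i\<close>, into three. The
  middle one ends and becomes \<open>\<phi>' i\<close>; the outer two serve the parts of the old gap
  to the left and to the right of \<open>i\<close>.\<close>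

lemma stage_Suc:
  assumes "stage i B \<phi>"
  shows "\<exists>B' \<phi>'. stage (Suc i) B' \<phi>' \<and> (\<forall>y<i. \<phi>' y = \<phi> y)"
proof -
  define j where "j = gap i i"
  have j: "j \<le> i" by (simp add: j_def gap_le)
  have gen: "generic (Suc i) B {..<i} \<phi>" and lex: "rows_lex (Suc i) B"
    and lr: "\<And>y z. y < i \<Longrightarrow> i \<le> z \<Longrightarrow> lt y z \<Longrightarrow> lex_left (\<phi> y) (B (gap i z))"
      "\<And>y z. y < i \<Longrightarrow> i \<le> z \<Longrightarrow> lt z y \<Longrightarrow> lex_left (B (gap i z)) (\<phi> y)"
    and old: "\<And>y y'. y < i \<Longrightarrow> y' < i \<Longrightarrow> lt y y' \<Longrightarrow> lex_left (\<phi> y) (\<phi> y')"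
    using assms by (auto simp: stage_def)
  have ne: "p \<noteq> bot" "q \<noteq> bot" using ultra_p ultra_q by (auto simp: ultra_def)
  obtain x1 where x1: "generic (Suc (Suc i)) (split j x1 B) {..<i} \<phi>" "None \<in> set x1"
    using eventually_happens[OF eventually_conj[OF generic_split[OF gen, of j] var]] ne j by auto
  define B1 where "B1 = split j x1 B"
  obtain x2 where x2: "generic (Suc (Suc (Suc i))) (split (Suc j) x2 B1) {..<i} \<phi>" "None \<in> set x2"
    using eventually_happens[OF eventually_conj[OF generic_split[OF x1(1), of "Suc j"] var]] ne j
    by (auto simp: B1_def)
  define B2 where "B2 = split (Suc j) x2 B1"
  obtain x3 where x3: "generic (Suc (Suc i)) (drop_row (Suc j) (ext x3 B2)) (insert i {..<i})
      (\<phi>(i := ext x3 B2 (Suc j)))"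
    using eventually_happens[OF generic_end[OF x2(1), of "Suc j" i]] ne j by (auto simp: B2_def)
  define B3 where "B3 = ext x3 B2"
  define B' where "B' = drop_row (Suc j) B3"
  define \<phi>' where "\<phi>' = \<phi>(i := B3 (Suc j))"
  have lex2: "rows_lex (Suc (Suc (Suc i))) B3"
    unfolding B3_def B2_def B1_def using lex x1(2) x2(2) j
    by (intro rows_lex_ext rows_lex_split) auto
  have lex': "rows_lex (Suc (Suc i)) B'"
    unfolding B'_def using lex2 by (rule rows_lex_drop)
  have ext: "\<exists>a. B' s = B (merge j s) @ a" for s
    by (auto simp: B'_def B3_def B2_def B1_def drop_row_def skip_def ext_def split_def merge_def)
  have ext_new: "\<exists>a. B3 (Suc j) = B j @ a"
    by (auto simp: B3_def B2_def B1_def ext_def split_def)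
  \<comment> \<open>Every other point stays in a row descending from its old row.\<close>
  have merge: "merge j (gap (Suc i) z) = gap i z" if "z \<noteq> i" for z
    using gap_mono[of z i i] gap_mono[of i z i] total[OF that]
    by (auto simp: gap_Suc merge_def j_def dest: trans[of i z i] irrefl[THEN notE])
  have "stage (Suc i) B' \<phi>'"
    unfolding stage_def
  proof (intro conjI allI impI)
    show "generic (Suc (Suc i)) B' {..<Suc i} \<phi>'"
      using x3 by (simp add: B'_def B3_def \<phi>'_def lessThan_Suc)
    show "rows_lex (Suc (Suc i)) B'" by fact
    fix y z assume y: "y < Suc i" and z: "Suc i \<le> z"
    let ?g = "gap (Suc i) z"
    obtain a where a: "B' ?g = B (gap i z) @ a" using ext[of ?g] merge[of z] z by auto
    show "lex_left (\<phi>' y) (B' ?g)" if "lt y z"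
    proof (cases "y = i")
      case True
      then have "j \<le> gap i z" "lt i z" using gap_mono that by (auto simp: j_def)
      then have "Suc j \<le> ?g" by (simp add: gap_Suc)
      moreover have "?g \<le> Suc i" by (rule gap_le)
      ultimately have "lex_left (B3 (Suc j)) (B3 (Suc ?g))" using lex2 by (simp add: rows_lex_def)
      then show ?thesis using True \<open>Suc j \<le> ?g\<close> by (simp add: \<phi>'_def B'_def drop_row_def skip_def)
    next
      case False
      then show ?thesis
        using lex_left_append[OF lr(1)[of y z], of "[]" a] y z that a by (simp add: \<phi>'_def)
    qed
    show "lex_left (B' ?g) (\<phi>' y)" if "lt z y"
    proof (cases "y = i")
      case True
      then have "gap i z \<le> j" "\<not> lt i z" using gap_mono[of z i i] trans[of i z i] irrefl[of i] that True by (auto simp: j_def)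
      then have "?g \<le> j" by (simp add: gap_Suc)
      then have "lex_left (B3 ?g) (B3 (Suc j))" using lex2 j by (simp add: rows_lex_def)
      then show ?thesis using True \<open>?g \<le> j\<close> by (simp add: \<phi>'_def B'_def drop_row_def skip_def)
    next
      case False
      then show ?thesis
        using lex_left_append[OF lr(2)[of y z], of a "[]"] y z that a by (simp add: \<phi>'_def)
    qed
  next
    fix y y' assume y: "y < Suc i" "y' < Suc i" "lt y y'"
    obtain a where a: "B3 (Suc j) = B (gap i i) @ a" using ext_new by (auto simp: j_def)
    consider "y < i" "y' < i" | "y < i" "y' = i" | "y = i" "y' < i" using y irrefl by (auto simp: less_Suc_eq)
    then show "lex_left (\<phi>' y) (\<phi>' y')"
    proof cases
      case 1 then show ?thesis using old y by (simp add: \<phi>'_def)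
    next
      case 2 then show ?thesis
        using lex_left_append[OF lr(1)[of y i], of "[]" a] y a by (simp add: \<phi>'_def)
    next
      case 3 then show ?thesis
        using lex_left_append[OF lr(2)[of y' i], of a "[]"] y a by (simp add: \<phi>'_def)
    qed
  qed
  then show ?thesis by (intro exI[of _ B'] exI[of _ \<phi>']) (simp add: \<phi>'_def)
qed

lemma generic_copy:
  obtains \<phi> where "\<And>x y. lt x y \<Longrightarrow> lex_left (\<phi> x) (\<phi> y)"
    "\<And>S. card S = n \<Longrightarrow> \<kappa> (\<phi> ` S) \<in> col ` {\<tau>. wf_events \<tau> 1 \<and> length \<tau> = 2 * n - 1}"
proof -
  have "\<exists>f. \<forall>i. stage i (fst (f i)) (snd (f i)) \<and> (\<forall>y<i. snd (f (Suc i)) y = snd (f i) y)"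
  proof (rule dependent_nat_choice)
    show "\<exists>s. stage 0 (fst s) (snd s)"
      by (intro exI[of _ "(\<lambda>_. [], \<lambda>_. [])"]) (simp add: stage_0)
    fix s i assume "stage i (fst s) (snd s)"
    from stage_Suc[OF this] show "\<exists>s'. stage (Suc i) (fst s') (snd s') \<and> (\<forall>y<i. snd s' y = snd s y)"
      by auto
  qed
  then obtain f where f: "\<And>i. stage i (fst (f i)) (snd (f i))"
    and f_Suc: "\<And>i y. y < i \<Longrightarrow> snd (f (Suc i)) y = snd (f i) y"
    by blast
  define \<phi> where "\<phi> y = snd (f (Suc y)) y" for y
  have \<phi>: "snd (f k) y = \<phi> y" if "y < k" for y k
    using Suc_leI[OF that]
  proof (induction k rule: dec_induct)
    case base then show ?case by (simp add: \<phi>_def)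
  next
    case (step k) then show ?case by (simp add: f_Suc)
  qed
  show ?thesis
  proof (rule that)
    fix x y assume "lt x y"
    moreover have "x < Suc (max x y)" "y < Suc (max x y)" by auto
    ultimately have "lex_left (snd (f (Suc (max x y))) x) (snd (f (Suc (max x y))) y)"
      using f[of "Suc (max x y)"] unfolding stage_def by blast
    then show "lex_left (\<phi> x) (\<phi> y)" by (simp add: \<phi>)
  next
    fix S :: "nat set" assume S: "card S = n"
    then have "finite S" using n_pos by (metis card.infinite less_irrefl)
    then obtain k where k: "S \<subseteq> {..<k}" using finite_nat_iff_bounded by blast
    have "\<kappa> (snd (f k) ` S) \<in> col ` {\<tau>. wf_events \<tau> 1 \<and> length \<tau> = 2 * n - 1}"
      using f[of k] k S unfolding stage_def by (intro generic_colour) auto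
    moreover have "snd (f k) ` S = \<phi> ` S" using k by (intro image_cong) (auto simp: \<phi>)
    ultimately show "\<kappa> (\<phi> ` S) \<in> col ` {\<tau>. wf_events \<tau> 1 \<and> length \<tau> = 2 * n - 1}" by simp
  qed
qed

end

end

text \<open>The upper bound of Devlin's theorem: an \<open>n\<close>-subset receives the limit
  colour of its event sequence, and \<open>path_count\<close> bounds the number of these
  sequences.\<close>

theorem big_ramsey_degree:
  fixes lt :: "nat \<Rightarrow> nat \<Rightarrow> bool" and \<kappa> :: "bool list set \<Rightarrow> 'c"
  assumes "\<And>x. \<not> lt x x" "\<And>x y z. lt x y \<Longrightarrow> lt y z \<Longrightarrow> lt x z"
    "\<And>x y. x \<noteq> y \<Longrightarrow> lt x y \<or> lt y x"
    and "finite (range \<kappa>)" "0 < n"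
  obtains \<phi> where "\<And>x y. lt x y \<Longrightarrow> lex_left (\<phi> x) (\<phi> y)"
    "finite {\<kappa> (\<phi> ` S) | S. card S = n}"
    "card {\<kappa> (\<phi> ` S) | S. card S = n} \<le> path_count (2 * n - 1) 1"
proof -
  obtain p q where "splitting_pair p q" using splitting_pair_exists by blast
  then interpret generic_colouring p q \<kappa> n
    using assms by (simp add: generic_colouring_def generic_colouring_axioms_def)
  obtain \<phi> where \<phi>: "\<And>x y. lt x y \<Longrightarrow> lex_left (\<phi> x) (\<phi> y)"
    "\<And>S. card S = n \<Longrightarrow> \<kappa> (\<phi> ` S) \<in> col ` {\<tau>. wf_events \<tau> 1 \<and> length \<tau> = 2 * n - 1}"
    using generic_copy[of lt] assms(1-3) by blast
  let ?T = "{\<tau>. wf_events \<tau> 1 \<and> length \<tau> = 2 * n - 1}"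
  have sub: "{\<kappa> (\<phi> ` S) | S. card S = n} \<subseteq> col ` ?T" using \<phi>(2) by blast
  have T: "finite ?T" "card ?T \<le> path_count (2 * n - 1) 1" using card_wf_events by auto
  then have fin: "finite {\<kappa> (\<phi> ` S) | S. card S = n}" using sub finite_subset by blast
  have "card {\<kappa> (\<phi> ` S) | S. card S = n} \<le> card (col ` ?T)"
    using sub T by (intro card_mono) auto
  also have "\<dots> \<le> path_count (2 * n - 1) 1" using card_image_le[OF T(1)] T(2) by (rule order_trans)
  finally show ?thesis using that \<phi>(1) fin by blast
qed

section \<open>Derivatives of the tangent\<close>

text \<open>The polynomial whose value at \<open>tan x\<close> is the \<open>N\<close>-th derivative
  of \<open>tan ^ m\<close> at \<open>x\<close>. The recursion peels off the innermost derivative,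
  so inductions have to generalise \<open>m\<close>.\<close>

primrec tan_deriv_poly :: "nat \<Rightarrow> nat \<Rightarrow> real \<Rightarrow> real" where
  "tan_deriv_poly 0 m y = y ^ m"
| "tan_deriv_poly (Suc N) m y = real m * (tan_deriv_poly N (m - 1) y + tan_deriv_poly N (m + 1) y)"

lemma DERIV_tan_deriv_poly:
  assumes "cos x \<noteq> (0 :: real)"
  shows "((\<lambda>x. tan_deriv_poly N m (tan x)) has_real_derivative tan_deriv_poly (Suc N) m (tan x)) (at x)"
proof (induction N arbitrary: m)
  case 0
  have "inverse ((cos x)\<^sup>2) = 1 + (tan x)\<^sup>2"
    using tan_sec[OF assms] by (simp add: power_inverse)
  then have "(tan has_real_derivative 1 + (tan x)\<^sup>2) (at x)"
    using DERIV_tan[OF assms] by simp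
  then have "((\<lambda>x. tan x ^ m) has_real_derivative real m * ((1 + (tan x)\<^sup>2) * tan x ^ (m - Suc 0))) (at x)"
    by (rule DERIV_power)
  moreover have "real m * ((1 + (tan x)\<^sup>2) * tan x ^ (m - Suc 0)) = real m * (tan x ^ (m - 1) + tan x ^ (m + 1))"
    by (cases m) (simp_all add: algebra_simps power2_eq_square)
  ultimately show ?case by simp
next
  case (Suc N)
  have "((\<lambda>x. real m * (tan_deriv_poly N (m - 1) (tan x) + tan_deriv_poly N (m + 1) (tan x)))
      has_real_derivative real m *
        (tan_deriv_poly (Suc N) (m - 1) (tan x) + tan_deriv_poly (Suc N) (m + 1) (tan x))) (at x)"
    by (intro DERIV_cmult DERIV_add Suc.IH)
  then show ?case by (simp only: tan_deriv_poly.simps)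
qed

lemma deriv_tan_iterated:
  assumes "cos x \<noteq> (0 :: real)"
  shows "(deriv ^^ N) tan x = tan_deriv_poly N 1 (tan x)"
  using assms
proof (induction N arbitrary: x)
  case (Suc N)
  have "eventually (\<lambda>y. cos y \<noteq> 0) (nhds x)"
    using Suc.prems by (intro eventually_nhds_in_open[of "{y. cos y \<noteq> 0}", simplified]
        open_Collect_neq continuous_intros) auto
  then have "eventually (\<lambda>y. (deriv ^^ N) tan y = tan_deriv_poly N 1 (tan y)) (nhds x)"
    by eventually_elim (rule Suc.IH)
  then have "deriv ((deriv ^^ N) tan) x = deriv (\<lambda>y. tan_deriv_poly N 1 (tan y)) x"
    by (rule deriv_cong_ev) simp
  also have "\<dots> = tan_deriv_poly (Suc N) 1 (tan x)"
    using Suc.prems by (intro DERIV_imp_deriv DERIV_tan_deriv_poly)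
  finally show ?case by simp
qed simp

lemma tan_deriv_poly_0: "tan_deriv_poly N m 0 = real (path_count N m)"
  by (induction N arbitrary: m) simp_all

lemma odd_tangent_number_eq: "odd_tangent_number j = real (path_count (2 * j - 1) 1)"
  using deriv_tan_iterated[of 0 "2 * j - 1"] by (simp add: odd_tangent_number_def tan_deriv_poly_0)

lemma path_count_odd_pos: "0 < path_count (Suc (2 * k)) 1"
  by (induction k) (auto simp: numeral_2_eq_2)

section \<open>The adjoint of a monotone surjection\<close>

definition lex_less :: "(nat \<Rightarrow> nat) \<Rightarrow> (nat \<Rightarrow> nat) \<Rightarrow> bool" where
  "lex_less x y \<longleftrightarrow> (\<exists>n. (\<forall>i<n. x i = y i) \<and> x n < y n)"

lemma first_diff_eqI:
  assumes "\<And>i. i < n \<Longrightarrow> x i = y i" "x n \<noteq> y n"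
  shows "first_diff x y = n"
  unfolding first_diff_def using assms by (intro Least_equality) (auto simp: not_le[symmetric])

lemma lex_le_iff: "lex_le x y \<longleftrightarrow> x = y \<or> lex_less x y"
proof -
  have "lex_less x y" if "x (first_diff x y) < y (first_diff x y)"
    using that first_diff_eq_below unfolding lex_less_def by blast
  moreover have "x (first_diff x y) < y (first_diff x y)" if "lex_less x y"
    using that first_diff_eqI unfolding lex_less_def by (metis less_irrefl)
  ultimately show ?thesis by (auto simp: lex_le_def)
qed

lemma lex_less_irrefl: "\<not> lex_less x x"
  by (simp add: lex_less_def)

lemma lex_less_trans: "lex_less x z" if xy: "lex_less x y" and yz: "lex_less y z"
proof -
  obtain n where n: "\<And>i. i < n \<Longrightarrow> x i = y i" "x n < y n" using xy by (auto simp: lex_less_def)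
  obtain m where m: "\<And>i. i < m \<Longrightarrow> y i = z i" "y m < z m" using yz by (auto simp: lex_less_def)
  have "(\<forall>i<min n m. x i = z i) \<and> x (min n m) < z (min n m)"
    using n m by (cases n m rule: linorder_cases) (auto simp: min_def)
  then show ?thesis unfolding lex_less_def by blast
qed

lemma lex_less_total: "x \<noteq> y \<Longrightarrow> lex_less x y \<or> lex_less y x"
  using lex_le_iff[of x y] lex_le_iff[of y x] first_diff_neq[of x y] first_diff_commute[of x y]
  by (auto simp: lex_le_def)

lemma lex_le_refl: "lex_le x x"
  by (simp add: lex_le_iff)

lemma lex_le_trans: "lex_le x y \<Longrightarrow> lex_le y z \<Longrightarrow> lex_le x z"
  using lex_less_trans by (auto simp: lex_le_iff)

lemma lex_le_antisym: "lex_le x y \<Longrightarrow> lex_le y x \<Longrightarrow> x = y"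
  using lex_less_trans lex_less_irrefl by (auto simp: lex_le_iff)

lemma not_lex_le: "\<not> lex_le x y \<longleftrightarrow> lex_less y x"
  using lex_less_total lex_less_trans lex_less_irrefl by (metis lex_le_iff)

lemma lex_le_zero: "lex_le (\<lambda>_. 0) x"
  using not_lex_le[of "\<lambda>_. 0" x] by (auto simp: lex_less_def)

definition trunc :: "nat \<Rightarrow> (nat \<Rightarrow> nat) \<Rightarrow> nat \<Rightarrow> nat" where
  "trunc k x n = (if n < k then x n else 0)"

lemma trunc_eq_iff: "trunc k x = trunc k y \<longleftrightarrow> (\<forall>i<k. x i = y i)"
  by (auto simp: trunc_def fun_eq_iff)

lemma trunc_0: "trunc 0 x = (\<lambda>_. 0)"
  by (simp add: trunc_def fun_eq_iff)

lemma trunc_id_iff: "trunc k x = x \<longleftrightarrow> (\<forall>n\<ge>k. x n = 0)"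
  by (auto simp: trunc_def fun_eq_iff)

lemma trunc_trunc: "trunc k (trunc n x) = trunc (min k n) x"
  by (auto simp: trunc_def)

lemma trunc_mono: "lex_le x y \<Longrightarrow> lex_le (trunc k x) (trunc k y)"
proof -
  assume "lex_le x y"
  then consider "x = y" | n where "\<And>i. i < n \<Longrightarrow> x i = y i" "x n < y n"
    by (auto simp: lex_le_iff lex_less_def)
  then show ?thesis
  proof cases
    case 2
    show ?thesis
    proof (cases "n < k")
      case True
      then have "lex_less (trunc k x) (trunc k y)"
        using 2 unfolding lex_less_def by (intro exI[of _ n]) (auto simp: trunc_def)
      then show ?thesis by (simp add: lex_le_iff)
    next
      case False
      then have "trunc k x = trunc k y" using 2 by (auto simp: trunc_eq_iff)
      then show ?thesis by (simp add: lex_le_refl)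
    qed
  qed (simp add: lex_le_refl)
qed

lemma trunc_le: "lex_le (trunc k x) x"
proof (cases "trunc k x = x")
  case False
  then have "\<exists>n. x n \<noteq> trunc k x n" by (metis ext)
  define n where "n = first_diff (trunc k x) x"
  have "trunc k x n \<noteq> x n" unfolding n_def using False by (rule first_diff_neq)
  then have "trunc k x n < x n" by (auto simp: trunc_def split: if_splits)
  then show ?thesis by (simp add: lex_le_def n_def)
qed (simp add: lex_le_refl)

lemma trunc_in_seqs: "x \<in> seqs b \<Longrightarrow> trunc k x \<in> seqs b"
  by (auto simp: seqs_def trunc_def)

text \<open>Truncation is monotone and never increases a point. Comparison with such a
  \<open>z\<close> thus depends on \<open>k\<close> digits only and is a clopen condition.\<close>

lemma lex_le_trunc_iff: "trunc k z = z \<Longrightarrow> lex_le z (trunc k x) \<longleftrightarrow> lex_le z x"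
  using trunc_mono[of z x k] trunc_le[of k x] lex_le_trans[of z "trunc k x" x] by auto

lemma trunc_id_mono: "trunc k z = z \<Longrightarrow> k \<le> n \<Longrightarrow> trunc n z = z"
  by (metis trunc_trunc min.absorb2)

text \<open>Such a \<open>z\<close> stands for the clopen division of the sequences into those below
  \<open>z\<close> and those from \<open>z\<close> on; zero is excluded because its lower part is
  empty.\<close>

definition cuts_upto :: "nat \<Rightarrow> nat \<Rightarrow> (nat \<Rightarrow> nat) set" where
  "cuts_upto b k = {z \<in> seqs b. z \<noteq> (\<lambda>_. 0) \<and> trunc k z = z}"

definition cuts :: "nat \<Rightarrow> (nat \<Rightarrow> nat) set" where
  "cuts b = (\<Union>k. cuts_upto b k)"

lemma card_trunc_seqs:
  assumes "0 < b"
  shows "finite {z \<in> seqs b. trunc k z = z}" "card {z \<in> seqs b. trunc k z = z} = b ^ k"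
proof -
  let ?F = "\<lambda>g n. if n < k then g n else 0 :: nat"
  let ?P = "{..<k} \<rightarrow>\<^sub>E {..<b}"
  have inj: "inj_on ?F ?P"
  proof (rule inj_onI)
    fix g h assume g: "g \<in> ?P" "h \<in> ?P" and eq: "?F g = ?F h"
    have "g n = h n" if "n \<in> {..<k}" for n using that fun_cong[OF eq, of n] by simp
    then show "g = h" using g by (intro PiE_ext)
  qed
  have eq: "?F ` ?P = {z \<in> seqs b. trunc k z = z}"
  proof (intro equalityI subsetI)
    fix z assume z: "z \<in> {z \<in> seqs b. trunc k z = z}"
    then have "\<And>n. z n < b" and "\<And>n. \<not> n < k \<Longrightarrow> z n = 0"
      by (auto simp: seqs_def trunc_id_iff)
    then show "z \<in> ?F ` ?P"
      by (intro image_eqI[where x = "restrict z {..<k}"]) (auto simp: fun_eq_iff)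
  next
    fix z assume "z \<in> ?F ` ?P"
    then obtain g where g: "g \<in> ?P" "z = ?F g" by blast
    have "g n < b" if "n < k" for n using PiE_mem[OF g(1), of n] that by simp
    then show "z \<in> {z \<in> seqs b. trunc k z = z}"
      using assms by (simp add: seqs_def trunc_id_iff g(2))
  qed
  show "finite {z \<in> seqs b. trunc k z = z}"
    unfolding eq[symmetric] by (intro finite_imageI finite_PiE) auto
  show "card {z \<in> seqs b. trunc k z = z} = b ^ k"
    unfolding eq[symmetric] by (simp add: card_image[OF inj] card_PiE)
qed

lemma zero_in_trunc_seqs: "0 < b \<Longrightarrow> (\<lambda>_. 0) \<in> {z \<in> seqs b. trunc k z = z}"
  by (auto simp: seqs_def trunc_def)

lemma cuts_upto_eq: "cuts_upto b k = {z \<in> seqs b. trunc k z = z} - {\<lambda>_. 0}"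
  by (auto simp: cuts_upto_def)

lemma finite_cuts_upto: "0 < b \<Longrightarrow> finite (cuts_upto b k)"
  by (simp add: cuts_upto_eq card_trunc_seqs)

lemma card_cuts_upto: "0 < b \<Longrightarrow> card (cuts_upto b k) = b ^ k - 1"
  using zero_in_trunc_seqs card_trunc_seqs by (simp add: cuts_upto_eq card_Diff_singleton)

lemma cuts_upto_subset: "cuts_upto b k \<subseteq> cuts b"
  by (auto simp: cuts_def)

lemma cuts_subset_seqs: "z \<in> cuts b \<Longrightarrow> z \<in> seqs b"
  by (auto simp: cuts_def cuts_upto_def)

lemma cuts_nonzero: "z \<in> cuts b \<Longrightarrow> z \<noteq> (\<lambda>_. 0)"
  by (auto simp: cuts_def cuts_upto_def)

lemma trunc_in_cuts_upto:
  "x \<in> seqs b \<Longrightarrow> trunc k x \<noteq> (\<lambda>_. 0) \<Longrightarrow> trunc k x \<in> cuts_upto b k"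
  by (simp add: cuts_upto_def trunc_in_seqs trunc_trunc)

lemma lex_le_trunc_cut: "z \<in> cuts_upto b k \<Longrightarrow> lex_le z (trunc k x) \<longleftrightarrow> lex_le z x"
  by (intro lex_le_trunc_iff) (simp add: cuts_upto_def)

text \<open>Unless it vanishes, \<open>trunc k u\<close> is itself one of the cuts.\<close>

lemma trunc_le_if_cuts:
  assumes "u \<in> seqs b" "\<And>z. z \<in> cuts_upto b k \<Longrightarrow> lex_le z u \<Longrightarrow> lex_le z v"
  shows "lex_le (trunc k u) (trunc k v)"
proof (cases "trunc k u = (\<lambda>_. 0)")
  case True
  then show ?thesis by (simp add: lex_le_zero)
next
  case False
  then have "trunc k u \<in> cuts_upto b k" using assms(1) by (intro trunc_in_cuts_upto)
  then show ?thesis using assms(2) trunc_le lex_le_trunc_cut by blast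
qed

lemma le_if_trunc_le:
  assumes "\<And>k. lex_le (trunc k u) (trunc k v)"
  shows "lex_le u v"
proof (rule ccontr)
  assume "\<not> lex_le u v"
  then obtain n where n: "\<And>i. i < n \<Longrightarrow> v i = u i" "v n < u n"
    by (auto simp: not_lex_le lex_less_def)
  then have "lex_less (trunc (Suc n) v) (trunc (Suc n) u)"
    unfolding lex_less_def by (intro exI[of _ n]) (auto simp: trunc_def)
  with assms show False by (metis not_lex_le)
qed

lemma le_if_cuts:
  assumes "u \<in> seqs b" "\<And>z. z \<in> cuts b \<Longrightarrow> lex_le z u \<Longrightarrow> lex_le z v"
  shows "lex_le u v"
proof (rule le_if_trunc_le)
  show "lex_le (trunc k u) (trunc k v)" for k
    using assms(1) by (rule trunc_le_if_cuts) (use assms(2) cuts_upto_subset in blast)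
qed

lemma rho_le_if_trunc_eq: "trunc k x = trunc k y \<Longrightarrow> rho x y \<le> (1/2) ^ k"
proof (cases "x = y")
  case False
  assume "trunc k x = trunc k y"
  then have "k \<le> first_diff x y"
    using first_diff_neq[OF False] by (auto simp: trunc_eq_iff not_less[symmetric])
  then show ?thesis using False by (auto simp: rho_def intro: power_decreasing)
qed (simp add: rho_def)

lemma trunc_eq_if_rho_less:
  assumes "rho x y < (1/2) ^ k"
  shows "trunc k x = trunc k y"
proof (cases "x = y")
  case False
  then have "k < first_diff x y" using assms by (simp add: rho_def power_strict_decreasing_iff)
  then show ?thesis by (auto simp: trunc_eq_iff first_diff_eq_below)
qed simp

section \<open>Continuity and compactness in terms of digits\<close>

lemma continuous_map_seq_top_iff:
  assumes f: "f \<in> seqs b \<rightarrow> seqs b"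
  shows "continuous_map (seq_top b) (seq_top b) f \<longleftrightarrow>
    (\<forall>x\<in>seqs b. \<forall>K. \<exists>N. \<forall>y\<in>seqs b. trunc N x = trunc N y \<longrightarrow> trunc K (f x) = trunc K (f y))"
    (is "_ \<longleftrightarrow> ?R")
proof -
  interpret S: Metric_space "seqs b" rho by (rule Metric_space_rho)
  have small: "\<exists>N. (1/2) ^ N < r" if "0 < r" for r :: real
    using real_arch_pow_inv[OF that, of "1/2"] by simp
  show ?thesis
  proof
    assume cont: "continuous_map (seq_top b) (seq_top b) f"
    show ?R
    proof (intro ballI allI)
      fix x K assume x: "x \<in> seqs b"
      let ?U = "{y \<in> topspace (seq_top b). f y \<in> S.mball (f x) ((1/2) ^ K)}"
      have "openin (seq_top b) ?U"
        using cont S.openin_mball by (rule openin_continuous_map_preimage)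
      moreover have "x \<in> ?U" using x f by (auto simp: Pi_iff)
      ultimately obtain r where r: "0 < r" "S.mball x r \<subseteq> ?U"
        unfolding S.openin_mtopology by blast
      obtain N where N: "(1/2) ^ N < r" using small r by blast
      have "trunc K (f x) = trunc K (f y)" if "y \<in> seqs b" "trunc N x = trunc N y" for y
      proof -
        have "y \<in> S.mball x r" using rho_le_if_trunc_eq[OF that(2)] N x that(1) by auto
        then have "rho (f x) (f y) < (1/2) ^ K" using r by auto
        then show ?thesis by (rule trunc_eq_if_rho_less)
      qed
      then show "\<exists>N. \<forall>y\<in>seqs b. trunc N x = trunc N y \<longrightarrow> trunc K (f x) = trunc K (f y)" by blast
    qed
  next
    assume R: ?R
    show "continuous_map (seq_top b) (seq_top b) f"
      unfolding continuous_map_def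
    proof (intro conjI allI impI)
      show "f \<in> topspace (seq_top b) \<rightarrow> topspace (seq_top b)" using f by simp
      fix U assume U: "openin (seq_top b) U"
      show "openin (seq_top b) {x \<in> topspace (seq_top b). f x \<in> U}"
        unfolding S.openin_mtopology
      proof (intro conjI allI impI)
        fix x assume "x \<in> {x \<in> topspace (seq_top b). f x \<in> U}"
        then have x: "x \<in> seqs b" "f x \<in> U" by auto
        obtain r where r: "0 < r" "S.mball (f x) r \<subseteq> U" using U x unfolding S.openin_mtopology by blast
        obtain K where K: "(1/2) ^ K < r" using small r by blast
        obtain N where N: "\<forall>y\<in>seqs b. trunc N x = trunc N y \<longrightarrow> trunc K (f x) = trunc K (f y)"
          using R x by blast
        have "S.mball x ((1/2) ^ N) \<subseteq> {x \<in> topspace (seq_top b). f x \<in> U}"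
        proof
          fix y assume "y \<in> S.mball x ((1/2) ^ N)"
          then have y: "y \<in> seqs b" "trunc N x = trunc N y" by (auto intro: trunc_eq_if_rho_less)
          then have "rho (f x) (f y) \<le> (1/2) ^ K" using N rho_le_if_trunc_eq by blast
          then have "f y \<in> S.mball (f x) r" using K x y f by (auto simp: Pi_iff)
          then show "y \<in> {x \<in> topspace (seq_top b). f x \<in> U}" using r y by auto
        qed
        then show "\<exists>r>0. S.mball x r \<subseteq> {x \<in> topspace (seq_top b). f x \<in> U}"
          by (intro exI[of _ "(1/2) ^ N"]) simp
      qed auto
    qed
  qed
qed

text \<open>Koenig's argument: among the \<open>b\<close> possible next digits, one is shared by
  infinitely many of the terms that agree so far.\<close>

lemma seqs_compact:
  fixes xs :: "nat \<Rightarrow> nat \<Rightarrow> nat"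
  assumes "\<And>n. xs n \<in> seqs b"
  obtains x where "x \<in> seqs b" "\<And>N. infinite {n. trunc N x = trunc N (xs n)}"
proof -
  let ?I = "\<lambda>N s. {n. trunc N s = trunc N (xs n)}"
  have "\<exists>f. \<forall>N. infinite (?I N (f N)) \<and> trunc N (f (Suc N)) = trunc N (f N)"
  proof (rule dependent_nat_choice)
    show "\<exists>s. infinite (?I 0 s)" by (simp add: trunc_0 infinite_UNIV_nat)
    fix s N assume inf: "infinite (?I N s)"
    have "?I N s \<subseteq> (\<Union>d<b. ?I (Suc N) (s(N := d)))"
    proof
      fix n assume "n \<in> ?I N s"
      then have "n \<in> ?I (Suc N) (s(N := xs n N))" by (auto simp: trunc_eq_iff less_Suc_eq)
      moreover have "xs n N < b" using assms by (simp add: seqs_def)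
      ultimately show "n \<in> (\<Union>d<b. ?I (Suc N) (s(N := d)))" by blast
    qed
    with inf have "\<not> finite (\<Union>d<b. ?I (Suc N) (s(N := d)))" using finite_subset by blast
    then obtain d where "infinite (?I (Suc N) (s(N := d)))" by blast
    then show "\<exists>s'. infinite (?I (Suc N) s') \<and> trunc N s' = trunc N s"
      by (intro exI[of _ "s(N := d)"]) (simp add: trunc_eq_iff)
  qed
  then obtain f where f: "\<And>N. infinite (?I N (f N))" "\<And>N. trunc N (f (Suc N)) = trunc N (f N)"
    by blast
  define x where "x N = f (Suc N) N" for N
  have x: "trunc N x = trunc N (f N)" for N
  proof (induction N)
    case (Suc N)
    then have "trunc N x = trunc N (f (Suc N))" using f(2) by simp
    then show ?case by (auto simp: trunc_eq_iff less_Suc_eq x_def)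
  qed (simp add: trunc_def)
  show ?thesis
  proof (rule that)
    show inf: "infinite (?I N x)" for N using f(1)[of N] x[of N] by simp
    show "x \<in> seqs b"
      unfolding seqs_def
    proof (intro CollectI allI)
      fix N
      obtain n where "trunc (Suc N) x = trunc (Suc N) (xs n)"
        using inf[of "Suc N"] by (metis (mono_tags, lifting) Collect_empty_eq finite.emptyI)
      then have "x N = xs n N" by (auto simp: trunc_eq_iff)
      then show "x N < b" using assms[of n] by (simp add: seqs_def)
    qed
  qed
qed

lemma Csur_uniform:
  assumes "f \<in> Csur b"
  obtains N where "\<And>x y. x \<in> seqs b \<Longrightarrow> y \<in> seqs b \<Longrightarrow> trunc N x = trunc N y \<Longrightarrow> trunc K (f x) = trunc K (f y)"
proof (rule ccontr)
  assume "\<not> thesis"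
  with that have "\<forall>N. \<exists>x y. x \<in> seqs b \<and> y \<in> seqs b \<and> trunc N x = trunc N y \<and> trunc K (f x) \<noteq> trunc K (f y)"
    by blast
  then obtain X Y where XY: "\<And>N. X N \<in> seqs b" "\<And>N. Y N \<in> seqs b"
    "\<And>N. trunc N (X N) = trunc N (Y N)" "\<And>N. trunc K (f (X N)) \<noteq> trunc K (f (Y N))"
    by metis
  obtain x where x: "x \<in> seqs b" "\<And>N. infinite {n. trunc N x = trunc N (X n)}"
    using seqs_compact[of X b] XY(1) by blast
  have "f \<in> seqs b \<rightarrow> seqs b" "continuous_map (seq_top b) (seq_top b) f"
    using assms CsurD(3)[OF assms] by (auto simp: Csur_def)
  then obtain N where N: "\<And>y. y \<in> seqs b \<Longrightarrow> trunc N x = trunc N y \<Longrightarrow> trunc K (f x) = trunc K (f y)"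
    using x(1) continuous_map_seq_top_iff[of f b] by blast
  obtain n where n: "N \<le> n" "trunc N x = trunc N (X n)"
    using x(2)[of N] unfolding infinite_nat_iff_unbounded_le by blast
  have "trunc N (X n) = trunc N (Y n)" using XY(3)[of n] n(1) by (auto simp: trunc_eq_iff)
  with n N XY(1,2,4) show False by metis
qed

text \<open>By uniform continuity, whether \<open>f x\<close> is at or above \<open>z\<close> is
  decided by \<open>N\<close> digits of \<open>x\<close>. The set of these \<open>x\<close> is
  closed upwards, so its least truncation \<open>w\<close> generates it. Surjectivity makes it
  nonempty and, as \<open>f\<close> attains zero, different from the whole space.\<close>

lemma cut_preimage:
  assumes f: "f \<in> Csur b" and z: "z \<in> cuts b"
  shows "\<exists>w\<in>cuts b. \<forall>x\<in>seqs b. lex_le z (f x) \<longleftrightarrow> lex_le w x"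
proof -
  obtain K where K: "z \<in> cuts_upto b K" using z by (auto simp: cuts_def)
  obtain N where N: "\<And>x y. x \<in> seqs b \<Longrightarrow> y \<in> seqs b \<Longrightarrow> trunc N x = trunc N y \<Longrightarrow> trunc K (f x) = trunc K (f y)"
    using Csur_uniform[OF f] by blast
  define S where "S = trunc N ` {x \<in> seqs b. lex_le z (f x)}"
  have zb: "z \<in> seqs b" using z by (rule cuts_subset_seqs)
  then have b: "0 < b" by (auto simp: seqs_def intro: le_less_trans)
  have "finite S"
    using card_trunc_seqs(1)[OF b, of N]
    by (rule finite_subset[rotated]) (auto simp: S_def trunc_in_seqs trunc_trunc)
  moreover have "S \<noteq> {}"
  proof -
    have "z \<in> f ` seqs b" using zb CsurD(2)[OF f] by simp
    then show ?thesis by (auto simp: S_def lex_le_refl)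
  qed
  moreover have "asymp_on S lex_less" "transp_on S lex_less"
    using lex_less_trans lex_less_irrefl by (blast intro: asymp_onI transp_onI)+
  ultimately obtain w where w: "w \<in> S" "\<And>x. x \<in> S \<Longrightarrow> x \<noteq> w \<Longrightarrow> \<not> lex_less x w"
    using Finite_Set.bex_min_element[of S lex_less] by blast
  have min: "lex_le w x" if "x \<in> S" for x
    using w(2)[OF that] not_lex_le lex_le_refl by metis
  obtain x0 where x0: "x0 \<in> seqs b" "lex_le z (f x0)" "w = trunc N x0" using w(1) by (auto simp: S_def)
  have wb: "w \<in> seqs b" using x0 by (simp add: trunc_in_seqs)
  have "trunc N w = trunc N x0" by (simp add: x0(3) trunc_trunc)
  then have "trunc K (f w) = trunc K (f x0)" using N wb x0(1) by blast
  then have zw: "lex_le z (f w)" using x0(2) lex_le_trunc_cut[OF K] by metis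
  have mono: "lex_le (f x) (f y)" if "x \<in> seqs b" "y \<in> seqs b" "lex_le x y" for x y
    using f that by (auto simp: Csur_def)
  have iff: "lex_le z (f x) \<longleftrightarrow> lex_le w x" if x: "x \<in> seqs b" for x
  proof
    assume "lex_le z (f x)"
    then have "trunc N x \<in> S" using x by (auto simp: S_def)
    then show "lex_le w x" using min trunc_le lex_le_trans by blast
  next
    assume "lex_le w x"
    then show "lex_le z (f x)" using mono wb x zw lex_le_trans by blast
  qed
  have "w \<noteq> (\<lambda>_. 0)"
  proof
    assume w0: "w = (\<lambda>_. 0)"
    have "(\<lambda>_. 0) \<in> f ` seqs b" using b CsurD(2)[OF f] by (auto simp: seqs_def)
    then obtain x where "x \<in> seqs b" "f x = (\<lambda>_. 0)" by auto
    then have "lex_le z (\<lambda>_. 0)" using iff[of x] w0 lex_le_zero by simp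
    then have "z = (\<lambda>_. 0)" using lex_le_zero by (rule lex_le_antisym)
    with cuts_nonzero[OF z] show False by simp
  qed
  then have "w \<in> cuts_upto b N" using wb by (simp add: cuts_upto_def x0(3) trunc_trunc)
  then show ?thesis using iff cuts_upto_subset by blast
qed

definition adj :: "nat \<Rightarrow> ((nat \<Rightarrow> nat) \<Rightarrow> nat \<Rightarrow> nat) \<Rightarrow> (nat \<Rightarrow> nat) \<Rightarrow> nat \<Rightarrow> nat" where
  "adj b f z = (SOME w. w \<in> cuts b \<and> (\<forall>x\<in>seqs b. lex_le z (f x) \<longleftrightarrow> lex_le w x))"

lemma adj:
  assumes "f \<in> Csur b" "z \<in> cuts b"
  shows "adj b f z \<in> cuts b" "\<And>x. x \<in> seqs b \<Longrightarrow> lex_le z (f x) \<longleftrightarrow> lex_le (adj b f z) x"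
  using someI_ex[of "\<lambda>w. w \<in> cuts b \<and> (\<forall>x\<in>seqs b. lex_le z (f x) \<longleftrightarrow> lex_le w x)"]
    cut_preimage[OF assms] unfolding adj_def by blast+

lemma adj_eqI:
  assumes "f \<in> Csur b" "z \<in> cuts b" "w \<in> seqs b" "\<And>x. x \<in> seqs b \<Longrightarrow> lex_le z (f x) \<longleftrightarrow> lex_le w x"
  shows "adj b f z = w"
  using adj[OF assms(1,2)] assms(3,4) cuts_subset_seqs lex_le_refl lex_le_antisym by metis

text \<open>A point \<open>x\<close> with \<open>f x = z\<close> lies at or above
  \<open>adj b f z\<close>. If this is also \<open>adj b f z'\<close>, then \<open>z'\<close> is at
  most \<open>f x = z\<close>; the other inequality is symmetric.\<close>

lemma inj_adj:
  assumes "f \<in> Csur b"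
  shows "inj_on (adj b f) (cuts b)"
proof (rule inj_onI)
  have le: "lex_le z' z" if z: "z \<in> cuts b" "z' \<in> cuts b" and eq: "adj b f z = adj b f z'" for z z'
  proof -
    have "z \<in> f ` seqs b" using cuts_subset_seqs[OF z(1)] CsurD(2)[OF assms] by simp
    then obtain x where "x \<in> seqs b" "f x = z" by auto
    then show ?thesis using adj(2)[OF assms z(1), of x] adj(2)[OF assms z(2), of x] eq lex_le_refl by simp
  qed
  show "z = z'" if "z \<in> cuts b" "z' \<in> cuts b" "adj b f z = adj b f z'" for z z'
    using le[OF that] le[OF that(2,1)] that(3) by (simp add: lex_le_antisym)
qed

text \<open>The number of cuts of length \<open>k\<close> up to \<open>f x\<close> equals the number
  of members of the image up to \<open>x\<close>. The sets of cuts up to two points are nested, so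
  equal sizes make them equal. The unordered image therefore determines \<open>f\<close> up to level
  \<open>k\<close>, and a colouring of sets suffices.\<close>

lemma trunc_eq_if_adj_image_eq:
  assumes f: "f \<in> Csur b" and g: "g \<in> Csur b"
    and eq: "adj b f ` cuts_upto b k = adj b g ` cuts_upto b k" and x: "x \<in> seqs b"
  shows "trunc k (f x) = trunc k (g x)"
proof -
  have b: "0 < b" using x by (auto simp: seqs_def intro: le_less_trans)
  let ?Z = "cuts_upto b k"
  have card: "card {z \<in> ?Z. lex_le z (f x)} = card {w \<in> adj b f ` ?Z. lex_le w x}" if f: "f \<in> Csur b" for f
  proof -
    have "{w \<in> adj b f ` ?Z. lex_le w x} = adj b f ` {z \<in> ?Z. lex_le z (f x)}"
      using adj(2)[OF f _ x] cuts_upto_subset by blast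
    moreover have "inj_on (adj b f) {z \<in> ?Z. lex_le z (f x)}"
      using inj_adj[OF f] cuts_upto_subset by (blast intro: inj_on_subset)
    ultimately show ?thesis by (simp add: card_image)
  qed
  then have cards: "card {z \<in> ?Z. lex_le z (f x)} = card {z \<in> ?Z. lex_le z (g x)}"
    using f g eq by simp
  have fin: "finite ?Z" using b by (rule finite_cuts_upto)
  have sets: "{z \<in> ?Z. lex_le z (f x)} = {z \<in> ?Z. lex_le z (g x)}"
  proof (cases "lex_le (f x) (g x)")
    case True
    then have "{z \<in> ?Z. lex_le z (f x)} \<subseteq> {z \<in> ?Z. lex_le z (g x)}" using lex_le_trans by blast
    then show ?thesis using cards fin by (intro card_subset_eq) auto
  next
    case False
    then have "lex_le (g x) (f x)" by (metis not_lex_le lex_le_iff)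
    then have "{z \<in> ?Z. lex_le z (g x)} \<subseteq> {z \<in> ?Z. lex_le z (f x)}" using lex_le_trans by blast
    then show ?thesis using cards fin by (intro card_subset_eq[symmetric]) auto
  qed
  have "f x \<in> seqs b" "g x \<in> seqs b" using f g x CsurD(3) by blast+
  moreover have "lex_le z (f x) \<longleftrightarrow> lex_le z (g x)" if "z \<in> ?Z" for z
    using sets that by blast
  ultimately show ?thesis by (intro lex_le_antisym trunc_le_if_cuts[of _ b]) simp_all
qed

lemma rho_inf_le_if_adj_image_eq:
  assumes "f \<in> Csur b" "g \<in> Csur b" "adj b f ` cuts_upto b k = adj b g ` cuts_upto b k" "0 < b"
  shows "rho_inf b f g \<le> (1/2) ^ k"
  unfolding rho_inf_def
proof (rule cSUP_least)
  show "seqs b \<noteq> {}" using assms(4) by (intro seqs_nonempty) simp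
  show "rho (f x) (g x) \<le> (1/2) ^ k" if "x \<in> seqs b" for x
    using trunc_eq_if_adj_image_eq[OF assms(1-3) that] by (rule rho_le_if_trunc_eq)
qed

text \<open>The first \<open>n\<close> digits of the largest point lying above all cuts \<open>z\<close> with \<open>e z \<le> x\<close>.\<close>

primrec approx :: "nat \<Rightarrow> ((nat \<Rightarrow> nat) \<Rightarrow> nat \<Rightarrow> nat) \<Rightarrow> (nat \<Rightarrow> nat) \<Rightarrow> nat \<Rightarrow> nat \<Rightarrow> nat" where
  "approx b e x 0 = (\<lambda>_. 0)"
| "approx b e x (Suc n) = (approx b e x n)(n :=
     Max {d. d < b \<and> (d = 0 \<or> lex_le (e ((approx b e x n)(n := d))) x)})"

section \<open>Realising strictly increasing maps of cuts as adjoints\<close>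

context
  fixes b :: nat and e :: "(nat \<Rightarrow> nat) \<Rightarrow> nat \<Rightarrow> nat"
  assumes b: "0 < b"
    and e_cuts: "\<And>z. z \<in> cuts b \<Longrightarrow> e z \<in> cuts b"
    and e_less: "\<And>z z'. z \<in> cuts b \<Longrightarrow> z' \<in> cuts b \<Longrightarrow> lex_less z z' \<Longrightarrow> lex_less (e z) (e z')"
begin

lemma e_mono: "z \<in> cuts b \<Longrightarrow> z' \<in> cuts b \<Longrightarrow> lex_le z z' \<Longrightarrow> lex_le (e z) (e z')"
  using e_less by (auto simp: lex_le_iff)

lemma approx_digit:
  fixes x n
  defines "S \<equiv> {d. d < b \<and> (d = 0 \<or> lex_le (e ((approx b e x n)(n := d))) x)}"
  shows "Max S \<in> S" "\<And>d. d \<in> S \<Longrightarrow> d \<le> Max S"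
proof -
  have "finite S" by (rule finite_subset[of _ "{..<b}"]) (auto simp: S_def)
  moreover have "0 \<in> S" using b by (simp add: S_def)
  ultimately show "Max S \<in> S" "\<And>d. d \<in> S \<Longrightarrow> d \<le> Max S" using Max_in Max_ge by blast+
qed

lemma approx_seqs: "approx b e x n \<in> seqs b" "trunc n (approx b e x n) = approx b e x n"
proof (induction n)
  case (Suc n)
  have "Max {d. d < b \<and> (d = 0 \<or> lex_le (e ((approx b e x n)(n := d))) x)} < b"
    using approx_digit(1)[where x = x and n = n] by simp
  then show "approx b e x (Suc n) \<in> seqs b" using Suc.IH(1) by (simp add: seqs_def)
  show "trunc (Suc n) (approx b e x (Suc n)) = approx b e x (Suc n)"
    using Suc.IH(2) by (auto simp: trunc_id_iff)
qed (use b in \<open>auto simp: seqs_def trunc_def\<close>)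

text \<open>If \<open>z\<close> agrees with the digits chosen so far, digit \<open>n\<close>
  decides, and \<open>m\<close> is the largest admissible one. Otherwise the first \<open>n\<close>
  digits settle the comparison, and the induction hypothesis is applied to truncations.\<close>

lemma approx_cut_iff:
  "z \<in> cuts_upto b n \<Longrightarrow> lex_le z (approx b e x n) \<longleftrightarrow> lex_le (e z) x"
proof (induction n arbitrary: z)
  case 0
  then show ?case by (auto simp: cuts_upto_def trunc_0)
next
  case (Suc n)
  define a where "a = approx b e x n"
  define m where "m = Max {d. d < b \<and> (d = 0 \<or> lex_le (e (a(n := d))) x)}"
  have m: "m < b" "m = 0 \<or> lex_le (e (a(n := m))) x"
    and m_ge: "\<And>d. d < b \<Longrightarrow> lex_le (e (a(n := d))) x \<Longrightarrow> d \<le> m"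
    using approx_digit[where x = x and n = n] unfolding m_def a_def by blast+
  have a: "a \<in> seqs b" "trunc n a = a" using approx_seqs by (auto simp: a_def)
  then have a_n: "a i = 0" if "n \<le> i" for i using that by (simp add: trunc_id_iff)
  have z: "z \<in> seqs b" "trunc (Suc n) z = z" "z \<in> cuts b"
    using Suc.prems cuts_upto_subset by (auto simp: cuts_upto_def)
  have z_n: "z i = 0" if "Suc n \<le> i" for i
    using fun_cong[OF z(2), of i] that by (auto simp: trunc_def)
  have cut_a: "a \<in> cuts b" "lex_le (e a) x" if "a \<noteq> (\<lambda>_. 0)"
    using that a Suc.IH[of a] cuts_upto_subset lex_le_refl by (auto simp: cuts_upto_def a_def)
  have "lex_le z (a(n := m)) \<longleftrightarrow> lex_le (e z) x"
  proof (cases "trunc n z = a")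
    case True
    have z_eq: "z = a(n := z n)"
    proof
      fix i
      show "z i = (a(n := z n)) i"
        using fun_cong[OF True, of i] z_n[of i] a_n[of i] by (auto simp: trunc_def split: if_splits)
    qed
    have le_iff: "lex_le z (a(n := m)) \<longleftrightarrow> z n \<le> m"
    proof
      assume "z n \<le> m"
      then consider "z n = m" | "z n < m" by linarith
      then show "lex_le z (a(n := m))"
      proof cases
        case 1 then show ?thesis using z_eq lex_le_refl by metis
      next
        case 2
        then have "lex_less z (a(n := m))"
          unfolding lex_less_def using z_eq by (intro exI[of _ n]) (metis fun_upd_apply less_irrefl)
        then show ?thesis by (simp add: lex_le_iff)
      qed
    next
      assume le: "lex_le z (a(n := m))"
      show "z n \<le> m"
      proof (rule ccontr)
        assume "\<not> z n \<le> m"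
        then have "lex_less (a(n := m)) z"
          unfolding lex_less_def using z_eq by (intro exI[of _ n]) (metis fun_upd_apply less_irrefl not_less)
        with le show False by (metis not_lex_le)
      qed
    qed
    show ?thesis
    proof
      assume "lex_le z (a(n := m))"
      show "lex_le (e z) x"
      proof (cases "m = 0")
        case True
        then have "z = a" using \<open>lex_le z (a(n := m))\<close> le_iff z_eq a_n[of n]
          by (metis fun_upd_triv le_zero_eq order_refl)
        then show ?thesis using cut_a cuts_nonzero[OF z(3)] by blast
      next
        case False
        have "a(n := m) \<in> cuts_upto b (Suc n)"
          using a(1) m(1) False a_n
          by (auto simp: cuts_upto_def seqs_def trunc_id_iff fun_eq_iff[of _ "\<lambda>_. 0"] intro: exI[of _ n])
        then have "lex_le (e z) (e (a(n := m)))"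
          using e_mono z(3) \<open>lex_le z (a(n := m))\<close> cuts_upto_subset by blast
        then show ?thesis using m(2) False lex_le_trans by blast
      qed
    next
      assume "lex_le (e z) x"
      then have "z n \<le> m" using m_ge[of "z n"] z_eq z(1) by (simp add: seqs_def)
      then show "lex_le z (a(n := m))" using le_iff by blast
    qed
  next
    case False
    have tr: "trunc n (a(n := m)) = a" using a_n by (auto simp: trunc_def fun_eq_iff)
    have less: "lex_less z y" if "lex_less (trunc n z) (trunc n y)" for y
      using that trunc_mono[of y z n] by (metis not_lex_le)
    show ?thesis
    proof
      assume "lex_le z (a(n := m))"
      then have "lex_le (trunc n z) a" using trunc_mono[of z "a(n := m)" n] tr by simp
      with False have "lex_less (trunc n z) (trunc n a)" using a(2) by (simp add: lex_le_iff)
      then have "lex_less z a" by (rule less)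
      moreover have "a \<noteq> (\<lambda>_. 0)" using \<open>lex_less z a\<close> lex_le_zero by (metis not_lex_le)
      ultimately show "lex_le (e z) x" using e_mono[OF z(3) cut_a(1)] cut_a(2) lex_le_trans
        by (metis lex_le_iff)
    next
      assume ez: "lex_le (e z) x"
      have "lex_le (trunc n z) a"
      proof (cases "trunc n z = (\<lambda>_. 0)")
        case True then show ?thesis by (simp add: lex_le_zero)
      next
        case False
        then have c: "trunc n z \<in> cuts_upto b n" using z(1) by (intro trunc_in_cuts_upto)
        then have "lex_le (e (trunc n z)) (e z)" using e_mono z(3) trunc_le cuts_upto_subset by blast
        then show ?thesis using Suc.IH[OF c] ez lex_le_trans by (auto simp: a_def)
      qed
      with False have "lex_less (trunc n z) (trunc n (a(n := m)))" using tr by (simp add: lex_le_iff)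
      then show "lex_le z (a(n := m))" using less by (simp add: lex_le_iff)
    qed
  qed
  then show ?case unfolding approx.simps(2) a_def m_def fun_upd_def .
qed

text \<open>The digits of \<open>h x\<close> are those of the approximations. Monotonicity and
  continuity follow from the equivalence, since points are determined by the cuts up to them;
  surjectivity needs compactness.\<close>

lemma cut_extension: "\<exists>h\<in>Csur b. \<forall>z\<in>cuts b. \<forall>x\<in>seqs b. lex_le z (h x) \<longleftrightarrow> lex_le (e z) x"
proof -
  define h where "h = restrict (\<lambda>x n. approx b e x (Suc n) n) (seqs b)"
  have trunc_h: "trunc k (h x) = approx b e x k" if "x \<in> seqs b" for x k
  proof (induction k)
    case (Suc k)
    show ?case
    proof
      fix n
      show "trunc (Suc k) (h x) n = approx b e x (Suc k) n"
        using fun_cong[OF Suc, of n] fun_cong[OF approx_seqs(2)[of "Suc k" x], of n] that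
        by (cases n k rule: linorder_cases) (auto simp: trunc_def h_def)
    qed
  qed (auto simp: trunc_def)
  have hx: "h x \<in> seqs b" if "x \<in> seqs b" for x
  proof -
    have "approx b e x (Suc n) n < b" for n
      using approx_seqs(1)[of x "Suc n"] unfolding seqs_def by blast
    then show ?thesis using that by (simp add: h_def seqs_def del: approx.simps)
  qed
  have iff: "lex_le z (h x) \<longleftrightarrow> lex_le (e z) x" if z: "z \<in> cuts b" and x: "x \<in> seqs b" for z x
  proof -
    obtain k where "z \<in> cuts_upto b k" using z by (auto simp: cuts_def)
    then show ?thesis using approx_cut_iff[of z k x] trunc_h[OF x, of k] lex_le_trunc_cut[of z b k "h x"] by simp
  qed
  have mono: "lex_le (h x) (h y)" if "x \<in> seqs b" "y \<in> seqs b" "lex_le x y" for x y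
  proof (rule le_if_cuts[OF hx[OF that(1)]])
    fix z assume z: "z \<in> cuts b" "lex_le z (h x)"
    then have "lex_le (e z) x" using iff that(1) by simp
    then have "lex_le (e z) y" using that(3) by (rule lex_le_trans)
    then show "lex_le z (h y)" using iff z(1) that(2) by simp
  qed
  have bound: "\<exists>N. \<forall>z\<in>cuts_upto b K. e z \<in> cuts_upto b N" for K
  proof -
    have "\<exists>N. \<forall>z\<in>Z. e z \<in> cuts_upto b N" if "finite Z" "Z \<subseteq> cuts b" for Z
      using that
    proof (induction Z)
      case (insert z Z)
      then obtain N where N: "\<forall>z\<in>Z. e z \<in> cuts_upto b N" by blast
      obtain N' where N': "e z \<in> cuts_upto b N'" using e_cuts insert.prems by (auto simp: cuts_def)
      have "cuts_upto b N \<subseteq> cuts_upto b (max N N')" "cuts_upto b N' \<subseteq> cuts_upto b (max N N')"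
        by (auto simp: cuts_upto_def intro: trunc_id_mono)
      then show ?case using N N' by (intro exI[of _ "max N N'"]) blast
    qed simp
    from this[OF finite_cuts_upto[OF b] cuts_upto_subset] show ?thesis .
  qed
  have "continuous_map (seq_top b) (seq_top b) h"
  proof (subst continuous_map_seq_top_iff)
    show "h \<in> seqs b \<rightarrow> seqs b" using hx by blast
    show "\<forall>x\<in>seqs b. \<forall>K. \<exists>N. \<forall>y\<in>seqs b. trunc N x = trunc N y \<longrightarrow> trunc K (h x) = trunc K (h y)"
    proof (intro ballI allI)
      fix x K assume x: "x \<in> seqs b"
      obtain N where N: "\<forall>z\<in>cuts_upto b K. e z \<in> cuts_upto b N" using bound by blast
      have "trunc K (h x) = trunc K (h y)" if y: "y \<in> seqs b" "trunc N x = trunc N y" for y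
      proof -
        have "lex_le z (h x) \<longleftrightarrow> lex_le z (h y)" if z: "z \<in> cuts_upto b K" for z
        proof -
          have zc: "z \<in> cuts b" using z cuts_upto_subset by blast
          have "lex_le (e z) x \<longleftrightarrow> lex_le (e z) y"
            using N z y(2) lex_le_trunc_cut by metis
          then show ?thesis using iff[OF zc] x y(1) by simp
        qed
        then show ?thesis using hx x y(1) by (intro lex_le_antisym trunc_le_if_cuts[of _ b]) auto
      qed
      then show "\<exists>N. \<forall>y\<in>seqs b. trunc N x = trunc N y \<longrightarrow> trunc K (h x) = trunc K (h y)" by blast
    qed
  qed
  moreover have "y \<in> h ` seqs b" if y: "y \<in> seqs b" for y
  proof -
    \<comment> \<open>A preimage of \<open>y\<close> is a cluster point of the images of its
      truncations: for \<open>z\<close> of length at most \<open>n\<close>, \<open>e z\<close> is at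
      most \<open>e (trunc n y)\<close> iff \<open>z\<close> is at most \<open>y\<close>. The value
      zero covers vanishing truncations, which are not cuts.\<close>
    define xs where "xs n = (if trunc n y = (\<lambda>_. 0) then (\<lambda>_. 0) else e (trunc n y))" for n
    have tr: "trunc n y \<in> cuts b" if "trunc n y \<noteq> (\<lambda>_. 0)" for n
      using trunc_in_cuts_upto[OF y that] cuts_upto_subset by blast
    have "xs n \<in> seqs b" for n
      using b e_cuts[OF tr] cuts_subset_seqs by (auto simp: xs_def seqs_def)
    then obtain x where x: "x \<in> seqs b" "\<And>N. infinite {n. trunc N x = trunc N (xs n)}"
      using seqs_compact[of xs b] by blast
    have "lex_le z (h x) \<longleftrightarrow> lex_le z y" if z: "z \<in> cuts b" for z
    proof -
      obtain k where k: "z \<in> cuts_upto b k" using z by (auto simp: cuts_def)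
      obtain N where N: "e z \<in> cuts_upto b N" using e_cuts[OF z] by (auto simp: cuts_def)
      obtain n where n: "k \<le> n" "trunc N x = trunc N (xs n)"
        using x(2)[of N] unfolding infinite_nat_iff_unbounded_le by blast
      have "lex_le z (h x) \<longleftrightarrow> lex_le (e z) (xs n)"
        using iff[OF z x(1)] lex_le_trunc_cut[OF N] n(2) by metis
      also have "\<dots> \<longleftrightarrow> lex_le z y"
      proof
        assume le: "lex_le (e z) (xs n)"
        show "lex_le z y"
        proof (rule ccontr)
          assume "\<not> lex_le z y"
          then have "lex_less (trunc n y) z"
            using trunc_le[of n y] lex_le_trans[of z "trunc n y" y] by (metis not_lex_le)
          then have "lex_less (xs n) (e z)"
            using e_less[OF tr z] cuts_nonzero[OF e_cuts[OF z]] lex_le_zero[of "e z"]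
            by (auto simp: xs_def lex_le_iff)
          with le show False by (metis not_lex_le)
        qed
      next
        assume "lex_le z y"
        moreover have "trunc n z = z" using k n(1) by (auto simp: cuts_upto_def intro: trunc_id_mono)
        ultimately have le: "lex_le z (trunc n y)" by (simp add: lex_le_trunc_iff)
        then have nz: "trunc n y \<noteq> (\<lambda>_. 0)" using cuts_nonzero[OF z] lex_le_zero lex_le_antisym by metis
        then show "lex_le (e z) (xs n)" using e_mono[OF z tr[OF nz] le] by (simp add: xs_def)
      qed
      finally show ?thesis .
    qed
    then have "h x = y"
      using le_if_cuts[OF hx[OF x(1)], of y] le_if_cuts[OF y, of "h x"] by (intro lex_le_antisym) simp_all
    then show ?thesis using x(1) by blast
  qed
  moreover have "h \<in> seqs b \<rightarrow>\<^sub>E seqs b" using hx by (auto simp: h_def PiE_iff)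
  ultimately have "h \<in> Csur b" using hx mono unfolding Csur_def by auto
  then show ?thesis using iff by blast
qed

end

section \<open>Colouring sets of cuts\<close>

text \<open>The sequence \<open>u 1 0 0 0 \<dots>\<close>; it separates the extensions of \<open>u 0\<close> from those of \<open>u 1\<close>.\<close>

definition code_cut :: "bool list \<Rightarrow> nat \<Rightarrow> nat" where
  "code_cut u n = (if n < length u then of_bool (u ! n) else of_bool (n = length u))"

lemma code_cut_in_cuts:
  assumes "2 \<le> b"
  shows "code_cut u \<in> cuts b"
proof -
  have "code_cut u n < b" for n using assms by (simp add: code_cut_def)
  moreover have "code_cut u (length u) \<noteq> 0" by (simp add: code_cut_def)
  then have "code_cut u \<noteq> (\<lambda>_. 0)" by metis
  moreover have "trunc (Suc (length u)) (code_cut u) = code_cut u"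
    by (simp add: trunc_id_iff code_cut_def)
  ultimately have "code_cut u \<in> cuts_upto b (Suc (length u))" by (simp add: cuts_upto_def seqs_def)
  then show ?thesis using cuts_upto_subset by blast
qed

lemma code_cut_less:
  assumes "lex_left u w"
  shows "lex_less (code_cut u) (code_cut w)"
proof -
  obtain r u' w' where "u = r @ False # u'" "w = r @ True # w'" using assms by (auto simp: lex_left_def)
  then show ?thesis
    unfolding lex_less_def by (intro exI[of _ "length r"]) (auto simp: code_cut_def nth_append)
qed

lemma countable_cuts: "0 < b \<Longrightarrow> countable (cuts b)"
  unfolding cuts_def by (rule countable_UN) (simp_all add: countable_finite finite_cuts_upto)

lemma infinite_cuts:
  assumes "2 \<le> b"
  shows "infinite (cuts b)"
proof -
  have "inj (\<lambda>k. code_cut (replicate k False))"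
  proof (rule injI)
    fix k l assume eq: "code_cut (replicate k False) = code_cut (replicate l False)"
    have "code_cut (replicate k False) n = of_bool (n = k)" for k n by (simp add: code_cut_def)
    then show "k = l" using fun_cong[OF eq, of k] by (cases "k = l") simp_all
  qed
  then have "infinite (range (\<lambda>k. code_cut (replicate k False)))" by (rule range_inj_infinite)
  moreover have "range (\<lambda>k. code_cut (replicate k False)) \<subseteq> cuts b" using code_cut_in_cuts[OF assms] by blast
  ultimately show ?thesis using finite_subset by blast
qed

text \<open>The order of the cuts is transported to the naturals by an enumeration, and the leaves
  of the tree are turned back into cuts, which have digits 0 and 1 only.\<close>

lemma big_ramsey_cuts:
  fixes \<kappa> :: "(nat \<Rightarrow> nat) set \<Rightarrow> 'c"
  assumes b: "2 \<le> b" and "finite (range \<kappa>)" "0 < n"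
  obtains e where "\<And>z. z \<in> cuts b \<Longrightarrow> e z \<in> cuts b"
    "\<And>z z'. z \<in> cuts b \<Longrightarrow> z' \<in> cuts b \<Longrightarrow> lex_less z z' \<Longrightarrow> lex_less (e z) (e z')"
    "finite {\<kappa> (e ` S) | S. S \<subseteq> cuts b \<and> card S = n}"
    "card {\<kappa> (e ` S) | S. S \<subseteq> cuts b \<and> card S = n} \<le> path_count (2 * n - 1) 1"
proof -
  have cnt: "countable (cuts b)" using b by (intro countable_cuts) simp
  define idx where "idx = to_nat_on (cuts b)"
  have bij: "bij_betw idx (cuts b) UNIV"
    unfolding idx_def using cnt infinite_cuts[OF b] by (rule to_nat_on_infinite)
  define el where "el = the_inv_into (cuts b) idx"
  have el: "el i \<in> cuts b" "idx (el i) = i" for i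
    using bij the_inv_into_into[of idx "cuts b" i "cuts b"] f_the_inv_into_f_bij_betw[OF bij]
    by (auto simp: el_def bij_betw_def)
  have el_idx: "el (idx z) = z" if "z \<in> cuts b" for z
    using bij that by (simp add: el_def bij_betw_def the_inv_into_f_f)
  define lt where "lt i j = lex_less (el i) (el j)" for i j
  obtain \<phi> where \<phi>: "\<And>x y. lt x y \<Longrightarrow> lex_left (\<phi> x) (\<phi> y)"
    and fin: "finite {\<kappa> (code_cut ` \<phi> ` S) | S. card S = n}"
    and card: "card {\<kappa> (code_cut ` \<phi> ` S) | S. card S = n} \<le> path_count (2 * n - 1) 1"
  proof (rule big_ramsey_degree[of lt "\<lambda>W. \<kappa> (code_cut ` W)" n])
    show "\<not> lt x x" for x by (simp add: lt_def lex_less_irrefl)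
    show "lt x z" if "lt x y" "lt y z" for x y z using that lex_less_trans by (auto simp: lt_def)
    show "lt x y \<or> lt y x" if "x \<noteq> y" for x y
      unfolding lt_def by (rule lex_less_total) (use that el(2) in metis)
    show "finite (range (\<lambda>W. \<kappa> (code_cut ` W)))"
      using assms(2) by (rule finite_subset[rotated]) auto
    show "0 < n" by fact
    fix \<phi> assume \<phi>: "\<And>x y. lt x y \<Longrightarrow> lex_left (\<phi> x) (\<phi> y)"
      "finite {\<kappa> (code_cut ` \<phi> ` S) | S. card S = n}"
      "card {\<kappa> (code_cut ` \<phi> ` S) | S. card S = n} \<le> path_count (2 * n - 1) 1"
    show thesis by (rule that[OF \<phi>])
  qed
  define e where "e z = code_cut (\<phi> (idx z))" for z
  have sub: "{\<kappa> (e ` S) | S. S \<subseteq> cuts b \<and> card S = n} \<subseteq> {\<kappa> (code_cut ` \<phi> ` S) | S. card S = n}"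
  proof clarify
    fix S assume S: "S \<subseteq> cuts b" "n = card S"
    have "inj_on idx S" using bij S(1) by (auto simp: bij_betw_def intro: inj_on_subset)
    then have "card (idx ` S) = card S" by (rule card_image)
    moreover have "e ` S = code_cut ` \<phi> ` idx ` S" by (simp add: e_def image_image)
    ultimately show "\<exists>S'. \<kappa> (e ` S) = \<kappa> (code_cut ` \<phi> ` S') \<and> card S' = card S" by metis
  qed
  show ?thesis
  proof (rule that)
    show "e z \<in> cuts b" for z unfolding e_def using b by (rule code_cut_in_cuts)
    show "lex_less (e z) (e z')" if "z \<in> cuts b" "z' \<in> cuts b" "lex_less z z'" for z z'
      unfolding e_def using that by (intro code_cut_less \<phi>) (simp add: lt_def el_idx)
    show "finite {\<kappa> (e ` S) | S. S \<subseteq> cuts b \<and> card S = n}" using sub fin by (rule finite_subset)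
    show "card {\<kappa> (e ` S) | S. S \<subseteq> cuts b \<and> card S = n} \<le> path_count (2 * n - 1) 1"
      using card_mono[OF fin sub] card by simp
  qed
qed

section \<open>The covering estimate\<close>

lemma id_in_Csur: "restrict (\<lambda>x. x) (seqs b) \<in> Csur b"
proof -
  have "continuous_map (seq_top b) (seq_top b) (restrict (\<lambda>x. x) (seqs b))"
    by (subst continuous_map_seq_top_iff) auto
  then show ?thesis unfolding Csur_def by auto
qed

lemma rho_inf_le_1: "1 \<le> b \<Longrightarrow> rho_inf b f g \<le> 1"
  unfolding rho_inf_def by (intro cSUP_least seqs_nonempty rho_le_1)

text \<open>The \<open>+ 1\<close> in \<open>level\<close> gives a strict inequality even when
  \<open>1 / \<delta>\<close> is a power of two.\<close>

lemma half_power_level_less: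
  assumes "0 < \<delta>" "1 \<le> level \<delta>"
  shows "(1/2) ^ nat (level \<delta>) < \<delta>"
proof -
  have "log 2 (1 / \<delta>) < real_of_int (level \<delta>)" unfolding level_def by linarith
  also have "\<dots> = real (nat (level \<delta>))" using assms(2) by simp
  finally have "1 / \<delta> < 2 powr real (nat (level \<delta>))"
    using assms(1) by (subst (asm) log_less_iff) auto
  then have "1 / \<delta> < 2 ^ nat (level \<delta>)" by (simp add: powr_realpow)
  then show ?thesis using assms(1) by (simp add: power_one_over field_simps)
qed

lemma one_less_if_level_less:
  assumes "0 < \<delta>" "level \<delta> < 1"
  shows "1 < \<delta>"
proof -
  have "log 2 (1 / \<delta>) < 0" using assms(2) unfolding level_def by linarith
  then show ?thesis using assms(1) by (simp add: log_less_zero_cancel_iff)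
qed

lemma tangent_bound_nat:
  assumes "2 \<le> b"
  obtains t where "0 < t" "real t = tangent_bound b \<delta>"
    "1 \<le> level \<delta> \<Longrightarrow> t = path_count (2 * (b ^ nat (level \<delta>) - 1) - 1) 1"
proof (cases "1 \<le> level \<delta>")
  case True
  define n where "n = b ^ nat (level \<delta>) - 1"
  have "1 < b ^ nat (level \<delta>)" using assms True by (intro one_less_power) auto
  then have "2 * n - 1 = Suc (2 * (n - 1))" by (simp add: n_def)
  then have "0 < path_count (2 * n - 1) 1" using path_count_odd_pos by metis
  moreover have "real (path_count (2 * n - 1) 1) = tangent_bound b \<delta>"
    using True by (simp add: tangent_bound_def odd_tangent_number_eq n_def)
  ultimately show ?thesis using that by (simp add: n_def)
next
  case False
  then show ?thesis using that[of 1] by (simp add: tangent_bound_def)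
qed

text \<open>Keeping of \<open>f\<close> only the image of the cuts of length \<open>k\<close> costs
  at most 2^-k in \<open>rho_inf\<close>, hence less than \<open>\<epsilon> / 2\<close> in
  \<open>K\<close>. The colours left on the homogeneous copy are the centres of the covering
  balls.\<close>

lemma homogeneous_cover:
  fixes K :: "'a set"
  assumes b: "2 \<le> b" and M: "0 < M" and \<epsilon>: "0 < \<epsilon>"
    and k: "0 < k" "M * (1/2) ^ k < \<epsilon> / 2"
    and K: "Metric_space K d" and tb: "Metric_space.mtotally_bounded K d K"
    and c: "Lipschitz_between M (Csur b) (rho_inf b) K d c"
  shows "\<exists>h\<in>Csur b. \<exists>B. covering_number_le K d \<epsilon> (path_count (2 * (b ^ k - 1) - 1) 1) B \<and>
    (\<forall>f\<in>Csur b. c (compose (seqs b) f h) \<in> B)"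
proof -
  interpret Metric_space K d by (rule K)
  have cK: "c f \<in> K" if "f \<in> Csur b" for f using c that by (auto simp: Lipschitz_between_def)
  have lip: "d (c f) (c g) \<le> M * rho_inf b f g" if "f \<in> Csur b" "g \<in> Csur b" for f g
    using c that by (auto simp: Lipschitz_between_def)
  obtain A where A: "finite A" "A \<subseteq> K" "K \<subseteq> (\<Union>a\<in>A. mball a (\<epsilon> / 2))"
    using tb \<epsilon> unfolding mtotally_bounded_def by (meson half_gt_zero)
  have "\<exists>a. a \<in> A \<and> d a v < \<epsilon> / 2" if "v \<in> K" for v
  proof -
    obtain a where "a \<in> A" "v \<in> mball a (\<epsilon> / 2)" using A(3) \<open>v \<in> K\<close> by blast
    then show ?thesis by (intro exI[of _ a]) (simp add: in_mball)
  qed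
  then obtain net where net: "\<And>v. v \<in> K \<Longrightarrow> net v \<in> A \<and> d (net v) v < \<epsilon> / 2" by metis
  define n where "n = b ^ k - 1"
  have "1 < b ^ k" using b k(1) by (intro one_less_power) auto
  then have n: "0 < n" by (simp add: n_def)
  have b0: "0 < b" using b by simp
  let ?Z = "cuts_upto b k"
  \<comment> \<open>For a set \<open>W\<close> that is not such an image any map may be taken, for
    instance the identity, so that \<open>\<kappa>\<close> is total.\<close>
  have "\<exists>f. f \<in> Csur b \<and> ((\<exists>g\<in>Csur b. adj b g ` ?Z = W) \<longrightarrow> adj b f ` ?Z = W)" for W
    using id_in_Csur by blast
  then obtain rep where rep: "\<And>W. rep W \<in> Csur b"
    and rep_image: "\<And>W. \<exists>g\<in>Csur b. adj b g ` ?Z = W \<Longrightarrow> adj b (rep W) ` ?Z = W"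
    by metis
  have rep_eq: "adj b (rep (adj b f ` ?Z)) ` ?Z = adj b f ` ?Z" if "f \<in> Csur b" for f
    using that by (intro rep_image) blast
  define \<kappa> where "\<kappa> W = net (c (rep W))" for W
  have \<kappa>_A: "\<kappa> W \<in> A" for W unfolding \<kappa>_def using net[OF cK[OF rep]] by blast
  \<comment> \<open>One half of \<open>\<epsilon>\<close> pays for replacing \<open>f\<close> by the
    representative with the same image, the other half for rounding to the net.\<close>
  have near: "d (\<kappa> (adj b f ` ?Z)) (c f) < \<epsilon>" if f: "f \<in> Csur b" for f
  proof -
    let ?g = "rep (adj b f ` ?Z)"
    have "d (c ?g) (c f) \<le> M * rho_inf b ?g f" using rep f by (rule lip)
    also have "\<dots> \<le> M * (1/2) ^ k"
      using M rho_inf_le_if_adj_image_eq[OF rep f rep_eq[OF f] b0] by simp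
    finally have "d (c ?g) (c f) < \<epsilon> / 2" using k(2) by simp
    moreover have "d (net (c ?g)) (c ?g) < \<epsilon> / 2" "net (c ?g) \<in> K" using net[OF cK[OF rep]] A(2) by auto
    ultimately show ?thesis
      using triangle[of "net (c ?g)" "c ?g" "c f"] cK[OF rep] cK[OF f] by (simp add: \<kappa>_def)
  qed
  have "range \<kappa> \<subseteq> A" using \<kappa>_A by blast
  then have "finite (range \<kappa>)" using A(1) by (rule finite_subset)
  then obtain e where e: "\<And>z. z \<in> cuts b \<Longrightarrow> e z \<in> cuts b"
    "\<And>z z'. z \<in> cuts b \<Longrightarrow> z' \<in> cuts b \<Longrightarrow> lex_less z z' \<Longrightarrow> lex_less (e z) (e z')"
    and fin: "finite {\<kappa> (e ` S) | S. S \<subseteq> cuts b \<and> card S = n}"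
    and card: "card {\<kappa> (e ` S) | S. S \<subseteq> cuts b \<and> card S = n} \<le> path_count (2 * n - 1) 1"
    using big_ramsey_cuts[OF b _ n, of \<kappa>] by blast
  obtain h where h: "h \<in> Csur b"
    "\<And>z x. z \<in> cuts b \<Longrightarrow> x \<in> seqs b \<Longrightarrow> lex_le z (h x) \<longleftrightarrow> lex_le (e z) x"
    using cut_extension[where e = e, OF b0 e] by blast
  define C where "C = {\<kappa> (e ` S) | S. S \<subseteq> cuts b \<and> card S = n}"
  define B where "B = (\<Union>a\<in>C. mball a \<epsilon>)"
  have "C \<subseteq> K" using \<kappa>_A A(2) by (auto simp: C_def)
  then have "covering_number_le K d \<epsilon> (path_count (2 * n - 1) 1) B"
    unfolding covering_number_le_def B_def using fin card by (auto simp: C_def)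
  moreover have "c (compose (seqs b) f h) \<in> B" if f: "f \<in> Csur b" for f
  proof -
    let ?g = "compose (seqs b) f h"
    have g: "?g \<in> Csur b" using f h(1) by (rule Csur_compose)
    \<comment> \<open>Adjoints compose in reverse order, and \<open>e\<close> is the adjoint of
      \<open>h\<close>; so the colour of the composition is that of the \<open>e\<close>-image of an
      \<open>n\<close>-set of cuts.\<close>
    have "adj b ?g z = e (adj b f z)" if z: "z \<in> cuts b" for z
    proof (rule adj_eqI[OF g z])
      have az: "adj b f z \<in> cuts b" using f z by (rule adj)
      then show "e (adj b f z) \<in> seqs b" using e(1) cuts_subset_seqs by blast
      fix x assume x: "x \<in> seqs b"
      then have "h x \<in> seqs b" using h(1) by (rule CsurD(3)[rotated])
      then show "lex_le z (?g x) \<longleftrightarrow> lex_le (e (adj b f z)) x"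
        using adj(2)[OF f z, of "h x"] h(2)[OF az x] x by (simp add: compose_eq)
    qed
    then have eq: "adj b ?g ` ?Z = e ` (adj b f ` ?Z)"
      unfolding image_image using cuts_upto_subset by (intro image_cong refl) blast
    have "adj b f ` ?Z \<subseteq> cuts b" using adj(1)[OF f] cuts_upto_subset by blast
    moreover have "card (adj b f ` ?Z) = n"
      using card_image[OF inj_on_subset[OF inj_adj[OF f] cuts_upto_subset]] card_cuts_upto[OF b0]
      by (simp add: n_def)
    ultimately have "\<kappa> (adj b ?g ` ?Z) \<in> C" unfolding eq C_def by blast
    moreover have "c ?g \<in> mball (\<kappa> (adj b ?g ` ?Z)) \<epsilon>"
      using near[OF g] cK[OF g] \<kappa>_A A(2) by auto
    ultimately show ?thesis unfolding B_def by blast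
  qed
  ultimately show ?thesis using h(1) unfolding n_def by blast
qed

theorem corollary3:
  fixes b :: nat
  assumes "b \<ge> 2"
  shows "\<forall>(\<epsilon>::real) (M::real). \<epsilon> > 0 \<longrightarrow> M > 0 \<longrightarrow>
    (\<exists>t::nat. t > 0 \<and> real t = tangent_bound b (\<epsilon> / (2 * M)) \<and>
      (\<forall>(K::'a set) d c.
         Metric_space K d \<longrightarrow> Metric_space.mtotally_bounded K d K \<longrightarrow>
         Lipschitz_between M (Csur b) (rho_inf b) K d c \<longrightarrow>
         (\<exists>h\<in>Csur b. \<exists>B. covering_number_le K d \<epsilon> t B \<and>
            (\<forall>f\<in>Csur b. c (compose (seqs b) f h) \<in> B))))"
proof (intro allI impI)
  fix \<epsilon> M :: real assume \<epsilon>: "0 < \<epsilon>" and M: "0 < M"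
  define \<delta> where "\<delta> = \<epsilon> / (2 * M)"
  have \<delta>: "0 < \<delta>" "M * \<delta> = \<epsilon> / 2" using \<epsilon> M by (simp_all add: \<delta>_def)
  obtain t where t: "0 < t" "real t = tangent_bound b \<delta>"
    and t_eq: "1 \<le> level \<delta> \<Longrightarrow> t = path_count (2 * (b ^ nat (level \<delta>) - 1) - 1) 1"
    using tangent_bound_nat[OF assms] by blast
  have "\<exists>h\<in>Csur b. \<exists>B. covering_number_le K d \<epsilon> t B \<and> (\<forall>f\<in>Csur b. c (compose (seqs b) f h) \<in> B)"
    if K: "Metric_space K d" "Metric_space.mtotally_bounded K d K"
      and c: "Lipschitz_between M (Csur b) (rho_inf b) K d c"
    for K :: "'a set" and d c
  proof (cases "1 \<le> level \<delta>")
    case True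
    have "M * (1/2) ^ nat (level \<delta>) < \<epsilon> / 2"
      using mult_strict_left_mono[OF half_power_level_less[OF \<delta>(1) True] M] \<delta>(2) by simp
    then show ?thesis
      using homogeneous_cover[OF assms M \<epsilon> _ _ K c, of "nat (level \<delta>)"] True t_eq by simp
  next
    \<comment> \<open>Here \<open>\<delta> > 1\<close>, so \<open>M < \<epsilon>\<close>. As
      \<open>rho_inf\<close> is at most 1, one ball contains all values, and the identity serves as
      \<open>h\<close>.\<close>
    case False
    interpret Metric_space K d by (rule K)
    let ?i = "restrict (\<lambda>x. x) (seqs b)"
    have i: "?i \<in> Csur b" by (rule id_in_Csur)
    have cK: "c f \<in> K" if "f \<in> Csur b" for f using c that by (auto simp: Lipschitz_between_def)
    have "M < \<epsilon>" using one_less_if_level_less[OF \<delta>(1)] False \<delta> M \<epsilon>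
      by (simp add: \<delta>_def less_divide_eq)
    have "c f \<in> mball (c ?i) \<epsilon>" if f: "f \<in> Csur b" for f
    proof -
      have "d (c ?i) (c f) \<le> M * rho_inf b ?i f" using c i f unfolding Lipschitz_between_def by blast
      also have "\<dots> \<le> M" using M rho_inf_le_1[of b ?i f] assms by simp
      finally show ?thesis using \<open>M < \<epsilon>\<close> cK i f by simp
    qed
    then have "\<forall>f\<in>Csur b. c (compose (seqs b) f ?i) \<in> mball (c ?i) \<epsilon>" using Csur_compose i by blast
    moreover have "covering_number_le K d \<epsilon> t (mball (c ?i) \<epsilon>)"
      unfolding covering_number_le_def using t(1) cK[OF i]
      by (intro conjI exI[of _ "{c ?i}"]) auto
    ultimately show ?thesis using i by blast
  qed
  with t show "\<exists>t::nat. t > 0 \<and> real t = tangent_bound b (\<epsilon> / (2 * M)) \<and>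
      (\<forall>(K::'a set) d c. Metric_space K d \<longrightarrow> Metric_space.mtotally_bounded K d K \<longrightarrow>
         Lipschitz_between M (Csur b) (rho_inf b) K d c \<longrightarrow>
         (\<exists>h\<in>Csur b. \<exists>B. covering_number_le K d \<epsilon> t B \<and>
            (\<forall>f\<in>Csur b. c (compose (seqs b) f h) \<in> B)))"
    unfolding \<delta>_def by blast
qed

end
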